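(* Let $K$ be a field. The following two assertions are equivalent, that is, each implies the other. (A) For all integers $n\ge 1$ and $s\ge 1$, if $\mathfrak{m}=(x_1,\dots,x_n)$ denotes the irrelevant maximal ideal of $R=K[x_1,\dots,x_n]$, then $$\operatorname{Hdepth}(\mathfrak{m}^s)=\left\lceil \frac{n}{s+1}\right\rceil .$$ (B) For all integers $n\ge d\ge 1$, if $I_{n,d}$ denotes the squarefree Veronese ideal generated by all squarefree monomials of degree $d$ in $R=K[x_1,\dots,x_n]$, then $$\operatorname{Hdepth}(I_{n,d})=d-1+\left\lceil \frac{n-(d-1)}{d+1}\right\rceil .$$
   Context: Polynomial rings over $K$ carry the standard grading ($\deg x_i=1$), and ideals are regarded as graded modules over the polynomial ring in which they live. Hilbert depth: let $R=K[x_1,\dots,x_n]$ and let $M$ be a finitely generated graded $R$-module. A Hilbert decomposition of $M$ is a finite family $\mathscr{H}=(S_i,s_i)$ such that $s_i\in\mathbb{Z}$, each $S_i$ is a graded $K$-algebra retract of $R$ (i.e. a graded $K$-algebra with graded $K$-algebra homomorphisms $S_i\to R\to S_i$ whose composition is the identity), and $M\cong\bigoplus_i S_i(-s_i)$ as graded $K$-vector spaces. Put $\operatorname{Hdepth}\mathscr{H}=\min_i \operatorname{depth} S_i(-s_i)$. The Hilbert depth of $M$ is $\operatorname{Hdepth} M=\max\{\operatorname{Hdepth}\mathscr{H} : \mathscr{H}\text{ is a Hilbert decomposition of } M\}$. *)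

theory Defs
  imports
    Complex_Main
    "HOL-Library.Extended_Nat"
    "HOL-Library.Poly_Mapping"
    "HOL-Algebra.Module"
    "HOL-Algebra.Ideal_Product"
begin

section \<open>Graded vector spaces, graded algebras and retracts\<close>

text \<open>
  One record serves for graded modules and graded algebras. As for the library record
  \<^type>\<open>module\<close>, the ring multiplication and unit are part of the record but are ignored when
  it is used as a module.
\<close>

record ('a, 'b) graded = "('a, 'b) module" +
  component :: "int \<Rightarrow> 'b set"

definition graded_module :: "('a, 'm) ring_scheme \<Rightarrow> ('a, 'b) graded \<Rightarrow> bool" where
  "graded_module K M \<longleftrightarrow>
     module K M \<and>
     (\<forall>j. submodule (component M j) K M) \<and>
     (\<forall>x \<in> carrier M. \<exists>!c :: int \<Rightarrow> 'b.
        (\<forall>j. c j \<in> component M j) \<and> finite {j. c j \<noteq> \<zero>\<^bsub>M\<^esub>} \<and>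
        x = (\<Oplus>\<^bsub>M\<^esub>j \<in> {j. c j \<noteq> \<zero>\<^bsub>M\<^esub>}. c j))"

definition graded_algebra :: "('a, 'm) ring_scheme \<Rightarrow> ('a, 'b) graded \<Rightarrow> bool" where
  "graded_algebra K S \<longleftrightarrow>
     algebra K S \<and> graded_module K S \<and>
     \<one>\<^bsub>S\<^esub> \<in> component S 0 \<and>
     (\<forall>i j. \<forall>x \<in> component S i. \<forall>y \<in> component S j. x \<otimes>\<^bsub>S\<^esub> y \<in> component S (i + j))"

definition graded_algebra_hom ::
  "('a, 'm) ring_scheme \<Rightarrow> ('a, 'b) graded \<Rightarrow> ('a, 'c) graded \<Rightarrow> ('b \<Rightarrow> 'c) set" where
  "graded_algebra_hom K S T =
     {h \<in> ring_hom S T.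
        (\<forall>a \<in> carrier K. \<forall>x \<in> carrier S. h (a \<odot>\<^bsub>S\<^esub> x) = a \<odot>\<^bsub>T\<^esub> h x) \<and>
        (\<forall>j. h ` component S j \<subseteq> component T j)}"

definition graded_retract ::
  "('a, 'm) ring_scheme \<Rightarrow> ('a, 'b) graded \<Rightarrow> ('a, 'c) graded \<Rightarrow> bool" where
  "graded_retract K R S \<longleftrightarrow>
     graded_algebra K S \<and>
     (\<exists>f \<in> graded_algebra_hom K S R. \<exists>g \<in> graded_algebra_hom K R S.
        \<forall>x \<in> carrier S. g (f x) = x)"

definition shift :: "('a, 'b) graded \<Rightarrow> int \<Rightarrow> ('a, 'b) graded" where
  "shift M a = M\<lparr>component := \<lambda>j. component M (a + j)\<rparr>"

text \<open>External direct sum of the family \<open>N\<close> over the finite index set \<open>I\<close>.\<close>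

definition direct_sum :: "'i set \<Rightarrow> ('i \<Rightarrow> ('a, 'b) graded) \<Rightarrow> ('a, 'i \<Rightarrow> 'b) graded" where
  "direct_sum I N =
     \<lparr>carrier = (\<Pi>\<^sub>E i\<in>I. carrier (N i)),
      mult = undefined,
      one = undefined,
      zero = (\<lambda>i\<in>I. \<zero>\<^bsub>N i\<^esub>),
      add = (\<lambda>x y. \<lambda>i\<in>I. x i \<oplus>\<^bsub>N i\<^esub> y i),
      smult = (\<lambda>a x. \<lambda>i\<in>I. a \<odot>\<^bsub>N i\<^esub> x i),
      component = (\<lambda>j. \<Pi>\<^sub>E i\<in>I. component (N i) j)\<rparr>"

definition graded_isomorphic ::
  "('a, 'm) ring_scheme \<Rightarrow> ('a, 'b) graded \<Rightarrow> ('a, 'c) graded \<Rightarrow> bool" where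
  "graded_isomorphic K M N \<longleftrightarrow>
     (\<exists>h. bij_betw h (carrier M) (carrier N) \<and>
        (\<forall>x \<in> carrier M. \<forall>y \<in> carrier M. h (x \<oplus>\<^bsub>M\<^esub> y) = h x \<oplus>\<^bsub>N\<^esub> h y) \<and>
        (\<forall>a \<in> carrier K. \<forall>x \<in> carrier M. h (a \<odot>\<^bsub>M\<^esub> x) = a \<odot>\<^bsub>N\<^esub> h x) \<and>
        (\<forall>j. h ` component M j = component N j))"


section \<open>Depth\<close>

text \<open>The submodule \<open>(f\<^sub>1, \<dots>, f\<^sub>r) N\<close> of the \<open>A\<close>-module \<open>N\<close>.\<close>

definition seq_submodule :: "('b, 'c, 'm) module_scheme \<Rightarrow> 'b list \<Rightarrow> 'c set" where
  "seq_submodule N fs =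
     {\<Oplus>\<^bsub>N\<^esub>i \<in> {..<length fs}. (fs ! i) \<odot>\<^bsub>N\<^esub> y i | y. y \<in> {..<length fs} \<rightarrow> carrier N}"

text \<open>
  The condition on \<open>x\<close> says that \<open>fs ! i\<close> is a nonzerodivisor on the quotient of \<open>N\<close> by the
  submodule generated by the preceding elements.
\<close>

definition regular_sequence :: "('b, 'c, 'm) module_scheme \<Rightarrow> 'b list \<Rightarrow> bool" where
  "regular_sequence N fs \<longleftrightarrow>
     (\<forall>i < length fs. \<forall>x \<in> carrier N.
        (fs ! i) \<odot>\<^bsub>N\<^esub> x \<in> seq_submodule N (take i fs) \<longrightarrow> x \<in> seq_submodule N (take i fs)) \<and>
     seq_submodule N fs \<noteq> carrier N"

definition irrelevant_ideal :: "('a, 'b) graded \<Rightarrow> 'b set" where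
  "irrelevant_ideal A = Idl\<^bsub>A\<^esub> (\<Union>j \<in> {0<..}. component A j)"

definition depth :: "('a, 'b) graded \<Rightarrow> ('b, 'c) graded \<Rightarrow> enat" where
  "depth A N =
     (SUP fs \<in> {fs. set fs \<subseteq> irrelevant_ideal A \<and> regular_sequence N fs}. enat (length fs))"

definition self_module :: "('a, 'b) graded \<Rightarrow> ('b, 'b) graded" where
  "self_module S =
     \<lparr>carrier = carrier S, mult = mult S, one = one S, zero = zero S, add = add S,
      smult = mult S, component = component S\<rparr>"


section \<open>Hilbert decompositions and Hilbert depth\<close>

text \<open>
  A family \<open>(S\<^sub>i, s\<^sub>i)\<close> is a list of pairs. The retracts are abstract graded algebras whose
  elements are taken from the type of the elements of \<open>R\<close>; up to isomorphism this covers every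
  retract, since the homomorphism from \<open>S\<^sub>i\<close> to \<open>R\<close> is injective. Of the \<open>R\<close>-module \<open>M\<close> only the
  underlying graded \<open>K\<close>-vector space enters.
\<close>

definition hilbert_decomposition ::
  "('a, 'm) ring_scheme \<Rightarrow> ('a, 'b) graded \<Rightarrow> ('a, 'c) graded
     \<Rightarrow> (('a, 'b) graded \<times> int) list \<Rightarrow> bool" where
  "hilbert_decomposition K R M H \<longleftrightarrow>
     (\<forall>(S, s) \<in> set H. graded_retract K R S) \<and>
     graded_isomorphic K M
       (direct_sum {..<length H} (\<lambda>i. shift (fst (H ! i)) (- snd (H ! i))))"

text \<open>
  The module \<open>S(-s)\<close> is regarded as a graded module over \<open>S\<close>. Over \<open>R\<close>, via the surjection
  from \<open>R\<close> to \<open>S\<close>, it has the same depth.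
  For a nonempty family the infimum is the minimum of finitely many depths. The supremum in
  \<open>Hdepth\<close> is attained whenever it is finite and nonzero, hence it is then the maximum.
\<close>

definition Hdepth_of :: "(('a, 'b) graded \<times> int) list \<Rightarrow> enat" where
  "Hdepth_of H = (INF (S, s) \<in> set H. depth S (shift (self_module S) (- s)))"

definition Hdepth ::
  "('a, 'm) ring_scheme \<Rightarrow> ('a, 'b) graded \<Rightarrow> ('a, 'c) graded \<Rightarrow> enat" where
  "Hdepth K R M = (SUP H \<in> {H. hilbert_decomposition K R M H}. Hdepth_of H)"


section \<open>Polynomial rings and their ideals\<close>

type_synonym 'a mpoly = "(nat \<Rightarrow>\<^sub>0 nat) \<Rightarrow>\<^sub>0 'a"

definition field_ring :: "'a::field ring" where
  "field_ring = \<lparr>carrier = UNIV, mult = (*), one = 1, zero = 0, add = (+)\<rparr>"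

definition var :: "nat \<Rightarrow> 'a::field mpoly" where
  "var i = Poly_Mapping.single (Poly_Mapping.single i 1) 1"

definition monomial_degree :: "(nat \<Rightarrow>\<^sub>0 nat) \<Rightarrow> nat" where
  "monomial_degree m = (\<Sum>i \<in> Poly_Mapping.keys m. Poly_Mapping.lookup m i)"

definition polys :: "nat \<Rightarrow> 'a::field mpoly set" where
  "polys n = {p. \<forall>m \<in> Poly_Mapping.keys p. Poly_Mapping.keys m \<subseteq> {..<n}}"

text \<open>The variables of \<open>poly_ring n\<close> are \<open>var 0, \<dots>, var (n - 1)\<close>.\<close>

definition poly_ring :: "nat \<Rightarrow> ('a::field, 'a mpoly) graded" where
  "poly_ring n =
     \<lparr>carrier = polys n, mult = (*), one = 1, zero = 0, add = (+),
      smult = (\<lambda>a p. Poly_Mapping.single 0 a * p),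
      component = (\<lambda>j. {p \<in> polys n. \<forall>m \<in> Poly_Mapping.keys p. int (monomial_degree m) = j})\<rparr>"

definition maximal_ideal :: "nat \<Rightarrow> 'a::field mpoly set" where
  "maximal_ideal n = Idl\<^bsub>poly_ring n\<^esub> (var ` {..<n})"

definition squarefree_veronese :: "nat \<Rightarrow> nat \<Rightarrow> 'a::field mpoly set" where
  "squarefree_veronese n d =
     Idl\<^bsub>poly_ring n\<^esub> {\<Prod>i\<in>A. var i | A. A \<subseteq> {..<n} \<and> card A = d}"

definition ideal_module :: "('a, 'b) graded \<Rightarrow> 'b set \<Rightarrow> ('a, 'b) graded" where
  "ideal_module R I = R\<lparr>carrier := I, component := \<lambda>j. I \<inter> component R j\<rparr>"

text \<open>The Hilbert depth of an ideal \<open>I\<close> of \<open>K[x\<^sub>1, \<dots>, x\<^sub>n]\<close>, where \<open>K\<close> is the field \<open>'a\<close>.\<close>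

definition Hdepth_ideal :: "nat \<Rightarrow> 'a::field mpoly set \<Rightarrow> enat" where
  "Hdepth_ideal n I = Hdepth field_ring (poly_ring n) (ideal_module (poly_ring n) I)"

end

theory Submission
  imports Defs
begin

text \<open>
  The Hilbert depth of a monomial ideal depends only on its Hilbert series. A graded retract \<open>S\<close> of
  \<open>K[x\<^sub>1, \<dots>, x\<^sub>n]\<close> is again a polynomial ring, in some \<open>k \<le> n\<close> variables of degree one
  (\<open>graded_retract_poly_ring\<close>), so that its Hilbert series is \<open>(1 - t)\<^bsup>-k\<^esup>\<close> and its depth is \<open>k\<close>
  (\<open>depth_le_of_iso\<close>, \<open>depth_poly_ring_ge\<close>). Two graded vector spaces with finite-dimensional
  components are isomorphic iff their Hilbert functions agree. Hence a Hilbert decomposition of the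
  ideal is the same thing as a way of writing its Hilbert series as a finite sum of terms
  \<open>t\<^bsup>s\<^esup> (1 - t)\<^bsup>-k\<^esup>\<close> with \<open>k \<le> n\<close>, and the Hilbert depth is the largest possible minimum of the
  exponents \<open>k\<close> (\<open>Hdepth_monomial_ideal\<close>).

  The equivalence then comes from one identity of Hilbert series. Let \<open>\<mm>\<close> be the irrelevant maximal
  ideal. For \<open>m \<ge> 1\<close> and \<open>d = e + 1\<close>, the series of \<open>\<mm>\<^bsup>d\<^esup>\<close> in \<open>m\<close> variables and the series of the squarefree Veronese ideal
  \<open>I\<^bsub>m+e,d\<^esub>\<close> are
  \<open>\<Sum>\<^bsub>i<m\<^esub> (d + i - 1 choose i) t\<^bsup>d\<^esup> (1 - t)\<^bsup>-(m-i)\<^esup>\<close> and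
  \<open>\<Sum>\<^bsub>i<m\<^esub> (d + i - 1 choose i) t\<^bsup>d\<^esup> (1 - t)\<^bsup>-(m-i)-e\<^esup>\<close>,
  so that they differ by the factor \<open>(1 - t)\<^bsup>e\<^esup>\<close> (\<open>hilbert_high\<close>, \<open>hilbert_wide\<close>). Multiplication by this
  factor turns a decomposition of the second series all of whose exponents are at least \<open>e\<close> into a
  decomposition of the first, and the inverse operation always applies in the other direction.
  The decompositions with an exponent below \<open>e\<close> do not influence the maximum. Therefore
  \<open>Hdepth I\<^bsub>m+e,d\<^esub> = e + Hdepth \<mm>\<^bsup>d\<^esup>\<close>, which is \<open>Hdepth_squarefree_veronese_eq\<close>; the substitution
  \<open>n = m + d - 1\<close> matches the two closed formulas.
\<close>

section \<open>Counting monomials\<close>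

definition monomials :: "nat \<Rightarrow> (nat \<Rightarrow>\<^sub>0 nat) set" where
  "monomials n = {m. Poly_Mapping.keys m \<subseteq> {..<n}}"

text \<open>
  The monomials of the squarefree Veronese ideal of degree \<open>d\<close>: such a monomial is divisible by a
  squarefree monomial of degree \<open>d\<close> iff its support has at least \<open>d\<close> elements.
\<close>

definition wide_monomials :: "nat \<Rightarrow> nat \<Rightarrow> (nat \<Rightarrow>\<^sub>0 nat) set" where
  "wide_monomials n d = {m \<in> monomials n. d \<le> card (Poly_Mapping.keys m)}"

definition high_monomials :: "nat \<Rightarrow> nat \<Rightarrow> (nat \<Rightarrow>\<^sub>0 nat) set" where
  "high_monomials n s = {m \<in> monomials n. s \<le> monomial_degree m}"

text \<open>
  The Hilbert function of the graded vector space with basis \<open>X\<close>, where \<open>x\<close> has degree \<open>dg x\<close>.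
  Degrees are integers throughout, so that the shift by one degree is invertible and all
  functions vanish far to the left.
\<close>

definition hilbert_fun :: "('x \<Rightarrow> int) \<Rightarrow> 'x set \<Rightarrow> int \<Rightarrow> nat" where
  "hilbert_fun dg X j = card {x \<in> X. dg x = j}"

abbreviation mdeg :: "(nat \<Rightarrow>\<^sub>0 nat) \<Rightarrow> int" where
  "mdeg m \<equiv> int (monomial_degree m)"

abbreviation count_monomials :: "nat \<Rightarrow> int \<Rightarrow> nat" where
  "count_monomials k \<equiv> hilbert_fun mdeg (monomials k)"

lemma keys_add_nat: "Poly_Mapping.keys (a + b) = Poly_Mapping.keys a \<union> Poly_Mapping.keys (b :: 'x \<Rightarrow>\<^sub>0 nat)"
  by (auto simp: in_keys_iff lookup_add)

lemma monomial_degree_superset: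
  assumes "finite A" "Poly_Mapping.keys m \<subseteq> A"
  shows "monomial_degree m = (\<Sum>i\<in>A. Poly_Mapping.lookup m i)"
  unfolding monomial_degree_def
  by (rule sum.mono_neutral_left) (use assms in \<open>auto simp: in_keys_iff\<close>)

lemma monomial_degree_add: "monomial_degree (a + b) = monomial_degree a + monomial_degree b"
  by (simp add: monomial_degree_superset[of "Poly_Mapping.keys a \<union> Poly_Mapping.keys b"]
      keys_add_nat lookup_add sum.distrib)

lemma monomial_degree_zero [simp]: "monomial_degree 0 = 0"
  by (simp add: monomial_degree_def)

lemma monomial_degree_single [simp]: "monomial_degree (Poly_Mapping.single i c) = c"
  by (simp add: monomial_degree_def)

lemma monomial_degree_eq_0_iff: "monomial_degree m = 0 \<longleftrightarrow> m = 0"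
  by (auto simp: monomial_degree_def in_keys_iff intro!: poly_mapping_eqI)

lemma lookup_le_monomial_degree: "Poly_Mapping.lookup m i \<le> monomial_degree m"
proof (cases "i \<in> Poly_Mapping.keys m")
  case True
  then show ?thesis unfolding monomial_degree_def
    by (intro member_le_sum) auto
qed (simp add: in_keys_iff)

lemma monomials_add [simp]: "a + b \<in> monomials n \<longleftrightarrow> a \<in> monomials n \<and> b \<in> monomials n"
  by (auto simp: monomials_def keys_add_nat)

lemma monomials_0 [simp]: "0 \<in> monomials n"
  by (simp add: monomials_def)

lemma monomials_single [simp]:
  "Poly_Mapping.single i c \<in> monomials n \<longleftrightarrow> c = 0 \<or> i < n"
  by (auto simp: monomials_def)

text \<open>A monomial in \<open>k\<close> variables is determined by its tuple of exponents.\<close>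

lemma card_monomials_bounded:
  "finite {m \<in> monomials k. \<forall>i. Poly_Mapping.lookup m i < N}"
  "card {m \<in> monomials k. \<forall>i. Poly_Mapping.lookup m i < N} \<le> N ^ k"
  "N > 0 \<Longrightarrow> N ^ k \<le> card {m \<in> monomials k. \<forall>i. Poly_Mapping.lookup m i < N}"
proof -
  let ?B = "{m \<in> monomials k. \<forall>i. Poly_Mapping.lookup m i < N}"
  let ?P = "{..<k} \<rightarrow>\<^sub>E {..<N}"
  let ?r = "\<lambda>m. restrict (Poly_Mapping.lookup m) {..<k}"
  have fin: "finite ?P" and cardP: "card ?P = N ^ k"
    by (simp_all add: finite_PiE card_PiE)
  have inj: "inj_on ?r ?B"
  proof (rule inj_onI)
    fix a b assume a: "a \<in> ?B" and b: "b \<in> ?B" and eq: "?r a = ?r b"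
    show "a = b"
    proof (rule poly_mapping_eqI)
      fix i
      show "Poly_Mapping.lookup a i = Poly_Mapping.lookup b i"
      proof (cases "i < k")
        case True
        then show ?thesis using fun_cong[OF eq, of i] by simp
      next
        case False
        then have "i \<notin> Poly_Mapping.keys a" "i \<notin> Poly_Mapping.keys b"
          using a b by (auto simp: monomials_def)
        then show ?thesis by (simp add: in_keys_iff)
      qed
    qed
  qed
  have sub: "?r ` ?B \<subseteq> ?P" by (intro image_subsetI restrict_PiE_iff[THEN iffD2]) simp
  show "finite ?B" by (rule finite_imageD[OF finite_subset[OF sub fin] inj])
  show "card ?B \<le> N ^ k"
    using card_inj_on_le[OF inj sub fin] cardP by simp
  show "N ^ k \<le> card ?B" if "N > 0"
  proof -
    have "?P \<subseteq> ?r ` ?B"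
    proof
      fix f assume f: "f \<in> ?P"
      define m where "m = Abs_poly_mapping (\<lambda>i. if i < k then f i else 0)"
      have "finite {i. (if i < k then f i else 0) \<noteq> 0}"
        by (rule finite_subset[of _ "{..<k}"]) auto
      then have lk: "Poly_Mapping.lookup m = (\<lambda>i. if i < k then f i else 0)"
        by (simp add: m_def)
      have "Poly_Mapping.keys m \<subseteq> {..<k}"
        by (rule subsetI) (simp add: in_keys_iff lk split: if_splits)
      moreover have "Poly_Mapping.lookup m i < N" for i
        using PiE_mem[OF f, of i] \<open>N > 0\<close> unfolding lk by simp
      ultimately have "m \<in> ?B" by (simp add: monomials_def)
      moreover have "?r m = f"
      proof
        fix i show "?r m i = f i"
          using PiE_arb[OF f, of i] by (cases "i < k") (simp_all add: lk)
      qed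
      ultimately show "f \<in> ?r ` ?B" by blast
    qed
    from card_mono[OF finite_imageI[OF \<open>finite ?B\<close>] this]
    show ?thesis unfolding card_image[OF inj] cardP .
  qed
qed

lemma finite_monomials_degree: "finite {m \<in> monomials n. mdeg m = j}"
proof (rule finite_subset)
  show "{m \<in> monomials n. mdeg m = j}
      \<subseteq> {m \<in> monomials n. \<forall>i. Poly_Mapping.lookup m i < Suc (nat j)}"
    using lookup_le_monomial_degree by (auto simp: less_Suc_eq_le)
qed (rule card_monomials_bounded)

lemma hilbert_fun_neg: "j < 0 \<Longrightarrow> hilbert_fun mdeg X j = 0"
  unfolding hilbert_fun_def by (auto simp: card_eq_0_iff)

lemma monomial_times_var:
  fixes m :: "nat \<Rightarrow>\<^sub>0 nat"
  assumes "Poly_Mapping.lookup m i \<noteq> 0"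
  obtains m' where "m = m' + Poly_Mapping.single i 1"
proof
  show "m = (m - Poly_Mapping.single i 1) + Poly_Mapping.single i 1"
    using assms by (intro poly_mapping_eqI) (auto simp: lookup_add lookup_minus lookup_single when_def)
qed

lemma inj_times_var: "inj_on (\<lambda>m. m + Poly_Mapping.single i (1::nat)) X"
  by (auto simp: inj_on_def)

lemma monomials_Suc_iff: "m \<in> monomials n \<longleftrightarrow> m \<in> monomials (Suc n) \<and> Poly_Mapping.lookup m n = 0"
proof -
  have "n \<notin> Poly_Mapping.keys m \<longleftrightarrow> Poly_Mapping.lookup m n = 0" by (simp add: in_keys_iff)
  then show ?thesis unfolding monomials_def lessThan_Suc by auto
qed

text \<open>
  This is \<open>(1 - t)\<^bsup>-(n+1)\<^esup> (1 - t) = (1 - t)\<^bsup>-n\<^esup>\<close> for coefficients: a monomial either avoids the last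
  variable or is divisible by it.
\<close>

lemma count_monomials_Suc:
  "count_monomials (Suc n) j = count_monomials n j + count_monomials (Suc n) (j - 1)"
proof -
  let ?x = "Poly_Mapping.single n (1::nat)"
  let ?A = "\<lambda>n j. {m \<in> monomials n. mdeg m = j}"
  have eq: "?A (Suc n) j = ?A n j \<union> (\<lambda>m. m + ?x) ` ?A (Suc n) (j - 1)"
  proof (intro equalityI subsetI)
    fix m assume m: "m \<in> ?A (Suc n) j"
    show "m \<in> ?A n j \<union> (\<lambda>m. m + ?x) ` ?A (Suc n) (j - 1)"
    proof (cases "Poly_Mapping.lookup m n = 0")
      case True
      then show ?thesis using m by (simp add: monomials_Suc_iff[of m n])
    next
      case False
      then obtain m' where "m = m' + ?x" by (rule monomial_times_var)
      then show ?thesis using m by (auto simp: monomial_degree_add)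
    qed
  next
    fix m assume "m \<in> ?A n j \<union> (\<lambda>m. m + ?x) ` ?A (Suc n) (j - 1)"
    then show "m \<in> ?A (Suc n) j"
      by (auto simp: monomials_Suc_iff[of _ n] monomial_degree_add)
  qed
  have "?A n j \<inter> (\<lambda>m. m + ?x) ` ?A (Suc n) (j - 1) = {}"
    by (auto simp: monomials_Suc_iff[of _ n] lookup_add)
  then show ?thesis
    unfolding hilbert_fun_def eq
    by (simp add: card_Un_disjoint finite_monomials_degree card_image inj_times_var)
qed

lemma finite_wide: "finite {m \<in> wide_monomials n d. mdeg m = j}"
  by (rule finite_subset[OF _ finite_monomials_degree[of n j]]) (auto simp: wide_monomials_def)

text \<open>
  The monomials are sorted by the exponent of the last variable. Exponent \<open>0\<close> leaves the condition on
  the support to the other variables. Exponent \<open>1\<close> contributes one variable to the support. If the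
  exponent is at least \<open>2\<close>, then division by the variable preserves the support and gives a
  monomial that still contains the variable; those are counted by a difference, and the subtracted
  term is moved to the left-hand side.
\<close>

lemma wide_monomials_rec:
  "hilbert_fun mdeg (wide_monomials (Suc n) (Suc d)) j
     + hilbert_fun mdeg (wide_monomials n (Suc d)) (j - 1) =
   hilbert_fun mdeg (wide_monomials n (Suc d)) j + hilbert_fun mdeg (wide_monomials n d) (j - 1)
     + hilbert_fun mdeg (wide_monomials (Suc n) (Suc d)) (j - 1)"
proof -
  let ?x = "Poly_Mapping.single n (1::nat)"
  let ?A = "\<lambda>n d j. {m \<in> wide_monomials n d. mdeg m = j}"
  let ?W = "?A (Suc n) (Suc d) (j - 1) - ?A n (Suc d) (j - 1)"
  let ?M = "\<lambda>X. (\<lambda>m. m + ?x) ` X"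
  have n_notin: "n \<notin> Poly_Mapping.keys m" if "m \<in> monomials n" for m
    using that by (auto simp: monomials_def)
  have wide0: "m \<in> wide_monomials n e \<longleftrightarrow> m \<in> wide_monomials (Suc n) e \<and> Poly_Mapping.lookup m n = 0"
    for m e by (auto simp: wide_monomials_def monomials_Suc_iff[of m n])
  \<comment> \<open>Exponent of the last variable equal to 0, equal to 1, and at least 2.\<close>
  have eq: "?A (Suc n) (Suc d) j = ?A n (Suc d) j \<union> ?M (?A n d (j - 1)) \<union> ?M ?W"
  proof (intro equalityI subsetI)
    fix m assume m: "m \<in> ?A (Suc n) (Suc d) j"
    show "m \<in> ?A n (Suc d) j \<union> ?M (?A n d (j - 1)) \<union> ?M ?W"
    proof (cases "Poly_Mapping.lookup m n = 0")
      case True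
      then show ?thesis using m by (simp add: wide0)
    next
      case False
      then obtain m' where m': "m = m' + ?x" by (rule monomial_times_var)
      then have mm: "m' \<in> monomials (Suc n)" "mdeg m' = j - 1"
        using m by (auto simp: monomial_degree_add wide_monomials_def)
      show ?thesis
      proof (cases "Poly_Mapping.lookup m' n = 0")
        case True
        then have mn: "m' \<in> monomials n" using mm by (simp add: monomials_Suc_iff[of m' n])
        have "Poly_Mapping.keys m = insert n (Poly_Mapping.keys m')"
          by (simp add: m' keys_add_nat)
        then have "m' \<in> ?A n d (j - 1)"
          using m mn mm n_notin[OF mn] by (auto simp: wide_monomials_def)
        then show ?thesis using m' by blast
      next
        case False
        then have "Poly_Mapping.keys m = Poly_Mapping.keys m'"
          by (auto simp: m' keys_add_nat in_keys_iff)
        then have "m' \<in> ?W"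
          using m mm False by (auto simp: wide0) (auto simp: wide_monomials_def)
        then show ?thesis using m' by blast
      qed
    qed
  next
    fix m assume "m \<in> ?A n (Suc d) j \<union> ?M (?A n d (j - 1)) \<union> ?M ?W"
    then consider "m \<in> ?A n (Suc d) j" | m' where "m' \<in> ?A n d (j - 1)" "m = m' + ?x"
      | m' where "m' \<in> ?W" "m = m' + ?x" by blast
    then show "m \<in> ?A (Suc n) (Suc d) j"
    proof cases
      case 1
      then show ?thesis by (simp add: wide0)
    next
      case 2
      then have "Poly_Mapping.keys m = insert n (Poly_Mapping.keys m')" "n \<notin> Poly_Mapping.keys m'"
        using n_notin by (auto simp: keys_add_nat wide_monomials_def)
      then show ?thesis using 2
        by (auto simp: wide_monomials_def monomial_degree_add monomials_Suc_iff[of m' n])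
    next
      case 3
      then have "Poly_Mapping.lookup m' n \<noteq> 0" by (auto simp: wide0)
      then have "Poly_Mapping.keys m = Poly_Mapping.keys m'"
        by (auto simp: 3 keys_add_nat in_keys_iff)
      then show ?thesis using 3 by (auto simp: wide_monomials_def monomial_degree_add)
    qed
  qed
  have lk: "Poly_Mapping.lookup m n = 0" if "m \<in> ?A n e i" for m e i
    using that by (simp add: wide0)
  have lkW: "Poly_Mapping.lookup m n \<noteq> 0" if "m \<in> ?W" for m
    using that by (auto simp: wide0)
  have lkM: "Poly_Mapping.lookup (m + ?x) n = Suc (Poly_Mapping.lookup m n)" for m
    by (simp add: lookup_add)
  have disj1: "?A n (Suc d) j \<inter> ?M (?A n d (j - 1)) = {}"
  proof (rule equals0I)
    fix a assume "a \<in> ?A n (Suc d) j \<inter> ?M (?A n d (j - 1))"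
    then obtain b where "a \<in> ?A n (Suc d) j" "a = b + ?x" by auto
    with lk[of a] lkM[of b] show False by auto
  qed
  have disj2: "(?A n (Suc d) j \<union> ?M (?A n d (j - 1))) \<inter> ?M ?W = {}"
  proof (rule equals0I)
    fix a assume a: "a \<in> (?A n (Suc d) j \<union> ?M (?A n d (j - 1))) \<inter> ?M ?W"
    then obtain w where w: "w \<in> ?W" "a = w + ?x" by blast
    from a have "a \<in> ?A n (Suc d) j \<or> (\<exists>b \<in> ?A n d (j - 1). a = b + ?x)" by blast
    then show False
    proof
      assume "a \<in> ?A n (Suc d) j"
      from lk[OF this] lkM[of w] w show False by simp
    next
      assume "\<exists>b \<in> ?A n d (j - 1). a = b + ?x"
      then obtain b where "b \<in> ?A n d (j - 1)" "a = b + ?x" by blast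
      with lk[OF this(1)] lkM[of b] lkM[of w] w lkW[OF w(1)] show False by simp
    qed
  qed
  have sub: "?A n (Suc d) (j - 1) \<subseteq> ?A (Suc n) (Suc d) (j - 1)"
    by (auto simp: wide0)
  have "card (?A (Suc n) (Suc d) j)
      = card (?A n (Suc d) j) + card (?A n d (j - 1)) + card ?W"
    unfolding eq using disj1 disj2
    by (simp add: card_Un_disjoint finite_wide card_image inj_times_var)
  moreover have "card ?W + card (?A n (Suc d) (j - 1)) = card (?A (Suc n) (Suc d) (j - 1))"
    using sub by (simp add: card_Diff_subset finite_wide card_mono)
  ultimately show ?thesis unfolding hilbert_fun_def by simp
qed

text \<open>
  The coefficients of the series
  \<open>\<Sum>\<^bsub>i<m\<^esub> (d + i - 1 choose i) t\<^bsup>d\<^esup> (1 - t)\<^bsup>-(m-i)-e\<^esup>\<close>. For \<open>e = 0\<close> its terms are those of the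
  Stanley decomposition of the \<open>d\<close>-th power of the maximal ideal in \<open>m\<close> variables: a monomial of degree
  at least \<open>d\<close> is uniquely a product \<open>u v\<close> with \<open>u\<close> of degree \<open>d\<close> and with all variables of \<open>v\<close> at or
  after the last variable of \<open>u\<close>. There are \<open>d + i - 1 choose i\<close> monomials \<open>u\<close> of degree \<open>d\<close> whose last
  variable is the \<open>(i + 1)\<close>-st one, and each leaves \<open>m - i\<close> variables for \<open>v\<close>.
  For \<open>d = 0\<close> truncated subtraction makes the coefficient \<open>1\<close> at \<open>i = 0\<close> and \<open>0\<close> elsewhere.
\<close>

definition stanley_sum :: "nat \<Rightarrow> nat \<Rightarrow> nat \<Rightarrow> int \<Rightarrow> nat" where
  "stanley_sum m d e j = (\<Sum>i<m. ((d + i - 1) choose i) * count_monomials (m - i + e) (j - int d))"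

text \<open>
  Passing from \<open>e\<close> to \<open>e + 1\<close> divides the series by \<open>1 - t\<close>.
\<close>

lemma stanley_sum_integrate:
  "stanley_sum m d (Suc e) j = stanley_sum m d e j + stanley_sum m d (Suc e) (j - 1)"
proof -
  have "count_monomials (m - i + Suc e) (j - int d)
      = count_monomials (m - i + e) (j - int d) + count_monomials (m - i + Suc e) (j - 1 - int d)" for i
    using count_monomials_Suc[of "m - i + e" "j - int d"] by (simp add: algebra_simps)
  then show ?thesis unfolding stanley_sum_def
    by (simp only: distrib_left sum.distrib)
qed

lemma stanley_sum_Suc_0: "stanley_sum (Suc m) 0 e j = count_monomials (Suc m + e) j"
proof -
  have "stanley_sum (Suc m) 0 e j = (\<Sum>i<Suc m. if i = 0 then count_monomials (Suc m + e) j else 0)"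
    unfolding stanley_sum_def by (rule sum.cong) (auto simp: binomial_eq_0)
  then show ?thesis by simp
qed

lemma stanley_sum_pascal:
  "stanley_sum (Suc m) (Suc d) e j = stanley_sum (Suc m) d e (j - 1) + stanley_sum m (Suc d) e j"
proof -
  have pas: "(Suc d + Suc i - 1) choose Suc i = ((d + Suc i - 1) choose Suc i) + ((Suc d + i - 1) choose i)" for i
    by simp
  have "stanley_sum (Suc m) (Suc d) e j
      = count_monomials (Suc m + e) (j - 1 - int d)
        + (\<Sum>i<m. ((Suc d + Suc i - 1) choose Suc i) * count_monomials (m - i + e) (j - int (Suc d)))"
    unfolding stanley_sum_def sum.lessThan_Suc_shift by (simp add: algebra_simps)
  also have "\<dots> = count_monomials (Suc m + e) (j - 1 - int d)
        + (\<Sum>i<m. ((d + Suc i - 1) choose Suc i) * count_monomials (m - i + e) (j - 1 - int d))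
        + stanley_sum m (Suc d) e j"
    unfolding pas stanley_sum_def by (simp add: sum.distrib algebra_simps)
  also have "\<dots> = stanley_sum (Suc m) d e (j - 1) + stanley_sum m (Suc d) e j"
    unfolding stanley_sum_def sum.lessThan_Suc_shift by simp
  finally show ?thesis .
qed

lemma count_monomials_0: "count_monomials 0 j = (if j = 0 then 1 else 0)"
proof -
  have "{m \<in> monomials 0. mdeg m = j} = (if j = 0 then {0} else {})"
    by (auto simp: monomials_def)
  then show ?thesis by (simp add: hilbert_fun_def)
qed

lemma stanley_sum_0_left: "stanley_sum 0 d e j = 0"
  by (simp add: stanley_sum_def)

text \<open>
  Both sides satisfy the recursion that Pascal's rule gives for the sum: a monomial of degree at
  least \<open>d\<close> either avoids the last variable or, after division by it, has degree at least \<open>d - 1\<close>.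
  The only excluded case is \<open>m = d = 0\<close>, where the sum is empty but the monomial \<open>1\<close> exists.
\<close>

lemma stanley_sum_power:
  assumes "m + d > 0"
  shows "stanley_sum m d 0 j = (if int d \<le> j then count_monomials m j else 0)"
  using assms
proof (induction "m + d" arbitrary: m d j rule: less_induct)
  case less
  show ?case
  proof (cases m)
    case 0
    then show ?thesis using less.prems by (simp add: stanley_sum_0_left count_monomials_0)
  next
    case m: (Suc m')
    show ?thesis
    proof (cases d)
      case 0
      then show ?thesis by (simp add: m stanley_sum_Suc_0 hilbert_fun_neg)
    next
      case d: (Suc d')
      have "stanley_sum m d 0 j = stanley_sum m d' 0 (j - 1) + stanley_sum m' d 0 j"
        using stanley_sum_pascal[of m' d' 0 j] by (simp add: m d)
      also have "\<dots> = (if int d \<le> j then count_monomials m (j - 1) else 0)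
          + (if int d \<le> j then count_monomials m' j else 0)"
        using less.hyps[of m d' "j - 1"] less.hyps[of m' d j] by (simp add: m d)
      finally show ?thesis using count_monomials_Suc[of m' j] by (simp add: m)
    qed
  qed
qed

lemma hilbert_high: 
  assumes "m + d > 0"
  shows "hilbert_fun mdeg (high_monomials m d) j = stanley_sum m d 0 j"
proof -
  have "{x \<in> high_monomials m d. mdeg x = j} = (if int d \<le> j then {x \<in> monomials m. mdeg x = j} else {})"
    by (auto simp: high_monomials_def)
  then show ?thesis using assms by (simp add: stanley_sum_power hilbert_fun_def)
qed

text \<open>
  Induction for functions that vanish far to the left: equality of first differences implies
  equality.
\<close>

lemma int_induct_from:
  fixes P :: "int \<Rightarrow> bool"
  assumes "\<And>j. j < b \<Longrightarrow> P j" and "\<And>j. P (j - 1) \<Longrightarrow> P j"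
  shows "P j"
proof (cases "j < b")
  case False
  then have "b - 1 \<le> j" by simp
  then show ?thesis
  proof (induction j rule: int_ge_induct)
    case base
    then show ?case using assms(1) by simp
  next
    case (step i)
    then show ?case using assms(2)[of "i + 1"] by simp
  qed
qed (rule assms)

lemma stanley_sum_neg: "j < 0 \<Longrightarrow> stanley_sum m d e j = 0"
  by (simp add: stanley_sum_def hilbert_fun_neg)

text \<open>
  Taking first differences in \<open>wide_monomials_rec\<close> gives a recursion in which the term for one variable
  and one support element less appears undifferentiated. The sum satisfies the same recursion by
  Pascal's rule, because \<open>stanley_sum_integrate\<close> turns the difference for \<open>e = d + 1\<close> into the sum for
  \<open>e = d\<close>. The outer induction is on \<open>d\<close>, the next on the number of variables, and the innermost on
  the degree, which undoes the difference. The exponent shift \<open>d\<close> on the right is what separates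
  this series from that of the power of the maximal ideal.
\<close>

lemma hilbert_wide:
  "hilbert_fun mdeg (wide_monomials (m + d) (Suc d)) j = stanley_sum m (Suc d) d j"
proof (induction d arbitrary: m j)
  case 0
  \<comment> \<open>The support is nonempty iff the degree is positive.\<close>
  have "wide_monomials m (Suc 0) = high_monomials m (Suc 0)"
    unfolding wide_monomials_def high_monomials_def
    using monomial_degree_eq_0_iff by (auto simp: Suc_le_eq card_gt_0_iff)
  then show ?case by (simp add: hilbert_high)
next
  case (Suc d)
  note IHd = Suc.IH
  show ?case
  proof (induction m arbitrary: j)
    case 0
    have "wide_monomials (Suc d) (Suc (Suc d)) = {}"
    proof -
      have "card (Poly_Mapping.keys x) \<le> Suc d" if "x \<in> monomials (Suc d)" for x
        using card_mono[of "{..<Suc d}" "Poly_Mapping.keys x"] that by (simp add: monomials_def)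
      then show ?thesis by (force simp: wide_monomials_def)
    qed
    then show ?case by (simp add: stanley_sum_0_left hilbert_fun_def)
  next
    case (Suc m)
    show ?case
    proof (induction j rule: int_induct_from[where b = 0])
      case (1 j)
      then show ?case by (simp add: hilbert_fun_neg stanley_sum_neg)
    next
      case (2 j)
      have "hilbert_fun mdeg (wide_monomials (Suc m + Suc d) (Suc (Suc d))) j
          + stanley_sum m (Suc (Suc d)) (Suc d) (j - 1)
          = stanley_sum m (Suc (Suc d)) (Suc d) j + stanley_sum (Suc m) (Suc d) d (j - 1)
            + stanley_sum (Suc m) (Suc (Suc d)) (Suc d) (j - 1)"
        using wide_monomials_rec[of "m + Suc d" "Suc d" j] Suc.IH 2 IHd[of "Suc m" "j - 1"]
        by simp
      moreover have "stanley_sum (Suc m) (Suc (Suc d)) (Suc d) j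
          = stanley_sum (Suc m) (Suc d) (Suc d) (j - 1) + stanley_sum m (Suc (Suc d)) (Suc d) j"
        by (rule stanley_sum_pascal)
      moreover have "stanley_sum (Suc m) (Suc (Suc d)) (Suc d) (j - 1)
          = stanley_sum (Suc m) (Suc d) (Suc d) (j - 1 - 1) + stanley_sum m (Suc (Suc d)) (Suc d) (j - 1)"
        by (rule stanley_sum_pascal)
      moreover have "stanley_sum (Suc m) (Suc d) (Suc d) (j - 1)
          = stanley_sum (Suc m) (Suc d) d (j - 1) + stanley_sum (Suc m) (Suc d) (Suc d) (j - 1 - 1)"
        by (rule stanley_sum_integrate)
      ultimately show ?case by simp
    qed
  qed
qed

section \<open>Polynomials and substitution\<close>

definition supported :: "'x set \<Rightarrow> ('x \<Rightarrow>\<^sub>0 'a::zero) set" where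
  "supported X = {p. Poly_Mapping.keys p \<subseteq> X}"

lemma polys_eq_supported: "polys n = supported (monomials n)"
  by (auto simp: polys_def supported_def monomials_def)

lemma supported_iff: "p \<in> supported X \<longleftrightarrow> (\<forall>x. x \<notin> X \<longrightarrow> Poly_Mapping.lookup p x = 0)"
  by (auto simp: supported_def in_keys_iff)

lemma supported_0 [simp]: "0 \<in> supported X"
  by (simp add: supported_iff)

lemma supported_add: "p \<in> supported X \<Longrightarrow> q \<in> supported X \<Longrightarrow> p + q \<in> supported X"
  by (simp add: supported_iff lookup_add)

lemma supported_diff:
  fixes p q :: "'x \<Rightarrow>\<^sub>0 'a::ab_group_add"
  shows "p \<in> supported X \<Longrightarrow> q \<in> supported X \<Longrightarrow> p - q \<in> supported X"
  by (simp add: supported_iff lookup_minus)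

lemma supported_uminus:
  fixes p :: "'x \<Rightarrow>\<^sub>0 'a::ab_group_add"
  shows "p \<in> supported X \<Longrightarrow> - p \<in> supported X"
  by (simp add: supported_iff)

lemma supported_sum: "(\<And>i. i \<in> A \<Longrightarrow> f i \<in> supported X) \<Longrightarrow> sum f A \<in> supported X"
  by (simp add: supported_iff lookup_sum)

lemma supported_single [simp]: "Poly_Mapping.single x c \<in> supported X \<longleftrightarrow> c = 0 \<or> x \<in> X"
  by (auto simp: supported_def)

lemma supported_mult:
  assumes "p \<in> supported X" "q \<in> supported Y" "\<And>x y. x \<in> X \<Longrightarrow> y \<in> Y \<Longrightarrow> x + y \<in> Z"
  shows "p * q \<in> supported Z"
  using assms keys_mult[of p q] by (fastforce simp: supported_def)

lemma sum_singles: "(\<Sum>x\<in>Poly_Mapping.keys p. Poly_Mapping.single x (Poly_Mapping.lookup p x)) = p"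
  by (rule poly_mapping_eqI)
    (simp add: lookup_sum lookup_single when_def in_keys_iff)

definition part :: "'x set \<Rightarrow> ('x \<Rightarrow>\<^sub>0 'a::zero) \<Rightarrow> ('x \<Rightarrow>\<^sub>0 'a)" where
  "part X p = Poly_Mapping.mapp (\<lambda>x c. c when x \<in> X) p"

lemma lookup_part: "Poly_Mapping.lookup (part X p) x = (Poly_Mapping.lookup p x when x \<in> X)"
  by (auto simp: part_def lookup_mapp when_def in_keys_iff)

lemma part_supported: "part X p \<in> supported X"
  by (simp add: supported_iff lookup_part)

lemma const_mult_lookup:
  fixes p :: "'x::monoid_add \<Rightarrow>\<^sub>0 'a::comm_semiring_1"
  shows "Poly_Mapping.lookup (Poly_Mapping.single 0 a * p) x = a * Poly_Mapping.lookup p x"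
  by (simp add: map.rep_eq when_def flip: mult_map_scale_conv_mult)

lemma supported_const_mult:
  fixes p :: "'x::monoid_add \<Rightarrow>\<^sub>0 'a::comm_semiring_1"
  shows "p \<in> supported X \<Longrightarrow> Poly_Mapping.single 0 a * p \<in> supported X"
  by (simp add: supported_iff const_mult_lookup)

lemma polys_closed:
  "0 \<in> polys n" "1 \<in> polys n" "Poly_Mapping.single 0 a \<in> polys n"
  "p \<in> polys n \<Longrightarrow> q \<in> polys n \<Longrightarrow> p + q \<in> polys n"
  "p \<in> polys n \<Longrightarrow> q \<in> polys n \<Longrightarrow> p - q \<in> polys n"
  "p \<in> polys n \<Longrightarrow> - p \<in> polys n"
  "p \<in> polys n \<Longrightarrow> q \<in> polys n \<Longrightarrow> p * q \<in> polys n"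
  "i < n \<Longrightarrow> var i \<in> polys n"
  unfolding polys_eq_supported
        apply (simp_all add: supported_add supported_diff supported_uminus var_def
      flip: single_one)
  by (erule (1) supported_mult) simp

lemma polys_sum: "(\<And>i. i \<in> A \<Longrightarrow> f i \<in> polys n) \<Longrightarrow> sum f A \<in> polys n"
  unfolding polys_eq_supported by (rule supported_sum)

lemma polys_var_less:
  "p \<in> polys n \<Longrightarrow> m \<in> Poly_Mapping.keys p \<Longrightarrow> i \<in> Poly_Mapping.keys m \<Longrightarrow> i < n"
  by (auto simp: polys_def)

lemma polys_mono:
  assumes "k \<le> n"
  shows "polys k \<subseteq> polys n"
proof
  fix p assume p: "p \<in> polys k"
  have "i < n" if "m \<in> Poly_Mapping.keys p" "i \<in> Poly_Mapping.keys m" for m i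
    using polys_var_less[OF p that] assms by simp
  then show "p \<in> polys n" unfolding polys_def by auto
qed

definition homogeneous :: "nat \<Rightarrow> int \<Rightarrow> 'a::field mpoly set" where
  "homogeneous n j = supported {m \<in> monomials n. mdeg m = j}"

lemma homogeneous_polys: "homogeneous n j \<subseteq> polys n"
  by (auto simp: homogeneous_def polys_eq_supported supported_def)

lemma poly_ring_simps [simp]:
  "carrier (poly_ring n) = polys n" "mult (poly_ring n) = (*)" "one (poly_ring n) = 1"
  "zero (poly_ring n) = 0" "add (poly_ring n) = (+)"
  "smult (poly_ring n) = (\<lambda>a p. Poly_Mapping.single 0 a * p)"
  "component (poly_ring n) = homogeneous n"
  by (auto simp: poly_ring_def homogeneous_def fun_eq_iff polys_eq_supported supported_def)

lemma field_ring_simps [simp]: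
  "carrier field_ring = UNIV" "mult field_ring = (*)" "one field_ring = 1"
  "zero field_ring = 0" "add field_ring = (+)"
  by (auto simp: field_ring_def)

lemma homogeneous_closed:
  "0 \<in> homogeneous n j" "1 \<in> homogeneous n 0"
  "p \<in> homogeneous n j \<Longrightarrow> q \<in> homogeneous n j \<Longrightarrow> p + q \<in> homogeneous n j"
  "p \<in> homogeneous n j \<Longrightarrow> - p \<in> homogeneous n j"
  "p \<in> homogeneous n j \<Longrightarrow> Poly_Mapping.single 0 a * p \<in> homogeneous n j"
  "p \<in> homogeneous n j \<Longrightarrow> q \<in> homogeneous n l \<Longrightarrow> p * q \<in> homogeneous n (j + l)"
  "i < n \<Longrightarrow> var i \<in> homogeneous n 1"
  unfolding homogeneous_def
        apply (simp_all add: supported_add supported_uminus var_def supported_const_mult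
      flip: single_one)
  by (erule (1) supported_mult) (simp add: monomial_degree_add)

lemma homogeneous_sum: "(\<And>i. i \<in> A \<Longrightarrow> f i \<in> homogeneous n j) \<Longrightarrow> sum f A \<in> homogeneous n j"
  unfolding homogeneous_def by (rule supported_sum)

subsection \<open>Substitution homomorphisms\<close>

definition mon_eval :: "(nat \<Rightarrow> 'b::comm_monoid_mult) \<Rightarrow> (nat \<Rightarrow>\<^sub>0 nat) \<Rightarrow> 'b" where
  "mon_eval \<sigma> m = (\<Prod>i\<in>Poly_Mapping.keys m. \<sigma> i ^ Poly_Mapping.lookup m i)"

definition subst :: "(nat \<Rightarrow> 'a::field mpoly) \<Rightarrow> 'a mpoly \<Rightarrow> 'a mpoly" where
  "subst \<sigma> p = (\<Sum>m\<in>Poly_Mapping.keys p. Poly_Mapping.single 0 (Poly_Mapping.lookup p m) * mon_eval \<sigma> m)"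

lemma mon_eval_superset:
  assumes "finite A" "Poly_Mapping.keys m \<subseteq> A"
  shows "mon_eval \<sigma> m = (\<Prod>i\<in>A. \<sigma> i ^ Poly_Mapping.lookup m i)"
  unfolding mon_eval_def
  by (rule prod.mono_neutral_left) (use assms in \<open>auto simp: in_keys_iff\<close>)

lemma mon_eval_add: "mon_eval \<sigma> (a + b) = mon_eval \<sigma> a * mon_eval \<sigma> b"
  by (simp add: mon_eval_superset[of "Poly_Mapping.keys a \<union> Poly_Mapping.keys b"]
      keys_add_nat lookup_add prod.distrib power_add)

lemma mon_eval_0 [simp]: "mon_eval \<sigma> 0 = 1"
  by (simp add: mon_eval_def)

lemma mon_eval_single [simp]: "mon_eval \<sigma> (Poly_Mapping.single i c) = \<sigma> i ^ c"
  by (simp add: mon_eval_def)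

lemma mon_eval_cong: "(\<And>i. i \<in> Poly_Mapping.keys m \<Longrightarrow> \<sigma> i = \<tau> i) \<Longrightarrow> mon_eval \<sigma> m = mon_eval \<tau> m"
  by (simp add: mon_eval_def)

lemma subst_superset:
  assumes "finite A" "Poly_Mapping.keys p \<subseteq> A"
  shows "subst \<sigma> p = (\<Sum>m\<in>A. Poly_Mapping.single 0 (Poly_Mapping.lookup p m) * mon_eval \<sigma> m)"
  unfolding subst_def
  by (rule sum.mono_neutral_left) (use assms in \<open>auto simp: in_keys_iff\<close>)

lemma subst_add: "subst \<sigma> (p + q) = subst \<sigma> p + subst \<sigma> q"
proof -
  let ?A = "Poly_Mapping.keys p \<union> Poly_Mapping.keys q"
  have "Poly_Mapping.keys (p + q) \<subseteq> ?A" by (rule keys_add)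
  then show ?thesis
    by (simp add: subst_superset[of ?A] lookup_add single_add distrib_right sum.distrib)
qed

lemma subst_0 [simp]: "subst \<sigma> 0 = 0"
  by (simp add: subst_def)

lemma subst_sum: "subst \<sigma> (sum f A) = (\<Sum>i\<in>A. subst \<sigma> (f i))"
  by (induction A rule: infinite_finite_induct) (simp_all add: subst_add)

lemma subst_single: "subst \<sigma> (Poly_Mapping.single m c) = Poly_Mapping.single 0 c * mon_eval \<sigma> m"
  by (simp add: subst_def)

lemma subst_mult: "subst \<sigma> (p * q) = subst \<sigma> p * subst \<sigma> q"
proof -
  let ?s = "\<lambda>p m. Poly_Mapping.single m (Poly_Mapping.lookup p m)"
  have mono: "subst \<sigma> (Poly_Mapping.single a b * Poly_Mapping.single c d) =
      subst \<sigma> (Poly_Mapping.single a b) * subst \<sigma> (Poly_Mapping.single c d)" for a b c d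
  proof -
    have "Poly_Mapping.single 0 (b * d) = Poly_Mapping.single 0 b * (Poly_Mapping.single 0 d :: 'a mpoly)"
      by (simp add: mult_single)
    then show ?thesis by (simp add: mult_single subst_single mon_eval_add mult_ac)
  qed
  have "subst \<sigma> (sum (?s p) (Poly_Mapping.keys p) * sum (?s q) (Poly_Mapping.keys q))
      = subst \<sigma> (sum (?s p) (Poly_Mapping.keys p)) * subst \<sigma> (sum (?s q) (Poly_Mapping.keys q))"
    unfolding sum_product subst_sum mono ..
  then show ?thesis by (simp only: sum_singles)
qed

lemma subst_const [simp]: "subst \<sigma> (Poly_Mapping.single 0 c) = Poly_Mapping.single 0 c"
  by (simp add: subst_single)

lemma subst_1 [simp]: "subst \<sigma> 1 = 1"
  using subst_const[of \<sigma> 1] by simp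

lemma subst_var [simp]: "subst \<sigma> (var i) = \<sigma> i"
  by (simp add: var_def subst_single)

lemma subst_power: "subst \<sigma> (p ^ k) = subst \<sigma> p ^ k"
  by (induction k) (simp_all add: subst_mult)

lemma subst_prod: "subst \<sigma> (prod f A) = (\<Prod>i\<in>A. subst \<sigma> (f i))"
  by (induction A rule: infinite_finite_induct) (simp_all add: subst_mult)

lemma subst_subst: "subst \<sigma> (subst \<tau> p) = subst (\<lambda>i. subst \<sigma> (\<tau> i)) p"
  by (simp add: subst_def[of \<tau>] subst_def[of "\<lambda>i. subst \<sigma> (\<tau> i)"] subst_sum subst_mult
      mon_eval_def subst_prod subst_power)

lemma subst_cong:
  assumes "p \<in> polys n" "\<And>i. i < n \<Longrightarrow> \<sigma> i = \<tau> i"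
  shows "subst \<sigma> p = subst \<tau> p"
  unfolding subst_def
  by (intro sum.cong arg_cong2[of _ _ _ _ "(*)"] mon_eval_cong refl)
    (use assms(2) polys_var_less[OF assms(1)] in blast)

lemma single_prod: "finite A \<Longrightarrow> (\<Prod>i\<in>A. Poly_Mapping.single (f i) (1::'a::comm_semiring_1))
    = Poly_Mapping.single (\<Sum>i\<in>A. f i) 1"
  by (induction A rule: finite_induct) (simp_all add: mult_single)

lemma var_power: "var i ^ k = Poly_Mapping.single (Poly_Mapping.single i k) 1"
  by (induction k) (simp_all add: var_def mult_single flip: single_add)

lemma mon_eval_var: "mon_eval var m = Poly_Mapping.single m 1"
  by (simp add: mon_eval_def var_power single_prod sum_singles)

lemma subst_var_id [simp]: "subst var p = p"
  by (simp add: subst_def mon_eval_var mult_single sum_singles)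

lemma single_eq_monomial: "Poly_Mapping.single m c = Poly_Mapping.single 0 c * mon_eval var m"
  by (simp add: mon_eval_var mult_single)

text \<open>
  The family \<open>Q\<close> is a multiplicative filtration. It is instantiated with a constant family, with
  a grading, and with a filtration by degree; thus one induction bounds the variables, the degree and
  the homogeneity of a substituted monomial.
\<close>

lemma mon_eval_in:
  fixes Q :: "nat \<Rightarrow> 'b::comm_monoid_mult set"
  assumes one: "1 \<in> Q 0" and mult: "\<And>i j x y. x \<in> Q i \<Longrightarrow> y \<in> Q j \<Longrightarrow> x * y \<in> Q (i + j)"
    and \<sigma>: "\<And>i. i \<in> Poly_Mapping.keys m \<Longrightarrow> \<sigma> i \<in> Q 1"
  shows "mon_eval \<sigma> m \<in> Q (monomial_degree m)"
proof -
  have pow: "x ^ k \<in> Q k" if "x \<in> Q 1" for x k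
    by (induction k) (use one mult[OF that] in auto)
  have "(\<Prod>i\<in>A. \<sigma> i ^ f i) \<in> Q (\<Sum>i\<in>A. f i)" if "finite A" "A \<subseteq> Poly_Mapping.keys m" for A f
    using that by (induction A rule: finite_induct) (auto simp: one intro!: mult pow \<sigma>)
  then show ?thesis by (simp add: mon_eval_def monomial_degree_def)
qed

lemma subst_polys:
  assumes "p \<in> polys n" "\<And>i. i < n \<Longrightarrow> \<sigma> i \<in> polys k"
  shows "subst \<sigma> p \<in> polys k"
  unfolding subst_def
proof (intro polys_sum polys_closed)
  fix m assume "m \<in> Poly_Mapping.keys p"
  then have "\<sigma> i \<in> polys k" if "i \<in> Poly_Mapping.keys m" for i
    using assms(2) polys_var_less[OF assms(1)] that by blast
  then show "mon_eval \<sigma> m \<in> polys k"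
    by (intro mon_eval_in[where Q = "\<lambda>_. polys k"]) (auto intro: polys_closed)
qed

lemma subst_homogeneous:
  assumes "p \<in> homogeneous n j" "\<And>i. i < n \<Longrightarrow> \<sigma> i \<in> homogeneous k 1"
  shows "subst \<sigma> p \<in> homogeneous k j"
  unfolding subst_def
proof (intro homogeneous_sum homogeneous_closed)
  fix m assume m: "m \<in> Poly_Mapping.keys p"
  have "mon_eval \<sigma> m \<in> homogeneous k (int (monomial_degree m))"
  proof (rule mon_eval_in)
    show "\<sigma> i \<in> homogeneous k (int 1)" if "i \<in> Poly_Mapping.keys m" for i
      using assms(2) polys_var_less[OF subsetD[OF homogeneous_polys assms(1)] m that] by simp
  qed (auto intro: homogeneous_closed)
  then show "mon_eval \<sigma> m \<in> homogeneous k j"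
    using assms(1) m by (force simp: homogeneous_def supported_def)
qed

text \<open>
  The monomials span and are products of variables, so an algebra homomorphism is determined by
  the images of the variables. Only the behaviour of \<open>h\<close> on polynomials in \<open>n\<close> variables is assumed,
  since homomorphisms of the ring \<open>poly_ring n\<close> carry no information outside its carrier.
\<close>

lemma hom_eq_subst:
  fixes h :: "'a::field mpoly \<Rightarrow> 'a mpoly"
  assumes add: "\<And>p q. p \<in> polys n \<Longrightarrow> q \<in> polys n \<Longrightarrow> h (p + q) = h p + h q"
    and mult: "\<And>p q. p \<in> polys n \<Longrightarrow> q \<in> polys n \<Longrightarrow> h (p * q) = h p * h q"
    and const: "\<And>c. h (Poly_Mapping.single 0 c) = Poly_Mapping.single 0 c"
    and p: "p \<in> polys n"
  shows "h p = subst (\<lambda>i. h (var i)) p"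
proof -
  have h0: "h 0 = 0" and h1: "h 1 = 1"
    using const[of 0] const[of 1] by simp_all
  have sum: "h (sum f A) = (\<Sum>x\<in>A. h (f x))" if "finite A" "\<And>x. x \<in> A \<Longrightarrow> f x \<in> polys n"
    for A :: "(nat \<Rightarrow>\<^sub>0 nat) set" and f
    using that by (induction A rule: finite_induct) (simp_all add: h0 add polys_sum)
  have pow: "x ^ k \<in> polys n \<and> h (x ^ k) = h x ^ k" if "x \<in> polys n" for x k
    by (induction k) (use that in \<open>simp_all add: h1 mult polys_closed\<close>)
  have prod: "prod f A \<in> polys n \<and> h (prod f A) = (\<Prod>x\<in>A. h (f x))"
    if "finite A" "\<And>x. x \<in> A \<Longrightarrow> f x \<in> polys n" for A :: "nat set" and f
    using that by (induction A rule: finite_induct) (simp_all add: h1 mult polys_closed)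
  have mon: "h (Poly_Mapping.single m c) = Poly_Mapping.single 0 c * mon_eval (\<lambda>i. h (var i)) m"
    if "m \<in> monomials n" for m c
  proof -
    have v: "(var i :: 'a mpoly) \<in> polys n" if "i \<in> Poly_Mapping.keys m" for i
      using that \<open>m \<in> monomials n\<close> by (auto simp: monomials_def intro: polys_closed)
    have "(mon_eval var m :: 'a mpoly) \<in> polys n \<and> h (mon_eval var m)
        = (\<Prod>i\<in>Poly_Mapping.keys m. h (var i ^ Poly_Mapping.lookup m i))"
      unfolding mon_eval_def by (rule prod[of _ "\<lambda>i. var i ^ Poly_Mapping.lookup m i"]) (simp_all add: pow v)
    moreover have "(\<Prod>i\<in>Poly_Mapping.keys m. h (var i ^ Poly_Mapping.lookup m i)) = mon_eval (\<lambda>i. h (var i)) m"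
      unfolding mon_eval_def by (rule prod.cong) (simp_all add: pow v)
    ultimately show ?thesis
      unfolding single_eq_monomial[of m c] by (simp add: mult const polys_closed)
  qed
  have mk: "m \<in> monomials n" if "m \<in> Poly_Mapping.keys p" for m
    using p that by (auto simp: polys_eq_supported supported_def)
  have "h p = h (\<Sum>m\<in>Poly_Mapping.keys p. Poly_Mapping.single m (Poly_Mapping.lookup p m))"
    by (simp only: sum_singles)
  also have "\<dots> = (\<Sum>m\<in>Poly_Mapping.keys p. h (Poly_Mapping.single m (Poly_Mapping.lookup p m)))"
    by (rule sum) (use mk in \<open>simp_all add: polys_eq_supported\<close>)
  also have "\<dots> = subst (\<lambda>i. h (var i)) p"
    unfolding subst_def by (rule sum.cong) (simp_all add: mon mk)
  finally show ?thesis .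
qed

subsection \<open>The polynomial ring as a graded algebra\<close>

lemma cring_field_ring: "cring (field_ring :: 'a::field ring)"
  by (intro cringI abelian_groupI comm_monoidI)
    (auto simp: algebra_simps intro: exI[of _ "- x" for x] left_minus)

lemma cring_poly_ring: "cring (poly_ring n :: ('a::field, 'a mpoly) graded)"
proof (intro cringI abelian_groupI comm_monoidI)
  fix x :: "'a mpoly" assume "x \<in> carrier (poly_ring n)"
  then show "\<exists>y\<in>carrier (poly_ring n). y \<oplus>\<^bsub>poly_ring n\<^esub> x = \<zero>\<^bsub>poly_ring n\<^esub>"
    by (intro bexI[of _ "- x"]) (auto intro: polys_closed)
qed (auto simp: algebra_simps intro: polys_closed)

lemma algebra_poly_ring: "algebra field_ring (poly_ring n :: ('a::field, 'a mpoly) graded)"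
  by (intro algebraI cring_field_ring cring_poly_ring)
    (auto simp: algebra_simps single_add mult_single simp flip: mult.assoc intro: polys_closed)

lemma a_inv_poly_ring:
  fixes p :: "'a::field mpoly"
  assumes "p \<in> polys n"
  shows "\<ominus>\<^bsub>poly_ring n\<^esub> p = - p"
proof -
  interpret cring "poly_ring n :: ('a, 'a mpoly) graded" by (rule cring_poly_ring)
  show ?thesis using assms minus_equality[of "- p" p] by (simp add: polys_closed)
qed

lemma finsum_poly_ring:
  fixes f :: "'i \<Rightarrow> 'a::field mpoly"
  assumes "\<And>i. i \<in> A \<Longrightarrow> f i \<in> polys n"
  shows "finsum (poly_ring n) f A = sum f A"
proof -
  interpret cring "poly_ring n :: ('a, 'a mpoly) graded" by (rule cring_poly_ring)
  show ?thesis using assms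
    by (induction A rule: infinite_finite_induct) (simp_all add: Pi_def)
qed

text \<open>
  Homogeneous components of different degrees have disjoint supports. This gives both the sum and the
  uniqueness in the decomposition of a polynomial into homogeneous components.
\<close>

lemma lookup_homogeneous_sum:
  assumes c: "\<And>j. c j \<in> homogeneous n j" and fin: "finite {j. c j \<noteq> 0}"
  shows "Poly_Mapping.lookup (\<Sum>j\<in>{j. c j \<noteq> 0}. c j) m = Poly_Mapping.lookup (c (mdeg m)) m"
proof -
  have z: "Poly_Mapping.lookup (c j) m = 0" if "j \<noteq> mdeg m" for j
    using c[of j] that by (auto simp: homogeneous_def supported_iff)
  have "Poly_Mapping.lookup (\<Sum>j\<in>{j. c j \<noteq> 0}. c j) m
      = (\<Sum>j\<in>{j. c j \<noteq> 0}. if j = mdeg m then Poly_Mapping.lookup (c (mdeg m)) m else 0)"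
    unfolding lookup_sum by (rule sum.cong) (auto simp: z)
  also have "\<dots> = Poly_Mapping.lookup (c (mdeg m)) m"
    using fin by auto
  finally show ?thesis .
qed

lemma graded_algebra_poly_ring:
  "graded_algebra field_ring (poly_ring n :: ('a::field, 'a mpoly) graded)"
proof -
  let ?R = "poly_ring n :: ('a, 'a mpoly) graded"
  interpret algebra field_ring ?R by (rule algebra_poly_ring)
  have sub: "submodule (component ?R j) field_ring ?R" for j
    using homogeneous_polys[of n j]
    by (intro submoduleI) (auto simp: a_inv_poly_ring subset_iff intro: homogeneous_closed)
  have dec: "\<exists>!c :: int \<Rightarrow> 'a mpoly.
        (\<forall>j. c j \<in> component ?R j) \<and> finite {j. c j \<noteq> \<zero>\<^bsub>?R\<^esub>} \<and>
        x = (\<Oplus>\<^bsub>?R\<^esub>j \<in> {j. c j \<noteq> \<zero>\<^bsub>?R\<^esub>}. c j)" if x: "x \<in> polys n" for x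
  proof -
    have fs: "(\<Oplus>\<^bsub>?R\<^esub>j \<in> {j. c j \<noteq> 0}. c j) = (\<Sum>j\<in>{j. c j \<noteq> 0}. c j)"
      if "\<And>j. c j \<in> homogeneous n j" for c
      by (rule finsum_poly_ring) (use that homogeneous_polys in blast)
    define h where "h j = part {m. mdeg m = j} x" for j
    have hh: "h j \<in> homogeneous n j" for j
      using x by (auto simp: h_def homogeneous_def supported_iff lookup_part polys_eq_supported)
    have fin: "finite {j. h j \<noteq> 0}"
    proof (rule finite_subset)
      show "{j. h j \<noteq> 0} \<subseteq> mdeg ` Poly_Mapping.keys x"
      proof
        fix j assume "j \<in> {j. h j \<noteq> 0}"
        then obtain m where "Poly_Mapping.lookup (h j) m \<noteq> 0"
          by (auto simp: poly_mapping_eq_iff fun_eq_iff)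
        then show "j \<in> mdeg ` Poly_Mapping.keys x"
          by (auto simp: h_def lookup_part in_keys_iff when_def split: if_splits)
      qed
    qed simp
    show ?thesis
    proof (rule ex1I[of _ h])
      have "x = (\<Sum>j\<in>{j. h j \<noteq> 0}. h j)"
        by (rule poly_mapping_eqI) (simp add: lookup_homogeneous_sum[OF hh fin], simp add: h_def lookup_part)
      then show "(\<forall>j. h j \<in> component ?R j) \<and> finite {j. h j \<noteq> \<zero>\<^bsub>?R\<^esub>} \<and>
        x = (\<Oplus>\<^bsub>?R\<^esub>j \<in> {j. h j \<noteq> \<zero>\<^bsub>?R\<^esub>}. h j)"
        using hh fin fs[OF hh] by simp
    next
      fix c assume "(\<forall>j. c j \<in> component ?R j) \<and> finite {j. c j \<noteq> \<zero>\<^bsub>?R\<^esub>} \<and>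
        x = (\<Oplus>\<^bsub>?R\<^esub>j \<in> {j. c j \<noteq> \<zero>\<^bsub>?R\<^esub>}. c j)"
      then have c: "\<And>j. c j \<in> homogeneous n j" and finc: "finite {j. c j \<noteq> 0}"
        and xc: "x = (\<Sum>j\<in>{j. c j \<noteq> 0}. c j)"
        using fs[of c] by simp_all
      show "c = h"
      proof (intro ext poly_mapping_eqI)
        fix j m
        show "Poly_Mapping.lookup (c j) m = Poly_Mapping.lookup (h j) m"
        proof (cases "mdeg m = j")
          case True
          then show ?thesis
            using lookup_homogeneous_sum[of c, OF c finc, of m] xc by (simp add: h_def lookup_part)
        next
          case False
          then show ?thesis using c[of j] by (auto simp: h_def lookup_part homogeneous_def supported_iff)
        qed
      qed
    qed
  qed
  show ?thesis
    unfolding graded_algebra_def graded_module_def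
    using algebra_poly_ring[where 'a='a and n=n] module_axioms sub dec by (simp add: homogeneous_closed)
qed

section \<open>Graded retracts of polynomial rings\<close>

text \<open>
  Scalar multiplication over an arbitrary basis, where no product is available; on polynomials it
  is multiplication by a constant.
\<close>

definition scale :: "'a::field \<Rightarrow> ('x \<Rightarrow>\<^sub>0 'a) \<Rightarrow> ('x \<Rightarrow>\<^sub>0 'a)" where
  "scale a p = Poly_Mapping.map ((*) a) p"

lemma lookup_scale: "Poly_Mapping.lookup (scale a p) x = a * Poly_Mapping.lookup p x"
  by (simp add: scale_def map.rep_eq when_def)

lemma const_mult_eq_scale: "Poly_Mapping.single 0 a * p = scale a p"
  by (simp add: scale_def mult_map_scale_conv_mult)

interpretation poly_mapping: vector_space "scale :: 'a::field \<Rightarrow> ('x \<Rightarrow>\<^sub>0 'a) \<Rightarrow> _"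
  by unfold_locales (auto intro!: poly_mapping_eqI simp: lookup_scale lookup_add algebra_simps)

interpretation poly_mapping_pair:
  vector_space_pair "scale :: 'a::field \<Rightarrow> ('x \<Rightarrow>\<^sub>0 'a) \<Rightarrow> _" "scale :: 'a \<Rightarrow> ('y \<Rightarrow>\<^sub>0 'a) \<Rightarrow> _"
  by unfold_locales

lemma supported_scale: "p \<in> supported X \<Longrightarrow> scale a p \<in> supported X"
  by (simp add: supported_iff lookup_scale)

lemma scale_single: "scale a (Poly_Mapping.single x c) = Poly_Mapping.single x (a * c)"
  by (rule poly_mapping_eqI) (simp add: lookup_scale lookup_single when_def)

text \<open>
  Invariance of dimension. The map is linear only on the polynomials supported in \<open>X\<close>, so the argument
  works with the images of the basis vectors instead of appealing to linear maps on the whole type.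
\<close>

lemma card_le_of_linear_injection:
  fixes h :: "('x \<Rightarrow>\<^sub>0 'a::field) \<Rightarrow> ('y \<Rightarrow>\<^sub>0 'a)"
  assumes fin: "finite X" "finite Y"
    and add: "\<And>p q. p \<in> supported X \<Longrightarrow> q \<in> supported X \<Longrightarrow> h (p + q) = h p + h q"
    and scale: "\<And>a p. p \<in> supported X \<Longrightarrow> h (scale a p) = scale a (h p)"
    and inj: "inj_on h (supported X)" and into: "h ` supported X \<subseteq> supported Y"
  shows "card X \<le> card Y"
proof -
  let ?e = "\<lambda>x :: 'x. Poly_Mapping.single x (1 :: 'a)"
  let ?e' = "\<lambda>y :: 'y. Poly_Mapping.single y (1 :: 'a)"
  let ?S = "(\<lambda>x. h (?e x)) ` X" and ?T = "?e' ` Y"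
  have h0: "h 0 = 0" using scale[of 0 0] by simp
  have hsum: "h (sum f A) = (\<Sum>x\<in>A. h (f x))" if "finite A" "\<And>x. x \<in> A \<Longrightarrow> f x \<in> supported X"
    for f and A :: "'x set"
    using that by (induction A rule: finite_induct) (simp_all add: h0 add supported_sum)
  have injX: "inj_on (\<lambda>x. h (?e x)) X"
  proof (rule inj_onI)
    fix x y assume "x \<in> X" "y \<in> X" "h (?e x) = h (?e y)"
    then have "?e x = ?e y" using inj by (auto dest: inj_onD)
    then have "Poly_Mapping.keys (?e x) = Poly_Mapping.keys (?e y)" by simp
    then show "x = y" by simp
  qed
  have "poly_mapping.independent ?S"
  proof (rule poly_mapping.independent_if_scalars_zero)
    fix c v assume z: "(\<Sum>v\<in>?S. scale (c v) v) = 0" and v: "v \<in> ?S"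
    let ?c = "\<lambda>x. c (h (?e x))"
    define p where "p = (\<Sum>x\<in>X. Poly_Mapping.single x (?c x))"
    have "h p = (\<Sum>x\<in>X. h (scale (?c x) (?e x)))"
      unfolding p_def using fin by (subst hsum) (auto simp: scale_single)
    also have "\<dots> = (\<Sum>x\<in>X. scale (?c x) (h (?e x)))"
      by (rule sum.cong) (auto simp: scale)
    also have "\<dots> = 0" using z by (simp add: sum.reindex[OF injX])
    finally have "h p = h 0" by (simp add: h0)
    moreover have "p \<in> supported X" unfolding p_def by (auto intro!: supported_sum)
    ultimately have "p = 0" using inj by (auto dest: inj_onD)
    moreover have "Poly_Mapping.lookup p x = ?c x" if "x \<in> X" for x
      using that fin by (simp add: p_def lookup_sum lookup_single when_def)
    ultimately show "c v = 0" using v by auto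
  qed (use fin in simp)
  moreover have "?S \<subseteq> poly_mapping.span ?T"
  proof
    fix v assume "v \<in> ?S"
    then have v: "v \<in> supported Y" using into by force
    have "(\<Sum>y\<in>Poly_Mapping.keys v. scale (Poly_Mapping.lookup v y) (?e' y)) \<in> poly_mapping.span ?T"
      using v by (intro poly_mapping.span_sum poly_mapping.span_scale poly_mapping.span_base)
        (auto simp: supported_def)
    then show "v \<in> poly_mapping.span ?T" by (simp add: scale_single sum_singles)
  qed
  ultimately have "card ?S \<le> card ?T"
    using poly_mapping.independent_span_bound[of ?T ?S] fin by auto
  also have "\<dots> \<le> card Y" using fin(2) by (rule card_image_le)
  finally show ?thesis by (simp add: card_image[OF injX])
qed

lemma monomial_degree_1E:
  assumes "monomial_degree m = 1"
  obtains i where "m = Poly_Mapping.single i 1"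
proof -
  have "m \<noteq> 0" using assms by auto
  then obtain i where "Poly_Mapping.lookup m i \<noteq> 0" by (auto simp: poly_mapping_eq_iff fun_eq_iff)
  then obtain m' where m': "m = m' + Poly_Mapping.single i 1" by (rule monomial_times_var)
  then have "m' = 0" using assms by (simp add: monomial_degree_add monomial_degree_eq_0_iff)
  then show ?thesis using m' that by simp
qed

lemma subst_scale: "subst s (scale a p) = scale a (subst s p)"
  by (simp add: subst_mult flip: const_mult_eq_scale)

text \<open>
  A linear map prescribes values for the variables, and on linear forms the resulting substitution
  is the linear map itself.
\<close>

lemma subst_linear_form:
  fixes l :: "'a::field mpoly \<Rightarrow> 'a mpoly"
  assumes lin: "Vector_Spaces.linear scale scale l" and p: "p \<in> homogeneous n 1"
  shows "subst (\<lambda>i. l (var i)) p = l p"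
proof -
  have "mon_eval (\<lambda>i. l (var i)) m = l (Poly_Mapping.single m 1)" if "m \<in> Poly_Mapping.keys p" for m
  proof -
    have "monomial_degree m = 1" using p that by (force simp: homogeneous_def supported_def)
    then obtain i where "m = Poly_Mapping.single i 1" by (rule monomial_degree_1E)
    then show ?thesis by (simp add: var_def)
  qed
  then have "subst (\<lambda>i. l (var i)) p
      = (\<Sum>m\<in>Poly_Mapping.keys p. scale (Poly_Mapping.lookup p m) (l (Poly_Mapping.single m 1)))"
    by (simp add: subst_def const_mult_eq_scale)
  also have "\<dots> = l (\<Sum>m\<in>Poly_Mapping.keys p. scale (Poly_Mapping.lookup p m) (Poly_Mapping.single m 1))"
    using lin by (simp add: poly_mapping_pair.linear_sum poly_mapping_pair.linear_scale)
  also have "\<dots> = l p" by (simp add: scale_single sum_singles)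
  finally show ?thesis .
qed

text \<open>
  Let \<open>\<phi>\<close> be the composition \<open>R \<rightarrow> S \<rightarrow> R\<close>, an idempotent graded endomorphism whose image is a copy of
  \<open>S\<close>. Choose variables \<open>x\<^bsub>e(0)\<^esub>, \<dots>, x\<^bsub>e(k-1)\<^esub>\<close> whose images \<open>b\<^sub>i\<close> under \<open>\<phi>\<close> form a basis of
  the space of linear forms \<open>\<phi>(R\<^sub>1)\<close>. The map \<open>\<theta>\<close> sends the variables of \<open>K[x\<^sub>0, \<dots>, x\<^bsub>k-1\<^esub>]\<close> to the
  images of these variables in \<open>S\<close>.

  It is injective: some linear map \<open>l\<close> sends each \<open>b\<^sub>i\<close> to \<open>x\<^sub>i\<close>, and the
  substitution \<open>\<Lambda>\<close> that it induces is a left inverse of \<open>p \<mapsto> p(b\<^sub>0, \<dots>, b\<^bsub>k-1\<^esub>)\<close>. It is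
  surjective in each degree: the image under \<open>\<phi>\<close> of every variable is a linear form in the \<open>b\<^sub>i\<close>, whose
  coefficients are recorded in \<open>\<tau>\<close>, hence every element of \<open>\<phi>(R)\<close> is a polynomial in the \<open>b\<^sub>i\<close>.
\<close>

theorem graded_retract_poly_ring:
  fixes S :: "('a::field, 'c) graded"
  assumes "graded_retract field_ring (poly_ring n) S"
  obtains k \<theta> where "k \<le> n" "\<theta> \<in> graded_algebra_hom field_ring (poly_ring k) S"
    "bij_betw \<theta> (polys k) (carrier S)" "\<And>j. \<theta> ` homogeneous k j = component S j"
proof -
  let ?R = "poly_ring n :: ('a, 'a mpoly) graded"
  from assms obtain f g where alg: "graded_algebra field_ring S"
    and f: "f \<in> graded_algebra_hom field_ring S ?R" and g: "g \<in> graded_algebra_hom field_ring ?R S"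
    and gf: "\<And>x. x \<in> carrier S \<Longrightarrow> g (f x) = x"
    unfolding graded_retract_def by blast
  have fring: "f \<in> ring_hom S ?R" and gring: "g \<in> ring_hom ?R S"
    and fsm: "\<And>a x. x \<in> carrier S \<Longrightarrow> f (a \<odot>\<^bsub>S\<^esub> x) = Poly_Mapping.single 0 a * f x"
    and gsm: "\<And>a x. x \<in> polys n \<Longrightarrow> g (Poly_Mapping.single 0 a * x) = a \<odot>\<^bsub>S\<^esub> g x"
    and fgr: "\<And>j. f ` component S j \<subseteq> homogeneous n j"
    and ggr: "\<And>j. g ` homogeneous n j \<subseteq> component S j"
    using f g by (auto simp: graded_algebra_hom_def)
  have gcl: "g p \<in> carrier S" if "p \<in> polys n" for p
    using ring_hom_closed[OF gring] that by simp
  have fcl: "f x \<in> polys n" if "x \<in> carrier S" for x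
    using ring_hom_closed[OF fring] that by simp
  have comp_sub: "component S j \<subseteq> carrier S" for j
  proof -
    have "submodule (component S j) field_ring S"
      using alg by (simp add: graded_algebra_def graded_module_def)
    then show ?thesis using submodule.axioms(1) subgroup.subset by fastforce
  qed
  define \<phi> where "\<phi> p = f (g p)" for p
  have \<phi>_subst: "\<phi> p = subst (\<lambda>i. \<phi> (var i)) p" if "p \<in> polys n" for p
  proof (rule hom_eq_subst[OF _ _ _ that])
    fix p q :: "'a mpoly" assume pq: "p \<in> polys n" "q \<in> polys n"
    show "\<phi> (p + q) = \<phi> p + \<phi> q"
      using ring_hom_add[OF gring, of p q] ring_hom_add[OF fring, of "g p" "g q"] pq gcl by (simp add: \<phi>_def)
    show "\<phi> (p * q) = \<phi> p * \<phi> q"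
      using ring_hom_mult[OF gring, of p q] ring_hom_mult[OF fring, of "g p" "g q"] pq gcl by (simp add: \<phi>_def)
  next
    fix c
    show "\<phi> (Poly_Mapping.single 0 c) = Poly_Mapping.single 0 c"
      using gsm[of 1 c] fsm[of "g 1" c] ring_hom_one[OF gring] ring_hom_one[OF fring] gcl[of 1]
      by (simp add: \<phi>_def polys_closed)
  qed
  have \<phi>_var: "\<phi> (var i) \<in> homogeneous n 1" if "i < n" for i
    using fgr[of 1] ggr[of 1] homogeneous_closed(7)[OF that] by (auto simp: \<phi>_def)
  let ?V = "(\<lambda>i. \<phi> (var i)) ` {..<n}"
  obtain B where B: "B \<subseteq> ?V" "poly_mapping.independent B" "?V \<subseteq> poly_mapping.span B"
    using poly_mapping.maximal_independent_subset[of ?V] by blast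
  define k where "k = card B"
  have finB: "finite B" using B(1) finite_subset by blast
  have kn: "k \<le> n"
    using card_mono[OF _ B(1)] card_image_le[of "{..<n}" "\<lambda>i. \<phi> (var i)"] by (simp add: k_def)
  obtain b where b: "bij_betw b {..<k} B"
    using ex_bij_betw_nat_finite[OF finB] by (auto simp: k_def lessThan_atLeast0)
  have "\<exists>j<n. \<phi> (var j) = b i" if "i < k" for i
    using bij_betwE[OF b] that B(1) by force
  then obtain e where e: "\<And>i. i < k \<Longrightarrow> e i < n" "\<And>i. i < k \<Longrightarrow> \<phi> (var (e i)) = b i"
    by metis
  obtain l :: "'a mpoly \<Rightarrow> 'a mpoly" where lin: "Vector_Spaces.linear scale scale l"
    and l: "\<And>x. x \<in> B \<Longrightarrow> l x = var (the_inv_into {..<k} b x)"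
    using poly_mapping_pair.linear_independent_extend[OF B(2), of "\<lambda>x. var (the_inv_into {..<k} b x)"]
    by blast
  have lb: "l (b i) = var i" if "i < k" for i
    using l[of "b i"] bij_betwE[OF b] bij_betw_imp_inj_on[OF b] that by (simp add: the_inv_into_f_f)
  define \<Lambda> where "\<Lambda> = subst (\<lambda>i. l (var i))"
  have \<Lambda>b: "\<Lambda> (b i) = var i" if "i < k" for i
    using subst_linear_form[OF lin \<phi>_var[OF e(1)[OF that]]] lb[OF that] e(2)[OF that] by (simp add: \<Lambda>_def)
  have inv: "\<Lambda> (subst b p) = p" if "p \<in> polys k" for p
  proof -
    have "\<Lambda> (subst b p) = subst (\<lambda>i. \<Lambda> (b i)) p" unfolding \<Lambda>_def by (rule subst_subst)
    also have "\<dots> = subst var p" by (rule subst_cong[OF that]) (rule \<Lambda>b)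
    finally show ?thesis by simp
  qed
  define \<epsilon> :: "'a mpoly \<Rightarrow> 'a mpoly" where "\<epsilon> = subst (\<lambda>i. var (e i))"
  have \<epsilon>cl: "\<epsilon> p \<in> polys n" if "p \<in> polys k" for p
    unfolding \<epsilon>_def using that by (rule subst_polys) (simp add: e polys_closed)
  have \<epsilon>hom: "\<epsilon> p \<in> homogeneous n j" if "p \<in> homogeneous k j" for p j
    unfolding \<epsilon>_def using that by (rule subst_homogeneous) (simp add: e homogeneous_closed)
  have \<phi>\<epsilon>: "\<phi> (\<epsilon> p) = subst b p" if "p \<in> polys k" for p
  proof -
    have "\<phi> (\<epsilon> p) = subst (\<lambda>i. \<phi> (var (e i))) p"
      by (subst \<phi>_subst[OF \<epsilon>cl[OF that]]) (simp add: \<epsilon>_def subst_subst)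
    also have "\<dots> = subst b p" by (rule subst_cong[OF that]) (rule e)
    finally show ?thesis .
  qed
  have "\<exists>t. t \<in> homogeneous k 1 \<and> subst b t = \<phi> (var j)" if "j < n" for j
  proof -
    have "\<phi> (var j) \<in> poly_mapping.span B" using B(3) that by auto
    then obtain c where c: "\<phi> (var j) = (\<Sum>v\<in>B. scale (c v) v)"
      using poly_mapping.span_finite[OF finB] by auto
    let ?t = "\<Sum>i<k. Poly_Mapping.single 0 (c (b i)) * var i"
    have "subst b ?t = (\<Sum>i<k. scale (c (b i)) (b i))"
      by (simp add: subst_sum subst_scale const_mult_eq_scale)
    also have "\<dots> = \<phi> (var j)"
      unfolding c by (rule sum.reindex_bij_betw[OF b])
    finally have "subst b ?t = \<phi> (var j)" .
    moreover have "?t \<in> homogeneous k 1"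
      by (intro homogeneous_sum homogeneous_closed) simp
    ultimately show ?thesis by blast
  qed
  then obtain \<tau> where \<tau>: "\<And>j. j < n \<Longrightarrow> \<tau> j \<in> homogeneous k 1" "\<And>j. j < n \<Longrightarrow> subst b (\<tau> j) = \<phi> (var j)"
    by metis
  have \<phi>\<tau>: "\<phi> y = \<phi> (\<epsilon> (subst \<tau> y))" "subst \<tau> y \<in> polys k" if "y \<in> polys n" for y
  proof -
    show cl: "subst \<tau> y \<in> polys k"
      using that by (rule subst_polys) (use \<tau>(1) homogeneous_polys in blast)
    have "\<phi> y = subst (\<lambda>j. subst b (\<tau> j)) y"
      unfolding \<phi>_subst[OF that] by (rule subst_cong[OF that]) (simp add: \<tau>)
    then show "\<phi> y = \<phi> (\<epsilon> (subst \<tau> y))"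
      by (simp add: \<phi>\<epsilon>[OF cl] subst_subst)
  qed
  define \<theta> where "\<theta> p = g (\<epsilon> p)" for p
  have f\<theta>: "f (\<theta> p) = subst b p" if "p \<in> polys k" for p
    using \<phi>\<epsilon>[OF that] by (simp add: \<theta>_def \<phi>_def)
  have \<theta>cl: "\<theta> p \<in> carrier S" if "p \<in> polys k" for p
    using that by (simp add: \<theta>_def gcl \<epsilon>cl)
  have sur: "x = \<theta> (subst \<tau> (f x))" if x: "x \<in> carrier S" for x
  proof -
    have "\<phi> (f x) = f x" using gf[OF x] by (simp add: \<phi>_def)
    then have "f x = f (\<theta> (subst \<tau> (f x)))"
      using \<phi>\<tau>(1)[OF fcl[OF x]] by (simp add: \<theta>_def \<phi>_def)
    then show ?thesis
      using gf[OF x] gf[OF \<theta>cl[OF \<phi>\<tau>(2)[OF fcl[OF x]]]] by simp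
  qed
  show thesis
  proof (rule that[of k \<theta>])
    have "\<theta> \<in> ring_hom (poly_ring k) S"
    proof (rule ring_hom_memI)
      fix p q :: "'a mpoly" assume "p \<in> carrier (poly_ring k)" "q \<in> carrier (poly_ring k)"
      then have pq: "p \<in> polys k" "q \<in> polys k" by simp_all
      show "\<theta> p \<in> carrier S" using pq by (simp add: \<theta>cl)
      show "\<theta> (p \<otimes>\<^bsub>poly_ring k\<^esub> q) = \<theta> p \<otimes>\<^bsub>S\<^esub> \<theta> q"
        using ring_hom_mult[OF gring, of "\<epsilon> p" "\<epsilon> q"] \<epsilon>cl pq by (simp add: \<theta>_def \<epsilon>_def subst_mult)
      show "\<theta> (p \<oplus>\<^bsub>poly_ring k\<^esub> q) = \<theta> p \<oplus>\<^bsub>S\<^esub> \<theta> q"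
        using ring_hom_add[OF gring, of "\<epsilon> p" "\<epsilon> q"] \<epsilon>cl pq by (simp add: \<theta>_def \<epsilon>_def subst_add)
    next
      show "\<theta> \<one>\<^bsub>poly_ring k\<^esub> = \<one>\<^bsub>S\<^esub>"
        using ring_hom_one[OF gring] by (simp add: \<theta>_def \<epsilon>_def)
    qed
    moreover have "\<theta> (Poly_Mapping.single 0 a * p) = a \<odot>\<^bsub>S\<^esub> \<theta> p" if "p \<in> polys k" for a p
      using gsm[OF \<epsilon>cl[OF that]] by (simp add: \<theta>_def \<epsilon>_def subst_mult)
    moreover have gr: "\<theta> ` homogeneous k j \<subseteq> component S j" for j
      using \<epsilon>hom ggr by (fastforce simp: \<theta>_def)
    ultimately show "\<theta> \<in> graded_algebra_hom field_ring (poly_ring k) S"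
      by (simp add: graded_algebra_hom_def)
    show "bij_betw \<theta> (polys k) (carrier S)"
    proof (rule bij_betwI')
      show "\<theta> p = \<theta> q \<longleftrightarrow> p = q" if "p \<in> polys k" "q \<in> polys k" for p q
        using f\<theta> inv that by metis
      show "\<exists>p\<in>polys k. x = \<theta> p" if "x \<in> carrier S" for x
        using sur[OF that] \<phi>\<tau>(2)[OF fcl[OF that]] by blast
    qed (rule \<theta>cl)
    show "\<theta> ` homogeneous k j = component S j" for j
    proof
      show "component S j \<subseteq> \<theta> ` homogeneous k j"
      proof
        fix x assume x: "x \<in> component S j"
        then have "subst \<tau> (f x) \<in> homogeneous k j"
          using fgr by (intro subst_homogeneous[where n = n] \<tau>(1)) blast
        then show "x \<in> \<theta> ` homogeneous k j"
          using sur x comp_sub by blast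
      qed
    qed (rule gr)
  qed (rule kn)
qed

section \<open>Depth of polynomial rings\<close>

text \<open>
  Division with remainder by the variable \<open>x\<^sub>i\<close>, with control of the monomials that occur.
\<close>

lemma split_off_var:
  fixes F :: "'a::field mpoly"
  assumes "F \<in> supported M"
  obtains F0 G where "F = F0 + var i * G" "F0 \<in> supported {m \<in> M. Poly_Mapping.lookup m i = 0}"
    "G \<in> supported {m. m + Poly_Mapping.single i 1 \<in> M}"
proof -
  let ?x = "Poly_Mapping.single i (1::nat)"
  let ?t = "\<lambda>m. Poly_Mapping.single m (Poly_Mapping.lookup F m)"
  let ?K0 = "{m \<in> Poly_Mapping.keys F. Poly_Mapping.lookup m i = 0}"
  let ?K1 = "{m \<in> Poly_Mapping.keys F. Poly_Mapping.lookup m i \<noteq> 0}"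
  let ?G = "\<Sum>m\<in>?K1. Poly_Mapping.single (m - ?x) (Poly_Mapping.lookup F m)"
  have restore: "(m - ?x) + ?x = m" if "Poly_Mapping.lookup m i \<noteq> 0" for m
    using that by (elim monomial_times_var) simp
  have FM: "m \<in> M" if "m \<in> Poly_Mapping.keys F" for m
    using assms that by (auto simp: supported_def)
  have "F = (\<Sum>m\<in>?K0 \<union> ?K1. ?t m)"
    by (subst sum_singles[of F, symmetric]) (rule sum.cong, auto)
  also have "\<dots> = sum ?t ?K0 + sum ?t ?K1"
    by (rule sum.union_disjoint) auto
  also have "sum ?t ?K1 = var i * ?G"
    unfolding sum_distrib_left
  proof (rule sum.cong[OF refl])
    fix m assume "m \<in> ?K1"
    then have "?x + (m - ?x) = m" using restore[of m] by (simp add: add.commute)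
    then show "?t m = var i * Poly_Mapping.single (m - ?x) (Poly_Mapping.lookup F m)"
      by (simp del: One_nat_def add: var_def mult_single)
  qed
  finally have "F = sum ?t ?K0 + var i * ?G" .
  moreover have "sum ?t ?K0 \<in> supported {m \<in> M. Poly_Mapping.lookup m i = 0}"
    by (intro supported_sum) (auto simp: FM)
  moreover have "?G \<in> supported {m. m + ?x \<in> M}"
    by (intro supported_sum) (auto simp del: One_nat_def simp: FM restore)
  ultimately show thesis by (rule that)
qed

text \<open>
  A regular sequence is algebraically independent. Let \<open>J i\<close> be the ideal generated by the first \<open>i\<close>
  elements. By downward induction on \<open>i\<close>, a polynomial \<open>F\<close> in the variables \<open>x\<^sub>i, \<dots>, x\<^bsub>r-1\<^esub>\<close> vanishes as
  soon as its value lies in \<open>J i\<close>. For \<open>i = r\<close> such an \<open>F\<close> is a constant, and a nonzero constant would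
  generate the whole ring. For the step write \<open>F = F\<^sub>0 + x\<^sub>i G\<close> with \<open>F\<^sub>0\<close> free of \<open>x\<^sub>i\<close>. The value of \<open>F\<^sub>0\<close>
  lies in \<open>J (i + 1)\<close>, hence \<open>F\<^sub>0 = 0\<close>. By regularity the value of \<open>G\<close> then lies in \<open>J i\<close>, and
  \<open>G = 0\<close> follows by induction on the degree in \<open>x\<^sub>i\<close>.
\<close>

lemma regular_imp_algebraically_independent:
  fixes \<sigma> :: "nat \<Rightarrow> 'a::field mpoly"
  assumes \<sigma>: "\<And>i. i < r \<Longrightarrow> \<sigma> i \<in> polys k"
    and J0: "J 0 = {0}"
    and JS: "\<And>i. i < r \<Longrightarrow> J (Suc i) = {p + \<sigma> i * q | p q. p \<in> J i \<and> q \<in> polys k}"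
    and reg: "\<And>i q. i < r \<Longrightarrow> q \<in> polys k \<Longrightarrow> \<sigma> i * q \<in> J i \<Longrightarrow> q \<in> J i"
    and proper: "J r \<noteq> polys k"
    and F: "F \<in> polys r" "subst \<sigma> F = 0"
  shows "F = 0"
proof -
  have ideal: "0 \<in> J i \<and> J i \<subseteq> polys k \<and> (\<forall>p\<in>J i. \<forall>q\<in>J i. p - q \<in> J i)
      \<and> (\<forall>p\<in>J i. \<forall>q\<in>polys k. p * q \<in> J i)" if "i \<le> r" for i
    using that
  proof (induction i)
    case 0
    then show ?case by (simp add: J0 polys_closed)
  next
    case (Suc i)
    then have IH: "0 \<in> J i" "J i \<subseteq> polys k" "\<And>p q. p \<in> J i \<Longrightarrow> q \<in> J i \<Longrightarrow> p - q \<in> J i"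
      "\<And>p q. p \<in> J i \<Longrightarrow> q \<in> polys k \<Longrightarrow> p * q \<in> J i" and i: "i < r"
      by auto
    have JI: "p + \<sigma> i * q \<in> J (Suc i)" if "p \<in> J i" "q \<in> polys k" for p q
      using that unfolding JS[OF i] by auto
    have "0 \<in> J (Suc i)" using JI[OF IH(1), of 0] by (simp add: polys_closed)
    moreover have "J (Suc i) \<subseteq> polys k"
    proof
      fix x assume "x \<in> J (Suc i)"
      then obtain p q where "x = p + \<sigma> i * q" "p \<in> J i" "q \<in> polys k"
        unfolding JS[OF i] by blast
      then show "x \<in> polys k"
        using IH(2) \<sigma>[OF i] by (simp add: subset_iff polys_closed)
    qed
    moreover have "p - q \<in> J (Suc i)" if pq: "p \<in> J (Suc i)" "q \<in> J (Suc i)" for p q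
    proof -
      obtain p1 p2 q1 q2 where "p = p1 + \<sigma> i * p2" "q = q1 + \<sigma> i * q2"
        "p1 \<in> J i" "q1 \<in> J i" "p2 \<in> polys k" "q2 \<in> polys k"
        using pq unfolding JS[OF i] by blast
      then show ?thesis
        using JI[OF IH(3) polys_closed(5), of p1 q1 p2 q2] by (simp add: algebra_simps)
    qed
    moreover have "p * q \<in> J (Suc i)" if pq: "p \<in> J (Suc i)" "q \<in> polys k" for p q
    proof -
      obtain p1 p2 where "p = p1 + \<sigma> i * p2" "p1 \<in> J i" "p2 \<in> polys k"
        using pq unfolding JS[OF i] by blast
      then show ?thesis
        using JI[OF IH(4) polys_closed(7), of p1 q p2 q] pq(2) by (simp add: algebra_simps)
    qed
    ultimately show ?case by blast
  qed
  have one: "1 \<notin> J r"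
  proof
    assume one: "1 \<in> J r"
    have "q \<in> J r" if "q \<in> polys k" for q
      using ideal[of r] one that by (metis mult_1 order_refl)
    then show False using ideal[of r] proper by blast
  qed
  have claim: "\<forall>F. F \<in> supported {m. Poly_Mapping.keys m \<subseteq> {i..<r}} \<longrightarrow> subst \<sigma> F \<in> J i \<longrightarrow> F = 0"
    if "i \<le> r" for i
    using that
  proof (induction i rule: inc_induct)
    case base
    show ?case
    proof (intro allI impI)
      fix F assume F: "F \<in> supported {m. Poly_Mapping.keys m \<subseteq> {r..<r}}" and J: "subst \<sigma> F \<in> J r"
      have "F = Poly_Mapping.single 0 (Poly_Mapping.lookup F 0)"
        using F by (intro poly_mapping_eqI) (auto simp: supported_iff lookup_single when_def)
      then obtain c where Fc: "F = Poly_Mapping.single 0 c" by blast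
      show "F = 0"
      proof (rule ccontr)
        assume "F \<noteq> 0"
        then have "c \<noteq> 0" using Fc by auto
        have "subst \<sigma> F * Poly_Mapping.single 0 (inverse c) \<in> J r"
          using ideal[of r] J polys_closed(3) by blast
        moreover have "subst \<sigma> F * Poly_Mapping.single 0 (inverse c) = 1"
          using \<open>c \<noteq> 0\<close> by (simp add: Fc mult_single)
        ultimately show False using one by simp
      qed
    qed
  next
    case (step i)
    have "\<forall>F. F \<in> supported {m. Poly_Mapping.keys m \<subseteq> {i..<r} \<and> Poly_Mapping.lookup m i < N}
        \<longrightarrow> subst \<sigma> F \<in> J i \<longrightarrow> F = 0" for N
    proof (induction N)
      case 0
      then show ?case by (simp add: supported_def)
    next
      case (Suc N)
      show ?case
      proof (intro allI impI)
        let ?M = "{m. Poly_Mapping.keys m \<subseteq> {i..<r} \<and> Poly_Mapping.lookup m i < Suc N}"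
        fix F assume F: "F \<in> supported ?M" and J: "subst \<sigma> F \<in> J i"
        from F obtain F0 G where FG: "F = F0 + var i * G"
          and F0: "F0 \<in> supported {m \<in> ?M. Poly_Mapping.lookup m i = 0}"
          and G: "G \<in> supported {m. m + Poly_Mapping.single i 1 \<in> ?M}"
          by (rule split_off_var)
        have G': "G \<in> supported {m. Poly_Mapping.keys m \<subseteq> {i..<r} \<and> Poly_Mapping.lookup m i < N}"
          using G by (auto simp: supported_def keys_add_nat lookup_add)
        have ir: "i < r" by fact
        have "{i..<r} \<subseteq> {..<r}" by auto
        with G' have "G \<in> polys r" unfolding supported_def polys_def by blast
        then have Gk: "subst \<sigma> G \<in> polys k" by (rule subst_polys) (rule \<sigma>)
        have eq: "subst \<sigma> F = subst \<sigma> F0 + \<sigma> i * subst \<sigma> G"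
          by (simp add: FG subst_add subst_mult)
        have "subst \<sigma> F0 = subst \<sigma> F + \<sigma> i * (- subst \<sigma> G)" by (simp add: eq)
        then have "subst \<sigma> F0 \<in> J (Suc i)"
          using J polys_closed(6)[OF Gk] unfolding JS[OF ir] by blast
        moreover have "F0 \<in> supported {m. Poly_Mapping.keys m \<subseteq> {Suc i..<r}}"
        proof -
          have "Poly_Mapping.keys m \<subseteq> {Suc i..<r}"
            if "Poly_Mapping.keys m \<subseteq> {i..<r}" "Poly_Mapping.lookup m i = 0" for m
          proof
            fix j assume j: "j \<in> Poly_Mapping.keys m"
            then have "j \<noteq> i" using that(2) by (auto simp: in_keys_iff)
            then show "j \<in> {Suc i..<r}" using that(1) j by force
          qed
          then show ?thesis using F0 unfolding supported_def by blast
        qed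
        ultimately have "F0 = 0" using step.IH by blast
        then have "\<sigma> i * subst \<sigma> G \<in> J i" using J eq by simp
        then have "subst \<sigma> G \<in> J i" using reg[OF ir Gk] by blast
        then have "G = 0" using Suc.IH G' by blast
        then show "F = 0" using \<open>F0 = 0\<close> FG by simp
      qed
    qed
    note bounded = this
    show ?case
    proof (intro allI impI)
      fix F assume F: "F \<in> supported {m. Poly_Mapping.keys m \<subseteq> {i..<r}}" and J: "subst \<sigma> F \<in> J i"
      define N where "N = Suc (\<Sum>m\<in>Poly_Mapping.keys F. Poly_Mapping.lookup m i)"
      have "Poly_Mapping.lookup m i < N" if "m \<in> Poly_Mapping.keys F" for m
        unfolding N_def less_Suc_eq_le using that by (intro member_le_sum) auto
      then have "F \<in> supported {m. Poly_Mapping.keys m \<subseteq> {i..<r} \<and> Poly_Mapping.lookup m i < N}"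
        using F by (auto simp: supported_def)
      then show "F = 0" using bounded J by blast
    qed
  qed
  have "F \<in> supported {m. Poly_Mapping.keys m \<subseteq> {0..<r}}"
    using F(1) unfolding polys_def supported_def lessThan_atLeast0 by blast
  then show ?thesis using claim[of 0] F(2) J0 by simp
qed

text \<open>
  A dimension count. Let \<open>D\<close> bound the degrees of the \<open>\<sigma> i\<close>. The \<open>N\<^sup>r\<close> monomials in \<open>r\<close>
  variables with exponents below \<open>N\<close> have linearly independent values, and these values have degree at most
  \<open>r N D\<close>. So \<open>N\<^sup>r \<le> (r N D + 1)\<^sup>k\<close> for all \<open>N > 0\<close>, which fails for large \<open>N\<close> if \<open>r > k\<close>.
\<close>

lemma algebraically_independent_le:
  fixes \<sigma> :: "nat \<Rightarrow> 'a::field mpoly"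
  assumes \<sigma>: "\<And>i. i < r \<Longrightarrow> \<sigma> i \<in> polys k"
    and indep: "\<And>F. F \<in> polys r \<Longrightarrow> subst \<sigma> F = 0 \<Longrightarrow> F = 0"
  shows "r \<le> k"
proof (rule ccontr)
  assume "\<not> r \<le> k"
  let ?box = "\<lambda>k N. {m \<in> monomials k. \<forall>i. Poly_Mapping.lookup m i < N}"
  define D where "D = (\<Sum>i<r. \<Sum>m\<in>Poly_Mapping.keys (\<sigma> i). monomial_degree m)"
  have D: "monomial_degree m \<le> D" if "i < r" "m \<in> Poly_Mapping.keys (\<sigma> i)" for i m
  proof -
    have "monomial_degree m \<le> (\<Sum>m\<in>Poly_Mapping.keys (\<sigma> i). monomial_degree m)"
      using that by (intro member_le_sum) auto
    also have "\<dots> \<le> D" unfolding D_def using that by (intro member_le_sum) auto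
    finally show ?thesis .
  qed
  define Q where "Q t = (supported {m \<in> monomials k. monomial_degree m \<le> t * D} :: 'a mpoly set)" for t
  have Qmon: "mon_eval \<sigma> m \<in> Q (monomial_degree m)" if "m \<in> monomials r" for m
  proof (rule mon_eval_in)
    show "1 \<in> Q 0" by (simp add: Q_def flip: single_one)
    show "x * y \<in> Q (i + j)" if "x \<in> Q i" "y \<in> Q j" for i j x y
      using that unfolding Q_def
      by (rule supported_mult) (simp add: monomial_degree_add add_mono distrib_right)
    show "\<sigma> i \<in> Q 1" if "i \<in> Poly_Mapping.keys m" for i
    proof -
      have "i < r" using that \<open>m \<in> monomials r\<close> by (auto simp: monomials_def)
      then show ?thesis using D \<sigma> by (auto simp: Q_def supported_def polys_eq_supported)
    qed
  qed
  have bound: "N ^ r \<le> (r * N * D + 1) ^ k" if "N > 0" for N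
  proof -
    have "N ^ r \<le> card (?box r N)" using that by (rule card_monomials_bounded)
    also have "\<dots> \<le> card (?box k (r * N * D + 1))"
    proof (rule card_le_of_linear_injection)
      have sub: "supported (?box r N) \<subseteq> (polys r :: 'a mpoly set)"
        by (auto simp: polys_eq_supported supported_def)
      show "inj_on (subst \<sigma>) (supported (?box r N))"
      proof (rule inj_onI)
        fix p q :: "'a mpoly"
        assume pq: "p \<in> supported (?box r N)" "q \<in> supported (?box r N)" "subst \<sigma> p = subst \<sigma> q"
        have "subst \<sigma> (p - q) + subst \<sigma> q = subst \<sigma> p" by (simp flip: subst_add)
        then have "subst \<sigma> (p - q) = 0" using pq(3) by simp
        moreover have "p - q \<in> polys r" using pq sub by (auto intro!: polys_closed)
        ultimately show "p = q" using indep[of "p - q"] by simp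
      qed
      show "subst \<sigma> ` supported (?box r N) \<subseteq> supported (?box k (r * N * D + 1))"
      proof (intro image_subsetI)
        fix p :: "'a mpoly" assume p: "p \<in> supported (?box r N)"
        show "subst \<sigma> p \<in> supported (?box k (r * N * D + 1))"
          unfolding subst_def
        proof (intro supported_sum supported_const_mult)
          fix m assume "m \<in> Poly_Mapping.keys p"
          then have m: "m \<in> monomials r" "\<And>i. Poly_Mapping.lookup m i < N"
            using p by (auto simp: supported_def)
          have "monomial_degree m = (\<Sum>i<r. Poly_Mapping.lookup m i)"
            using m(1) by (intro monomial_degree_superset) (auto simp: monomials_def)
          also have "\<dots> \<le> (\<Sum>i<r. N)" using m(2) by (intro sum_mono) (simp add: less_imp_le)
          finally have deg: "monomial_degree m * D \<le> r * N * D" by simp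
          have "{m' \<in> monomials k. monomial_degree m' \<le> monomial_degree m * D} \<subseteq> ?box k (r * N * D + 1)"
            using lookup_le_monomial_degree deg by (fastforce simp: less_Suc_eq_le intro: order_trans)
          then show "mon_eval \<sigma> m \<in> supported (?box k (r * N * D + 1))"
            using Qmon[OF m(1)] unfolding Q_def supported_def by blast
        qed
      qed
      show "subst \<sigma> (scale a p) = scale a (subst \<sigma> p)" for a p
        by (simp add: subst_mult flip: const_mult_eq_scale)
    qed (simp_all add: card_monomials_bounded subst_add)
    also have "\<dots> \<le> (r * N * D + 1) ^ k" by (rule card_monomials_bounded)
    finally show ?thesis .
  qed
  \<comment> \<open>The bound fails at \<open>N = C + 1\<close>, since \<open>r N D + 1 \<le> N (r D + 1)\<close>.\<close>
  define C where "C = (r * D + 1) ^ k"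
  have "(C + 1) ^ k * (C + 1) = (C + 1) ^ Suc k" by simp
  also have "\<dots> \<le> (C + 1) ^ r" using \<open>\<not> r \<le> k\<close> by (intro power_increasing) auto
  also have "\<dots> \<le> (r * (C + 1) * D + 1) ^ k" by (rule bound) simp
  also have "\<dots> \<le> ((C + 1) * (r * D + 1)) ^ k"
  proof (rule power_mono)
    show "r * (C + 1) * D + 1 \<le> (C + 1) * (r * D + 1)" by (simp add: algebra_simps)
  qed simp
  also have "\<dots> = (C + 1) ^ k * C" unfolding power_mult_distrib by (simp add: C_def)
  finally show False by simp
qed

lemma finsum_shift_self: "finsum (shift (self_module S) s) f A = finsum S f A"
  by (simp add: finsum_def finprod_def shift_def self_module_def)

lemma shift_self_simps [simp]:
  "carrier (shift (self_module S) s) = carrier S"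
  "smult (shift (self_module S) s) = mult S"
  by (simp_all add: shift_def self_module_def)

lemma seq_submodule_0: "cring S \<Longrightarrow> seq_submodule (shift (self_module S) s) [] = {\<zero>\<^bsub>S\<^esub>}"
proof -
  assume "cring S"
  then interpret cring S .
  show ?thesis by (auto simp: seq_submodule_def finsum_shift_self)
qed

text \<open>
  Together with the case of the empty sequence, this recursion is all that the depth computations
  use of \<open>seq_submodule\<close>.
\<close>

lemma seq_submodule_Suc:
  assumes S: "cring S" and fs: "set fs \<subseteq> carrier S" and i: "i < length fs"
  shows "seq_submodule (shift (self_module S) s) (take (Suc i) fs)
    = {x \<oplus>\<^bsub>S\<^esub> (fs ! i) \<otimes>\<^bsub>S\<^esub> y | x y. x \<in> seq_submodule (shift (self_module S) s) (take i fs) \<and> y \<in> carrier S}"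
    (is "?L = ?R")
proof -
  interpret cring S by fact
  have cl: "fs ! j \<in> carrier S" if "j < length fs" for j
    using fs that by (auto simp: subset_iff)
  have mem: "x \<in> seq_submodule (shift (self_module S) s) (take l fs) \<longleftrightarrow>
      (\<exists>y. y \<in> {..<l} \<rightarrow> carrier S \<and> x = (\<Oplus>\<^bsub>S\<^esub>j \<in> {..<l}. fs ! j \<otimes>\<^bsub>S\<^esub> y j))"
    if "l \<le> length fs" for x l
  proof -
    have eq: "(\<Oplus>\<^bsub>S\<^esub>j \<in> {..<l}. take l fs ! j \<otimes>\<^bsub>S\<^esub> y j) = (\<Oplus>\<^bsub>S\<^esub>j \<in> {..<l}. fs ! j \<otimes>\<^bsub>S\<^esub> y j)"
      if y: "y \<in> {..<l} \<rightarrow> carrier S" for y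
    proof (rule finsum_cong'[OF refl])
      show "(\<lambda>j. fs ! j \<otimes>\<^bsub>S\<^esub> y j) \<in> {..<l} \<rightarrow> carrier S"
      proof (rule Pi_I)
        fix j assume j: "j \<in> {..<l}"
        then have "j < length fs" using \<open>l \<le> length fs\<close> by simp
        then show "fs ! j \<otimes>\<^bsub>S\<^esub> y j \<in> carrier S" using cl funcset_mem[OF y j] by blast
      qed
    qed simp
    have len: "length (take l fs) = l" using that by simp
    have "x \<in> seq_submodule (shift (self_module S) s) (take l fs) \<longleftrightarrow>
      (\<exists>y. y \<in> {..<l} \<rightarrow> carrier S \<and> x = (\<Oplus>\<^bsub>S\<^esub>j \<in> {..<l}. take l fs ! j \<otimes>\<^bsub>S\<^esub> y j))"
      unfolding seq_submodule_def finsum_shift_self shift_self_simps len by blast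
    also have "\<dots> \<longleftrightarrow>
      (\<exists>y. y \<in> {..<l} \<rightarrow> carrier S \<and> x = (\<Oplus>\<^bsub>S\<^esub>j \<in> {..<l}. fs ! j \<otimes>\<^bsub>S\<^esub> y j))"
      by (intro ex_cong1 conj_cong refl) (simp only: eq)
    finally show ?thesis .
  qed
  have split: "(\<Oplus>\<^bsub>S\<^esub>j \<in> {..<Suc i}. fs ! j \<otimes>\<^bsub>S\<^esub> y j)
      = (\<Oplus>\<^bsub>S\<^esub>j \<in> {..<i}. fs ! j \<otimes>\<^bsub>S\<^esub> y j) \<oplus>\<^bsub>S\<^esub> fs ! i \<otimes>\<^bsub>S\<^esub> y i"
    if y: "y \<in> {..<Suc i} \<rightarrow> carrier S" for y
  proof -
    have p: "fs ! j \<otimes>\<^bsub>S\<^esub> y j \<in> carrier S" if "j < Suc i" for j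
      using that i cl[of j] funcset_mem[OF y, of j] by simp
    then have "(\<lambda>j. fs ! j \<otimes>\<^bsub>S\<^esub> y j) \<in> {..<i} \<rightarrow> carrier S" by (intro Pi_I) simp
    then show ?thesis
      using finsum_insert[of "{..<i}" i "\<lambda>j. fs ! j \<otimes>\<^bsub>S\<^esub> y j"] p[of i] finsum_closed
      by (simp add: lessThan_Suc a_comm)
  qed
  note memS = mem[OF Suc_leI[OF i]] and memi = mem[OF less_imp_le[OF i]]
  show ?thesis
  proof (intro equalityI subsetI)
    fix x assume "x \<in> ?L"
    then obtain y where y: "y \<in> {..<Suc i} \<rightarrow> carrier S" "x = (\<Oplus>\<^bsub>S\<^esub>j \<in> {..<Suc i}. fs ! j \<otimes>\<^bsub>S\<^esub> y j)"
      unfolding memS by blast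
    have "(\<Oplus>\<^bsub>S\<^esub>j \<in> {..<i}. fs ! j \<otimes>\<^bsub>S\<^esub> y j) \<in> seq_submodule (shift (self_module S) s) (take i fs)"
    proof -
      have "y \<in> {..<i} \<rightarrow> carrier S" using y(1) by auto
      then show ?thesis unfolding memi by blast
    qed
    moreover have "y i \<in> carrier S" using y(1) by auto
    ultimately show "x \<in> ?R" unfolding y(2) split[OF y(1)] by blast
  next
    fix x assume "x \<in> ?R"
    then obtain u z where x: "x = u \<oplus>\<^bsub>S\<^esub> fs ! i \<otimes>\<^bsub>S\<^esub> z" and z: "z \<in> carrier S"
      and u: "u \<in> seq_submodule (shift (self_module S) s) (take i fs)" by blast
    from u[unfolded memi] obtain y where y: "y \<in> {..<i} \<rightarrow> carrier S" "u = (\<Oplus>\<^bsub>S\<^esub>j \<in> {..<i}. fs ! j \<otimes>\<^bsub>S\<^esub> y j)"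
      by (elim exE conjE) (rule that)
    let ?y = "y(i := z)"
    have Y: "?y \<in> {..<Suc i} \<rightarrow> carrier S"
      using funcset_mem[OF y(1)] z by (intro Pi_I) (auto simp: less_Suc_eq)
    have "(\<Oplus>\<^bsub>S\<^esub>j \<in> {..<i}. fs ! j \<otimes>\<^bsub>S\<^esub> ?y j) = u"
    proof (unfold y(2), rule finsum_cong'[OF refl])
      show "(\<lambda>j. fs ! j \<otimes>\<^bsub>S\<^esub> y j) \<in> {..<i} \<rightarrow> carrier S"
        using cl i funcset_mem[OF y(1)] by (intro Pi_I m_closed) simp_all
    qed simp
    then have "x = (\<Oplus>\<^bsub>S\<^esub>j \<in> {..<Suc i}. fs ! j \<otimes>\<^bsub>S\<^esub> ?y j)"
      unfolding split[OF Y] x by simp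
    then show "x \<in> ?L" unfolding memS using Y by (intro exI[of _ ?y] conjI)
  qed
qed

lemma seq_submodule_subset:
  assumes S: "cring S" and fs: "set fs \<subseteq> carrier S" and "i \<le> length fs"
  shows "seq_submodule (shift (self_module S) s) (take i fs) \<subseteq> carrier S"
  using assms(3)
proof (induction i)
  case 0
  then show ?case using S by (simp add: seq_submodule_0 cring.cring_simprules)
next
  case (Suc i)
  interpret cring S by fact
  have i: "i < length fs" using Suc.prems by simp
  have "fs ! i \<in> carrier S" by (rule subsetD[OF fs nth_mem[OF i]])
  then have cl: "x \<oplus>\<^bsub>S\<^esub> fs ! i \<otimes>\<^bsub>S\<^esub> y \<in> carrier S" if "x \<in> carrier S" "y \<in> carrier S" for x y
    using that by (intro a_closed m_closed)
  show ?case
  proof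
    fix x assume "x \<in> seq_submodule (shift (self_module S) s) (take (Suc i) fs)"
    then obtain u v where x: "x = u \<oplus>\<^bsub>S\<^esub> fs ! i \<otimes>\<^bsub>S\<^esub> v"
      and u: "u \<in> seq_submodule (shift (self_module S) s) (take i fs)" and v: "v \<in> carrier S"
      unfolding seq_submodule_Suc[OF S fs i] by (elim CollectE exE conjE) (rule that)
    show "x \<in> carrier S"
      unfolding x by (rule cl[OF subsetD[OF Suc.IH[OF less_imp_le[OF i]] u] v])
  qed
qed

text \<open>
  A regular sequence in \<open>S\<close> is pulled back along \<open>\<theta>\<close> to a regular sequence of polynomials in \<open>k\<close>
  variables, which is algebraically independent and therefore has at most \<open>k\<close> elements.
\<close>

lemma depth_le_of_iso:
  fixes S :: "('a::field, 'c) graded"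
  assumes S: "cring S" and gr: "\<And>j. component S j \<subseteq> carrier S"
    and \<theta>: "\<theta> \<in> ring_hom (poly_ring k) S" and bij: "bij_betw \<theta> (polys k :: 'a mpoly set) (carrier S)"
  shows "depth S (shift (self_module S) s) \<le> enat k"
  unfolding depth_def
proof (rule SUP_least, clarify)
  fix fs assume irr: "set fs \<subseteq> irrelevant_ideal S" and reg: "regular_sequence (shift (self_module S) s) fs"
  let ?I = "\<lambda>i. seq_submodule (shift (self_module S) s) (take i fs)"
  have fs: "set fs \<subseteq> carrier S"
  proof -
    have "(\<Union>j\<in>{0<..}. component S j) \<subseteq> carrier S" by (rule UN_least) (rule gr)
    then have "ideal (irrelevant_ideal S) S"
      unfolding irrelevant_ideal_def by (rule ring.genideal_ideal[OF cring.axioms(1)[OF S]])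
    then have "irrelevant_ideal S \<subseteq> carrier S" by (intro subsetI) (rule ideal.Icarr)
    with irr show ?thesis by (rule subset_trans)
  qed
  have \<theta>add: "\<theta> (p + q) = \<theta> p \<oplus>\<^bsub>S\<^esub> \<theta> q" and \<theta>mult: "\<theta> (p * q) = \<theta> p \<otimes>\<^bsub>S\<^esub> \<theta> q"
    if "p \<in> polys k" "q \<in> polys k" for p q
    using ring_hom_add[OF \<theta>, of p q] ring_hom_mult[OF \<theta>, of p q] that by simp_all
  have \<theta>cl: "\<theta> p \<in> carrier S" if "p \<in> polys k" for p
    using bij that by (rule bij_betw_apply)
  have \<theta>inj: "p = q" if "\<theta> p = \<theta> q" "p \<in> polys k" "q \<in> polys k" for p q
    using bij that by (auto simp: bij_betw_def inj_on_def)
  have \<theta>0: "\<theta> 0 = \<zero>\<^bsub>S\<^esub>"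
  proof -
    interpret cring S by fact
    show ?thesis using \<theta>add[of 0 0] \<theta>cl[of 0] by (simp add: polys_closed)
  qed
  have \<theta>sur: "\<exists>p\<in>polys k. x = \<theta> p" if "x \<in> carrier S" for x
    using bij that by (auto simp: bij_betw_def)
  have "\<exists>p\<in>polys k. fs ! i = \<theta> p" if "i < length fs" for i
    using \<theta>sur[OF subsetD[OF fs nth_mem[OF that]]] .
  then obtain \<sigma> where \<sigma>: "\<And>i. i < length fs \<Longrightarrow> \<sigma> i \<in> polys k" "\<And>i. i < length fs \<Longrightarrow> fs ! i = \<theta> (\<sigma> i)"
    by metis
  define J where "J i = {p \<in> polys k. \<theta> p \<in> ?I i}" for i
  have ISuc: "?I (Suc i) = {x \<oplus>\<^bsub>S\<^esub> (fs ! i) \<otimes>\<^bsub>S\<^esub> y | x y. x \<in> ?I i \<and> y \<in> carrier S}"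
    if "i < length fs" for i
    by (rule seq_submodule_Suc[OF S fs that])
  have Isub: "?I i \<subseteq> carrier S" if "i \<le> length fs" for i
    by (rule seq_submodule_subset[OF S fs that])
  have "length fs \<le> k"
  proof (rule algebraically_independent_le)
    fix F :: "'a mpoly" assume F: "F \<in> polys (length fs)" "subst \<sigma> F = 0"
    show "F = 0"
    proof (rule regular_imp_algebraically_independent[OF \<sigma>(1) _ _ _ _ F])
      show "J 0 = {0}"
      proof -
        have "p = 0" if "p \<in> polys k" "\<theta> p = \<zero>\<^bsub>S\<^esub>" for p
          using that \<theta>0 by (intro \<theta>inj) (simp_all add: polys_closed)
        then show ?thesis
          unfolding J_def take_0 seq_submodule_0[OF S] using \<theta>0 by (auto simp: polys_closed)
      qed
    next
      fix i assume i: "i < length fs"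
      show "J (Suc i) = {p + \<sigma> i * q | p q. p \<in> J i \<and> q \<in> polys k}"
      proof (intro equalityI subsetI)
        fix p assume "p \<in> J (Suc i)"
        then obtain x y where p: "p \<in> polys k" "\<theta> p = x \<oplus>\<^bsub>S\<^esub> fs ! i \<otimes>\<^bsub>S\<^esub> y"
          and xy: "x \<in> ?I i" "y \<in> carrier S"
          unfolding J_def ISuc[OF i] by blast
        from xy obtain u v where uv: "u \<in> polys k" "x = \<theta> u" "v \<in> polys k" "y = \<theta> v"
          using \<theta>sur[of x] \<theta>sur[of y] subsetD[OF Isub[OF less_imp_le[OF i]]] by blast
        have "\<theta> p = \<theta> (u + \<sigma> i * v)"
          using uv \<sigma> i by (simp add: p \<theta>add \<theta>mult polys_closed)
        then have "p = u + \<sigma> i * v"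
          using p uv \<sigma>(1)[OF i] by (intro \<theta>inj) (simp_all add: polys_closed)
        then show "p \<in> {p + \<sigma> i * q | p q. p \<in> J i \<and> q \<in> polys k}"
          using uv xy unfolding J_def by blast
      next
        fix p assume "p \<in> {p + \<sigma> i * q | p q. p \<in> J i \<and> q \<in> polys k}"
        then obtain u v where p: "p = u + \<sigma> i * v" "u \<in> polys k" "\<theta> u \<in> ?I i" "v \<in> polys k"
          unfolding J_def by blast
        have "\<theta> p = \<theta> u \<oplus>\<^bsub>S\<^esub> fs ! i \<otimes>\<^bsub>S\<^esub> \<theta> v"
          using p \<sigma> i by (simp add: \<theta>add \<theta>mult polys_closed)
        then have "\<theta> p \<in> ?I (Suc i)" unfolding ISuc[OF i] using p \<theta>cl by blast
        moreover have "p \<in> polys k" unfolding p(1) using p \<sigma>(1)[OF i] by (simp add: polys_closed)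
        ultimately show "p \<in> J (Suc i)" by (simp add: J_def)
      qed
    next
      fix i q assume i: "i < length fs" and q: "q \<in> polys k" "\<sigma> i * q \<in> J i"
      have "fs ! i \<otimes>\<^bsub>S\<^esub> \<theta> q \<in> ?I i"
        using q \<sigma>[OF i] by (simp add: J_def \<theta>mult)
      then have "\<theta> q \<in> ?I i"
        using reg i \<theta>cl[OF q(1)] by (simp add: regular_sequence_def)
      then show "q \<in> J i" using q by (simp add: J_def)
    next
      have "?I (length fs) \<noteq> carrier S" using reg by (simp add: regular_sequence_def)
      then obtain x where x: "x \<in> carrier S" "x \<notin> ?I (length fs)" using Isub by blast
      obtain p where "p \<in> polys k" "x = \<theta> p" using \<theta>sur[OF x(1)] by blast
      then show "J (length fs) \<noteq> polys k" using x by (auto simp: J_def)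
    qed
  qed (rule \<sigma>)
  then show "enat (length fs) \<le> enat k" by simp
qed

text \<open>
  The variables form a regular sequence. The ideal generated by the first \<open>i\<close> of them is spanned
  by the monomials in \<open>X i\<close>, and multiplication by \<open>x\<^sub>i\<close> does not affect membership of a monomial in \<open>X i\<close>.
\<close>

lemma depth_poly_ring_ge:
  "enat k \<le> depth (poly_ring k :: ('a::field, 'a mpoly) graded) (shift (self_module (poly_ring k)) s)"
proof -
  let ?R = "poly_ring k :: ('a, 'a mpoly) graded"
  interpret cring ?R by (rule cring_poly_ring)
  define fs where "fs = map (var :: nat \<Rightarrow> 'a mpoly) [0..<k]"
  let ?I = "\<lambda>i. seq_submodule (shift (self_module ?R) s) (take i fs)"
  define X where "X i = {m \<in> monomials k. \<exists>l<i. Poly_Mapping.lookup m l \<noteq> 0}" for i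
  have len: "length fs = k" and nth: "\<And>i. i < k \<Longrightarrow> fs ! i = var i"
    by (simp_all add: fs_def)
  have fs: "set fs \<subseteq> carrier ?R" by (auto simp: fs_def intro: polys_closed)
  have I: "?I i = supported (X i)" if "i \<le> k" for i
    using that
  proof (induction i)
    case 0
    then show ?case using seq_submodule_0[OF cring_poly_ring] by (simp add: X_def supported_def)
  next
    case (Suc i)
    then have i: "i < k" and IH: "?I i = supported (X i)" by simp_all
    have "?I (Suc i) = {p + var i * q | p q. p \<in> supported (X i) \<and> q \<in> polys k}"
      using seq_submodule_Suc[OF cring_poly_ring fs, of i] i IH by (simp add: len nth)
    also have "\<dots> = supported (X (Suc i))"
    proof (intro equalityI subsetI)
      fix p assume "p \<in> {p + var i * q | p q. p \<in> supported (X i) \<and> q \<in> polys k}"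
      then obtain u v where p: "p = u + var i * v" "u \<in> supported (X i)" "v \<in> supported (monomials k)"
        by (auto simp: polys_eq_supported)
      have "u \<in> supported (X (Suc i))" using p(2) by (auto simp: supported_def X_def less_Suc_eq)
      moreover have "var i * v \<in> supported (X (Suc i))"
      proof (rule supported_mult[OF _ p(3)])
        show "var i \<in> supported {Poly_Mapping.single i 1}" by (simp add: var_def)
        show "x + y \<in> X (Suc i)" if "x \<in> {Poly_Mapping.single i 1}" "y \<in> monomials k" for x y
          using that i by (auto simp: X_def lookup_add intro!: exI[of _ i])
      qed
      ultimately show "p \<in> supported (X (Suc i))" unfolding p(1) by (rule supported_add)
    next
      fix p :: "'a mpoly" assume "p \<in> supported (X (Suc i))"
      then obtain F0 G where FG: "p = F0 + var i * G"
        and F0: "F0 \<in> supported {m \<in> X (Suc i). Poly_Mapping.lookup m i = 0}"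
        and G: "G \<in> supported {m. m + Poly_Mapping.single i 1 \<in> X (Suc i)}"
        by (rule split_off_var)
      have "F0 \<in> supported (X i)"
        using F0 by (auto simp: supported_def X_def less_Suc_eq)
      moreover have "G \<in> polys k" using G by (auto simp: supported_def X_def polys_eq_supported)
      ultimately show "p \<in> {p + var i * q | p q. p \<in> supported (X i) \<and> q \<in> polys k}"
        using FG by blast
    qed
    finally show ?case .
  qed
  have "regular_sequence (shift (self_module ?R) s) fs"
    unfolding regular_sequence_def
  proof (intro conjI allI impI ballI)
    fix i p assume i: "i < length fs" and "p \<in> carrier (shift (self_module ?R) s)"
      and h: "fs ! i \<odot>\<^bsub>shift (self_module ?R) s\<^esub> p \<in> ?I i"
    then have p: "p \<in> supported (monomials k)" and ik: "i < k" and h: "var i * p \<in> supported (X i)"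
      using nth I by (simp_all add: len polys_eq_supported)
    let ?q = "part (- X i) p"
    \<comment> \<open>Monomials outside \<open>X i\<close> stay outside under multiplication by \<open>x\<^sub>i\<close>, so the part of \<open>p\<close> supported there must vanish.\<close>
    have "p = part (X i) p + ?q"
      by (rule poly_mapping_eqI) (simp add: lookup_add lookup_part when_def)
    then have eq: "var i * ?q = var i * p - var i * part (X i) p"
      by (metis add_diff_cancel_left' distrib_left)
    have "var i * part (X i) p \<in> supported (X i)"
    proof (rule supported_mult[OF _ part_supported])
      show "var i \<in> supported {Poly_Mapping.single i 1}" by (simp add: var_def)
      show "x + y \<in> X i" if "x \<in> {Poly_Mapping.single i 1}" "y \<in> X i" for x y
        using that ik by (auto simp: X_def lookup_add)
    qed
    then have "var i * ?q \<in> supported (X i)"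
      unfolding eq using h by (rule supported_diff[rotated])
    moreover have "var i * ?q \<in> supported (- X i)"
    proof (rule supported_mult)
      show "var i \<in> supported {Poly_Mapping.single i 1}" by (simp add: var_def)
      show "?q \<in> supported (monomials k - X i)"
        using p by (auto simp: supported_iff lookup_part)
      show "x + y \<in> - X i" if "x \<in> {Poly_Mapping.single i 1}" "y \<in> monomials k - X i" for x y
        using that ik by (auto simp: X_def lookup_add lookup_single)
    qed
    ultimately have "var i * ?q = 0" by (auto simp: supported_def simp flip: keys_eq_empty)
    moreover have "(var i :: 'a mpoly) \<noteq> 0"
      unfolding var_def by (metis keys_single keys_zero insert_not_empty one_neq_zero)
    ultimately have "?q = 0" by simp
    then have "p \<in> supported (X i)" using \<open>p = part (X i) p + ?q\<close> part_supported[of "X i" p] by simp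
    then show "p \<in> ?I i" using I[of i] ik by simp
  next
    have "1 \<notin> ?I k" unfolding I[OF order_refl] by (auto simp: X_def supported_def)
    then show "seq_submodule (shift (self_module ?R) s) fs \<noteq> carrier (shift (self_module ?R) s)"
      using polys_closed(2)[of k] by (auto simp: len[symmetric])
  qed
  moreover have "set fs \<subseteq> irrelevant_ideal ?R"
  proof -
    have "(\<Union>j\<in>{0<..}. component ?R j) \<subseteq> irrelevant_ideal ?R"
      unfolding irrelevant_ideal_def using homogeneous_polys[of k] by (intro genideal_self) auto
    moreover have "set fs \<subseteq> component ?R 1" by (auto simp: fs_def intro: homogeneous_closed)
    moreover have "component ?R 1 \<subseteq> (\<Union>j\<in>{0<..}. component ?R j)" by (rule UN_upper) simp
    ultimately show ?thesis by blast
  qed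
  ultimately have "enat (length fs) \<le> depth ?R (shift (self_module ?R) s)"
    unfolding depth_def by (intro SUP_upper) simp
  then show ?thesis by (simp add: len)
qed

section \<open>Hilbert functions of graded vector spaces\<close>

text \<open>
  The map \<open>h\<close> identifies \<open>M\<close> with the graded vector space with basis \<open>X\<close>. Only addition and scalar
  multiplication of \<open>M\<close> enter, so the notion also applies to \<open>direct_sum\<close>, where the
  ring operations are undefined.
\<close>

definition graded_coordinates ::
  "(('x \<Rightarrow>\<^sub>0 'a::field) \<Rightarrow> 'b) \<Rightarrow> 'x set \<Rightarrow> ('x \<Rightarrow> int) \<Rightarrow> ('a, 'b) graded \<Rightarrow> bool" where
  "graded_coordinates h X dg M \<longleftrightarrow>
     bij_betw h (supported X) (carrier M) \<and>
     (\<forall>p \<in> supported X. \<forall>q \<in> supported X. h (p + q) = h p \<oplus>\<^bsub>M\<^esub> h q) \<and>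
     (\<forall>a. \<forall>p \<in> supported X. h (scale a p) = a \<odot>\<^bsub>M\<^esub> h p) \<and>
     (\<forall>j. h ` supported {x \<in> X. dg x = j} = component M j)"

lemma graded_coordinatesD:
  assumes "graded_coordinates h X dg M"
  shows "bij_betw h (supported X) (carrier M)"
    "\<And>p q. p \<in> supported X \<Longrightarrow> q \<in> supported X \<Longrightarrow> h (p + q) = h p \<oplus>\<^bsub>M\<^esub> h q"
    "\<And>a p. p \<in> supported X \<Longrightarrow> h (scale a p) = a \<odot>\<^bsub>M\<^esub> h p"
    "\<And>j. h ` supported {x \<in> X. dg x = j} = component M j"
  using assms by (auto simp: graded_coordinates_def)

text \<open>
  Pullback along \<open>g\<close>, extended by zero. The support stays finite if \<open>g\<close> is injective on \<open>Y\<close>, and all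
  properties are stated under that condition.
\<close>

definition reindex :: "'y set \<Rightarrow> ('y \<Rightarrow> 'x) \<Rightarrow> ('x \<Rightarrow>\<^sub>0 'a::zero) \<Rightarrow> ('y \<Rightarrow>\<^sub>0 'a)" where
  "reindex Y g p = Abs_poly_mapping (\<lambda>y. if y \<in> Y then Poly_Mapping.lookup p (g y) else 0)"

lemma lookup_reindex:
  assumes "inj_on g Y"
  shows "Poly_Mapping.lookup (reindex Y g p) y = (if y \<in> Y then Poly_Mapping.lookup p (g y) else 0)"
proof -
  let ?F = "{y. (if y \<in> Y then Poly_Mapping.lookup p (g y) else 0) \<noteq> 0}"
  have "g ` ?F \<subseteq> Poly_Mapping.keys p" by (auto simp: in_keys_iff split: if_splits)
  then have "finite (g ` ?F)" by (rule finite_subset) simp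
  moreover have "inj_on g ?F" by (rule inj_on_subset[OF assms]) (auto split: if_splits)
  ultimately have "finite ?F" by (rule finite_imageD)
  then show ?thesis by (simp add: reindex_def)
qed

lemma supported_mono: "X \<subseteq> Y \<Longrightarrow> supported X \<subseteq> supported Y"
  by (auto simp: supported_def)

text \<open>
  In coordinates the isomorphism becomes a linear bijection \<open>\<psi>\<close> between the components of degree \<open>j\<close>, and the
  invariance of dimension applies to \<open>\<psi>\<close> and to its inverse.
\<close>

lemma graded_isomorphic_imp_hilbert_fun_eq:
  fixes h :: "('x \<Rightarrow>\<^sub>0 'a::field) \<Rightarrow> 'b" and h' :: "('y \<Rightarrow>\<^sub>0 'a) \<Rightarrow> 'c"
  assumes iso: "graded_isomorphic field_ring M N"
    and h: "graded_coordinates h X dg M" and h': "graded_coordinates h' Y dg' N"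
    and fin: "finite {x \<in> X. dg x = j}" "finite {y \<in> Y. dg' y = j}"
  shows "hilbert_fun dg X j = hilbert_fun dg' Y j"
proof -
  from iso obtain f where f: "bij_betw f (carrier M) (carrier N)"
    and fadd: "\<And>x y. x \<in> carrier M \<Longrightarrow> y \<in> carrier M \<Longrightarrow> f (x \<oplus>\<^bsub>M\<^esub> y) = f x \<oplus>\<^bsub>N\<^esub> f y"
    and fscale: "\<And>a x. x \<in> carrier M \<Longrightarrow> f (a \<odot>\<^bsub>M\<^esub> x) = a \<odot>\<^bsub>N\<^esub> f x"
    and fcomp: "f ` component M j = component N j"
    unfolding graded_isomorphic_def by auto
  note hD = graded_coordinatesD[OF h] and hD' = graded_coordinatesD[OF h']
  let ?X = "{x \<in> X. dg x = j}" and ?Y = "{y \<in> Y. dg' y = j}"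
  let ?g = "\<lambda>p. f (h p)"
  have g: "bij_betw ?g (supported X) (carrier N)"
    using bij_betw_trans[OF hD(1) f] by (simp add: comp_def)
  have hcl: "h p \<in> carrier M" if "p \<in> supported X" for p
    using hD(1) that by (rule bij_betw_apply)
  define \<psi> where "\<psi> p = the_inv_into (supported Y) h' (?g p)" for p
  have inj': "inj_on h' (supported Y)" using hD'(1) by (rule bij_betw_imp_inj_on)
  have h\<psi>: "h' (\<psi> p) = ?g p" "\<psi> p \<in> supported Y" if "p \<in> supported X" for p
  proof -
    have "?g p \<in> h' ` supported Y"
      using bij_betw_apply[OF g that] bij_betw_imp_surj_on[OF hD'(1)] by simp
    then show "h' (\<psi> p) = ?g p" "\<psi> p \<in> supported Y"
      unfolding \<psi>_def by (simp_all add: f_the_inv_into_f[OF inj'] the_inv_into_into[OF inj'])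
  qed
  have \<psi>eq: "\<psi> p = q" if "p \<in> supported X" "q \<in> supported Y" "h' q = ?g p"
    for p and q :: "'y \<Rightarrow>\<^sub>0 'a"
    using inj_onD[OF inj', of "\<psi> p" q] h\<psi>[OF that(1)] that by simp
  have \<psi>add: "\<psi> (p + q) = \<psi> p + \<psi> q" if "p \<in> supported X" "q \<in> supported X" for p q
    using that by (intro \<psi>eq) (simp_all add: supported_add h\<psi> hD hD' fadd hcl)
  have \<psi>scale: "\<psi> (scale a p) = scale a (\<psi> p)" if "p \<in> supported X" for a p
    using that by (intro \<psi>eq) (simp_all add: supported_scale h\<psi> hD hD' fscale hcl)
  have \<psi>inj: "inj_on \<psi> (supported X)"
  proof (rule inj_onI)
    fix p q assume pq: "p \<in> supported X" "q \<in> supported X" "\<psi> p = \<psi> q"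
    then have "?g p = ?g q" using h\<psi>(1)[of p] h\<psi>(1)[of q] by simp
    then show "p = q" using inj_onD[OF bij_betw_imp_inj_on[OF g]] pq by blast
  qed
  have sub: "supported ?X \<subseteq> supported X" "supported ?Y \<subseteq> supported Y"
    by (auto intro!: supported_mono)
  note subX = subsetD[OF sub(1)]
  have img0: "?g ` supported ?X = h' ` supported ?Y"
    by (simp only: image_image[symmetric] hD(4) hD'(4) fcomp)
  have img: "\<psi> ` supported ?X = supported ?Y"
  proof (intro equalityI subsetI)
    fix q assume "q \<in> \<psi> ` supported ?X"
    then obtain p where p: "p \<in> supported ?X" "q = \<psi> p" by blast
    then have "?g p \<in> h' ` supported ?Y" unfolding img0[symmetric] by (intro imageI)
    then obtain r where r: "?g p = h' r" "r \<in> supported ?Y" by (rule imageE)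
    then have "\<psi> p = r" using \<psi>eq[OF subsetD[OF sub(1) p(1)] subsetD[OF sub(2) r(2)]] by simp
    then show "q \<in> supported ?Y" using p(2) r(2) by simp
  next
    fix q :: "'y \<Rightarrow>\<^sub>0 'a" assume q: "q \<in> supported ?Y"
    then have "h' q \<in> ?g ` supported ?X" unfolding img0 by (rule imageI)
    then obtain p where p: "h' q = ?g p" "p \<in> supported ?X" by (rule imageE)
    then have "\<psi> p = q" using \<psi>eq[OF subsetD[OF sub(1) p(2)] subsetD[OF sub(2) q]] by simp
    then show "q \<in> \<psi> ` supported ?X" using p(2) by blast
  qed
  have "card ?X \<le> card ?Y"
  proof (rule card_le_of_linear_injection[OF fin, of \<psi>])
    show "\<psi> (p + q) = \<psi> p + \<psi> q" if "p \<in> supported ?X" "q \<in> supported ?X" for p q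
      by (rule \<psi>add[OF subX[OF that(1)] subX[OF that(2)]])
    show "\<psi> (scale a p) = scale a (\<psi> p)" if "p \<in> supported ?X" for a p
      by (rule \<psi>scale[OF subX[OF that]])
    show "\<psi> ` supported ?X \<subseteq> supported ?Y" by (simp only: img order_refl)
  qed (rule inj_on_subset[OF \<psi>inj sub(1)])
  moreover have "card ?Y \<le> card ?X"
  proof (rule card_le_of_linear_injection[OF fin(2,1), of "the_inv_into (supported ?X) \<psi>"])
    have bij: "bij_betw \<psi> (supported ?X) (supported ?Y)"
      using inj_on_subset[OF \<psi>inj sub(1)] img by (simp add: bij_betw_def)
    let ?i = "the_inv_into (supported ?X) \<psi>"
    have ibij: "bij_betw ?i (supported ?Y) (supported ?X)" using bij by (rule bij_betw_the_inv_into)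
    then show "inj_on ?i (supported ?Y)" "?i ` supported ?Y \<subseteq> supported ?X"
      by (auto simp: bij_betw_def)
    have i: "?i q = p" if "p \<in> supported ?X" "\<psi> p = q" for p q
      using the_inv_into_f_f[OF bij_betw_imp_inj_on[OF bij] that(1)] that(2) by simp
    have icl: "?i q \<in> supported ?X" "\<psi> (?i q) = q" if "q \<in> supported ?Y" for q
      using bij_betw_apply[OF ibij that] f_the_inv_into_f_bij_betw[OF bij that] by simp_all
    show "?i (p + q) = ?i p + ?i q" if "p \<in> supported ?Y" "q \<in> supported ?Y" for p q
    proof (rule i)
      show "?i p + ?i q \<in> supported ?X"
        using icl(1)[OF that(1)] icl(1)[OF that(2)] by (rule supported_add)
      show "\<psi> (?i p + ?i q) = p + q"
        by (simp only: \<psi>add[OF subX[OF icl(1)[OF that(1)]] subX[OF icl(1)[OF that(2)]]] icl(2) that)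
    qed
    show "?i (scale a p) = scale a (?i p)" if "p \<in> supported ?Y" for a p
    proof (rule i)
      show "scale a (?i p) \<in> supported ?X" using icl(1)[OF that] by (rule supported_scale)
      show "\<psi> (scale a (?i p)) = scale a p"
        by (simp only: \<psi>scale[OF subX[OF icl(1)[OF that]]] icl(2) that)
    qed
  qed
  ultimately show ?thesis by (simp add: hilbert_fun_def)
qed

lemma degree_preserving_bijection:
  assumes fin: "\<And>j. finite {x \<in> X. dg x = j}" "\<And>j. finite {y \<in> Y. dg' y = j}"
    and eq: "\<And>j. hilbert_fun dg X j = hilbert_fun dg' Y j"
  obtains b where "bij_betw b X Y" "\<And>x. x \<in> X \<Longrightarrow> dg' (b x) = dg x"
proof -
  have "\<exists>f. bij_betw f {x \<in> X. dg x = j} {y \<in> Y. dg' y = j}" for j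
    by (rule finite_same_card_bij[OF fin(1) fin(2) eq[unfolded hilbert_fun_def]])
  then obtain f where f: "\<And>j. bij_betw (f j) {x \<in> X. dg x = j} {y \<in> Y. dg' y = j}"
    using choice[of "\<lambda>j f. bij_betw f {x \<in> X. dg x = j} {y \<in> Y. dg' y = j}"] by blast
  define b where "b x = f (dg x) x" for x
  have b: "b x \<in> Y" "dg' (b x) = dg x" if "x \<in> X" for x
  proof -
    have "b x \<in> {y \<in> Y. dg' y = dg x}"
      unfolding b_def by (rule bij_betw_apply[OF f]) (simp add: that)
    then show "b x \<in> Y" "dg' (b x) = dg x" by simp_all
  qed
  have "bij_betw b X Y"
  proof (rule bij_betwI')
    show "b x = b y \<longleftrightarrow> x = y" if xy: "x \<in> X" "y \<in> X" for x y
    proof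
      assume e: "b x = b y"
      then have "dg' (b x) = dg' (b y)" by simp
      then have d: "dg x = dg y" by (simp only: b(2)[OF xy(1)] b(2)[OF xy(2)])
      show "x = y"
        by (rule inj_onD[OF bij_betw_imp_inj_on[OF f[of "dg x"]]]) (use e d xy in \<open>simp_all add: b_def\<close>)
    qed simp
    show "\<exists>x\<in>X. y = b x" if "y \<in> Y" for y
    proof -
      have "y \<in> f (dg' y) ` {x \<in> X. dg x = dg' y}"
        using bij_betw_imp_surj_on[OF f[of "dg' y"]] that by simp
      then obtain x where "y = f (dg' y) x" "x \<in> {x \<in> X. dg x = dg' y}" by (rule imageE)
      then show ?thesis by (intro bexI[of _ x]) (simp_all add: b_def)
    qed
  qed (rule b)
  then show thesis using b(2) by (rule that)
qed

text \<open>
  A degree-preserving bijection of the bases induces an isomorphism.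
\<close>

lemma hilbert_fun_eq_imp_graded_isomorphic:
  fixes h :: "('x \<Rightarrow>\<^sub>0 'a::field) \<Rightarrow> 'b" and h' :: "('y \<Rightarrow>\<^sub>0 'a) \<Rightarrow> 'c"
  assumes h: "graded_coordinates h X dg M" and h': "graded_coordinates h' Y dg' N"
    and fin: "\<And>j. finite {x \<in> X. dg x = j}" "\<And>j. finite {y \<in> Y. dg' y = j}"
    and eq: "\<And>j. hilbert_fun dg X j = hilbert_fun dg' Y j"
  shows "graded_isomorphic field_ring M N"
proof -
  note hD = graded_coordinatesD[OF h] and hD' = graded_coordinatesD[OF h']
  obtain b where b: "bij_betw b X Y" and bdg: "\<And>x. x \<in> X \<Longrightarrow> dg' (b x) = dg x"
    by (rule degree_preserving_bijection[OF fin eq]) (rule that)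
  define c where "c = the_inv_into X b"
  have c: "bij_betw c Y X" unfolding c_def using b by (rule bij_betw_the_inv_into)
  have cb: "c (b x) = x" if "x \<in> X" for x
    using the_inv_into_f_f[OF bij_betw_imp_inj_on[OF b] that] by (simp add: c_def)
  have bc: "b (c y) = y" if "y \<in> Y" for y
    using f_the_inv_into_f_bij_betw[OF b that] by (simp add: c_def)
  have bY: "b x \<in> Y" if "x \<in> X" for x using b that by (rule bij_betw_apply)
  have cX: "c y \<in> X" if "y \<in> Y" for y using c that by (rule bij_betw_apply)
  have lr: "Poly_Mapping.lookup (reindex Y c p) y = (if y \<in> Y then Poly_Mapping.lookup p (c y) else 0)"
    for p :: "'x \<Rightarrow>\<^sub>0 'a" and y
    using bij_betw_imp_inj_on[OF c] by (rule lookup_reindex)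
  have lb: "Poly_Mapping.lookup (reindex X b p) x = (if x \<in> X then Poly_Mapping.lookup p (b x) else 0)"
    for p :: "'y \<Rightarrow>\<^sub>0 'a" and x
    using bij_betw_imp_inj_on[OF b] by (rule lookup_reindex)
  have r1: "reindex X b (reindex Y c p) = p" if "p \<in> supported X" for p :: "'x \<Rightarrow>\<^sub>0 'a"
    using that by (intro poly_mapping_eqI) (auto simp: lb lr bY cb supported_iff)
  have r2: "reindex Y c (reindex X b p) = p" if "p \<in> supported Y" for p :: "'y \<Rightarrow>\<^sub>0 'a"
    using that by (intro poly_mapping_eqI) (auto simp: lb lr cX bc supported_iff)
  have rY: "reindex Y c p \<in> supported Y" for p :: "'x \<Rightarrow>\<^sub>0 'a" by (simp add: supported_iff lr)
  have rX: "reindex X b p \<in> supported X" for p :: "'y \<Rightarrow>\<^sub>0 'a" by (simp add: supported_iff lb)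
  have bijr: "bij_betw (reindex Y c :: ('x \<Rightarrow>\<^sub>0 'a) \<Rightarrow> _) (supported X) (supported Y)"
    by (rule bij_betw_byWitness[of _ "reindex X b"]) (use r1 r2 rX rY in auto)
  define k where "k = the_inv_into (supported X) h"
  have k: "bij_betw k (carrier M) (supported X)"
    unfolding k_def using hD(1) by (rule bij_betw_the_inv_into)
  have hk: "h (k x) = x" if "x \<in> carrier M" for x
    using f_the_inv_into_f_bij_betw[OF hD(1) that] by (simp add: k_def)
  have kh: "k (h p) = p" if "p \<in> supported X" for p
    using the_inv_into_f_f[OF bij_betw_imp_inj_on[OF hD(1)] that] by (simp add: k_def)
  have kcl: "k x \<in> supported X" if "x \<in> carrier M" for x
    using k that by (rule bij_betw_apply)
  have kadd: "k (x \<oplus>\<^bsub>M\<^esub> y) = k x + k y" if "x \<in> carrier M" "y \<in> carrier M" for x y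
    using kh[OF supported_add[OF kcl[OF that(1)] kcl[OF that(2)]]] that by (simp add: hD kcl hk)
  have kscale: "k (a \<odot>\<^bsub>M\<^esub> x) = scale a (k x)" if "x \<in> carrier M" for a x
    using kh[OF supported_scale[OF kcl[OF that]]] that by (simp add: hD kcl hk)
  let ?f = "\<lambda>x. h' (reindex Y c (k x))"
  have radd: "reindex Y c (p + q) = reindex Y c p + reindex Y c q" for p q :: "'x \<Rightarrow>\<^sub>0 'a"
    by (rule poly_mapping_eqI) (simp add: lr lookup_add)
  have rscale: "reindex Y c (scale a p) = scale a (reindex Y c p)" for a and p :: "'x \<Rightarrow>\<^sub>0 'a"
    by (rule poly_mapping_eqI) (simp add: lr lookup_scale)
  show ?thesis
    unfolding graded_isomorphic_def
  proof (intro exI[of _ ?f] conjI ballI allI)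
    show "bij_betw ?f (carrier M) (carrier N)"
      using bij_betw_trans[OF bij_betw_trans[OF k bijr] hD'(1)] by (simp add: comp_def)
    show "?f (x \<oplus>\<^bsub>M\<^esub> y) = ?f x \<oplus>\<^bsub>N\<^esub> ?f y" if "x \<in> carrier M" "y \<in> carrier M" for x y
      using that by (simp add: kadd radd hD' rY)
    show "?f (a \<odot>\<^bsub>M\<^esub> x) = a \<odot>\<^bsub>N\<^esub> ?f x" if "x \<in> carrier M" for a x
      using that by (simp add: kscale rscale hD' rY)
    show "?f ` component M j = component N j" for j
    proof -
      have "k ` component M j = supported {x \<in> X. dg x = j}"
      proof -
        have "k ` h ` supported {x \<in> X. dg x = j} = (\<lambda>p. p) ` supported {x \<in> X. dg x = j}"
          unfolding image_image
          by (rule image_cong[OF refl]) (rule kh, rule subsetD[OF supported_mono], auto)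
        then show ?thesis by (simp add: hD(4))
      qed
      moreover have "reindex Y c ` supported {x \<in> X. dg x = j} = (supported {y \<in> Y. dg' y = j} :: ('y \<Rightarrow>\<^sub>0 'a) set)"
      proof (intro equalityI subsetI)
        fix q :: "'y \<Rightarrow>\<^sub>0 'a" assume "q \<in> reindex Y c ` supported {x \<in> X. dg x = j}"
        then obtain p :: "'x \<Rightarrow>\<^sub>0 'a" where p: "p \<in> supported {x \<in> X. dg x = j}" "q = reindex Y c p" by blast
        have "Poly_Mapping.lookup p (c y) = 0" if "y \<in> Y" "dg' y \<noteq> j" for y
          using p(1) bdg[OF cX[OF that(1)]] that bc[OF that(1)] by (auto simp: supported_iff)
        then show "q \<in> supported {y \<in> Y. dg' y = j}" by (auto simp: supported_iff p(2) lr)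
      next
        fix q :: "'y \<Rightarrow>\<^sub>0 'a" assume q: "q \<in> supported {y \<in> Y. dg' y = j}"
        then have "q \<in> supported Y" using supported_mono[of "{y \<in> Y. dg' y = j}" Y] by blast
        then have "q = reindex Y c (reindex X b q)" by (simp add: r2)
        moreover have "reindex X b q \<in> supported {x \<in> X. dg x = j}"
          using q by (auto simp: supported_iff lb bdg)
        ultimately show "q \<in> reindex Y c ` supported {x \<in> X. dg x = j}" by blast
      qed
      ultimately have "h' ` reindex Y c ` k ` component M j = component N j" by (simp add: hD'(4))
      then show ?thesis by (simp add: image_image)
    qed
  qed
qed

lemma graded_coordinates_shift:
  assumes "graded_coordinates h X dg M"
  shows "graded_coordinates h X (\<lambda>x. dg x + s) (shift M (- s))"
proof -
  have "(dg x + s = j) = (dg x = - s + j)" for x j by auto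
  then show ?thesis using assms by (simp add: graded_coordinates_def shift_def)
qed

text \<open>
  A basis of the direct sum is the disjoint union of the bases; the \<open>i\<close>-th summand reads off the
  coordinates with first index \<open>i\<close>.
\<close>

lemma graded_coordinates_direct_sum:
  fixes h :: "nat \<Rightarrow> ('x \<Rightarrow>\<^sub>0 'a::field) \<Rightarrow> 'b"
  assumes h: "\<And>i. i < l \<Longrightarrow> graded_coordinates (h i) (X i) (dg i) (N i)"
  shows "graded_coordinates (\<lambda>p. \<lambda>i\<in>{..<l}. h i (reindex UNIV (Pair i) p))
    (Sigma {..<l} X) (\<lambda>(i, x). dg i x) (direct_sum {..<l} N)"
proof -
  note hD = graded_coordinatesD[OF h]
  let ?r = "\<lambda>i. reindex UNIV (Pair i) :: (nat \<times> 'x \<Rightarrow>\<^sub>0 'a) \<Rightarrow> _"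
  let ?H = "\<lambda>p. \<lambda>i\<in>{..<l}. h i (?r i p)"
  have lr: "Poly_Mapping.lookup (?r i p) x = Poly_Mapping.lookup p (i, x)" for i p x
    by (subst lookup_reindex) (auto simp: inj_on_def)
  have rcl: "?r i p \<in> supported (Y i)" if "p \<in> supported (Sigma {..<l} Y)" for i p and Y :: "nat \<Rightarrow> 'x set"
    using that by (auto simp: supported_iff lr)
  have ex: "\<exists>p \<in> supported (Sigma {..<l} Y). ?H p = y"
    if y: "y \<in> (\<Pi>\<^sub>E i\<in>{..<l}. h i ` supported (Y i))" for y and Y :: "nat \<Rightarrow> 'x set"
  proof -
    \<comment> \<open>The coordinate vectors of the summands are glued to a single vector \<open>p\<close>.\<close>
    define q where "q i = inv_into (supported (Y i)) (h i) (y i)" for i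
    have q: "q i \<in> supported (Y i)" "y i = h i (q i)" if "i < l" for i
    proof -
      have "y i \<in> h i ` supported (Y i)" using PiE_mem[OF y, of i] that by simp
      then show "q i \<in> supported (Y i)" "y i = h i (q i)"
        unfolding q_def by (simp_all add: inv_into_into f_inv_into_f)
    qed
    define p where "p = Abs_poly_mapping (\<lambda>(i, x). if i < l then Poly_Mapping.lookup (q i) x else 0)"
    have "{z. (case z of (i, x) \<Rightarrow> if i < l then Poly_Mapping.lookup (q i) x else 0) \<noteq> 0}
        \<subseteq> Sigma {..<l} (\<lambda>i. Poly_Mapping.keys (q i))"
      by (auto simp: in_keys_iff split: if_splits)
    then have "finite {z. (case z of (i, x) \<Rightarrow> if i < l then Poly_Mapping.lookup (q i) x else 0) \<noteq> 0}"
      by (rule finite_subset) auto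
    then have lp: "Poly_Mapping.lookup p (i, x) = (if i < l then Poly_Mapping.lookup (q i) x else 0)" for i x
      by (simp add: p_def)
    have "?r i p = q i" if "i < l" for i
      by (rule poly_mapping_eqI) (simp add: lr lp that)
    then have "?H p i = y i" for i
      using q(2) PiE_arb[OF y, of i] by (cases "i < l") auto
    then have "?H p = y" by (rule ext)
    moreover have "p \<in> supported (Sigma {..<l} Y)"
      using q(1) by (auto simp: supported_iff lp)
    ultimately show ?thesis by blast
  qed
  have img: "?H ` supported (Sigma {..<l} Y) = (\<Pi>\<^sub>E i\<in>{..<l}. h i ` supported (Y i))" for Y
  proof (intro equalityI subsetI)
    fix y assume "y \<in> ?H ` supported (Sigma {..<l} Y)"
    then obtain p where "p \<in> supported (Sigma {..<l} Y)" "y = ?H p" by blast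
    then show "y \<in> (\<Pi>\<^sub>E i\<in>{..<l}. h i ` supported (Y i))" using rcl by (simp add: restrict_PiE_iff)
  qed (use ex in blast)
  have inj: "inj_on ?H (supported (Sigma {..<l} X))"
  proof (rule inj_onI)
    fix p q assume pq: "p \<in> supported (Sigma {..<l} X)" "q \<in> supported (Sigma {..<l} X)" "?H p = ?H q"
    have "?r i p = ?r i q" if i: "i < l" for i
    proof -
      have "h i (?r i p) = h i (?r i q)" using fun_cong[OF pq(3), of i] i by simp
      then show ?thesis
        using inj_onD[OF bij_betw_imp_inj_on[OF hD(1)[OF i]]] rcl[OF pq(1)] rcl[OF pq(2)] by blast
    qed
    then have e: "Poly_Mapping.lookup p (i, x) = Poly_Mapping.lookup q (i, x)" if "i < l" for i x
      using that lr by metis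
    show "p = q"
    proof (rule poly_mapping_eqI)
      fix z :: "nat \<times> 'x"
      obtain i x where z: "z = (i, x)" by (cases z)
      show "Poly_Mapping.lookup p z = Poly_Mapping.lookup q z"
        using e pq(1,2) by (cases "i < l") (simp_all add: z supported_iff)
    qed
  qed
  have radd: "?r i (p + q) = ?r i p + ?r i q" for i p q
    by (rule poly_mapping_eqI) (simp add: lr lookup_add)
  have rscale: "?r i (scale a p) = scale a (?r i p)" for i a p
    by (rule poly_mapping_eqI) (simp add: lr lookup_scale)
  show ?thesis
    unfolding graded_coordinates_def
  proof (intro conjI ballI allI)
    have "(\<Pi>\<^sub>E i\<in>{..<l}. h i ` supported (X i)) = (\<Pi>\<^sub>E i\<in>{..<l}. carrier (N i))"
      by (rule PiE_cong) (use bij_betw_imp_surj_on[OF hD(1)] in simp)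
    with img[of X] have "?H ` supported (Sigma {..<l} X) = carrier (direct_sum {..<l} N)"
      unfolding direct_sum_def by simp
    with inj show "bij_betw ?H (supported (Sigma {..<l} X)) (carrier (direct_sum {..<l} N))"
      by (rule bij_betw_imageI)
    show "?H (p + q) = ?H p \<oplus>\<^bsub>direct_sum {..<l} N\<^esub> ?H q"
      if "p \<in> supported (Sigma {..<l} X)" "q \<in> supported (Sigma {..<l} X)" for p q
      unfolding direct_sum_def by (rule ext) (simp add: restrict_def radd hD(2) rcl[OF that(1)] rcl[OF that(2)])
    show "?H (scale a p) = a \<odot>\<^bsub>direct_sum {..<l} N\<^esub> ?H p"
      if "p \<in> supported (Sigma {..<l} X)" for a p
      unfolding direct_sum_def by (rule ext) (simp add: restrict_def rscale hD(3) rcl[OF that])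
    show "?H ` supported {z \<in> Sigma {..<l} X. (case z of (i, x) \<Rightarrow> dg i x) = j}
        = component (direct_sum {..<l} N) j" for j
    proof -
      have "{z \<in> Sigma {..<l} X. (case z of (i, x) \<Rightarrow> dg i x) = j} = Sigma {..<l} (\<lambda>i. {x \<in> X i. dg i x = j})"
        by auto
      moreover have "(\<Pi>\<^sub>E i\<in>{..<l}. h i ` supported {x \<in> X i. dg i x = j}) = (\<Pi>\<^sub>E i\<in>{..<l}. component (N i) j)"
        by (rule PiE_cong) (simp add: hD(4))
      ultimately show ?thesis using img[of "\<lambda>i. {x \<in> X i. dg i x = j}"] by (simp add: direct_sum_def)
    qed
  qed
qed

lemma hilbert_fun_Sigma:
  fixes l :: nat
  assumes "\<And>i. i < l \<Longrightarrow> finite {x \<in> X i. dg i x = j}"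
  shows "finite {z \<in> Sigma {..<l} X. (case z of (i, x) \<Rightarrow> dg i x) = j}"
    "hilbert_fun (\<lambda>(i, x). dg i x) (Sigma {..<l} X) j = (\<Sum>i<l. hilbert_fun (dg i) (X i) j)"
proof -
  have eq: "{z \<in> Sigma {..<l} X. (case z of (i, x) \<Rightarrow> dg i x) = j} = Sigma {..<l} (\<lambda>i. {x \<in> X i. dg i x = j})"
    by auto
  show "finite {z \<in> Sigma {..<l} X. (case z of (i, x) \<Rightarrow> dg i x) = j}"
    unfolding eq by (rule finite_SigmaI) (simp_all add: assms)
  show "hilbert_fun (\<lambda>(i, x). dg i x) (Sigma {..<l} X) j = (\<Sum>i<l. hilbert_fun (dg i) (X i) j)"
    unfolding hilbert_fun_def eq by (rule card_SigmaI) (use assms in auto)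
qed

section \<open>Hilbert depth of monomial ideals\<close>

text \<open>
  The numerical shadow of a Hilbert decomposition: a pair \<open>(k, s)\<close> stands for the polynomial ring in
  \<open>k\<close> variables with generator in degree \<open>s\<close>, with Hilbert series \<open>t\<^sup>s (1 - t)\<^bsup>-k\<^esup>\<close>.
\<close>

definition numerical_decomposition :: "nat \<Rightarrow> (int \<Rightarrow> nat) \<Rightarrow> (nat \<times> int) list \<Rightarrow> bool" where
  "numerical_decomposition n H L \<longleftrightarrow>
     (\<forall>(k, s) \<in> set L. k \<le> n) \<and> (\<forall>j. H j = (\<Sum>(k, s)\<leftarrow>L. count_monomials k (j - s)))"

definition numerical_depth :: "(nat \<times> int) list \<Rightarrow> enat" where
  "numerical_depth L = (INF (k, s) \<in> set L. enat k)"

lemma sum_list_nth: "(\<Sum>x\<leftarrow>xs. f x) = (\<Sum>i<length xs. f (xs ! i))"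
  by (simp add: sum_list_sum_nth lessThan_atLeast0)

text \<open>
  The inclusion is split by the homomorphism that sends the surplus variables to zero.
\<close>

lemma graded_retract_smaller_poly_ring:
  assumes "k \<le> n"
  shows "graded_retract field_ring (poly_ring n :: ('a::field, 'a mpoly) graded) (poly_ring k)"
proof -
  let ?g = "subst (\<lambda>i. if i < k then var i else 0) :: 'a mpoly \<Rightarrow> 'a mpoly"
  have hom_mono: "homogeneous k j \<subseteq> (homogeneous n j :: 'a mpoly set)" for j
  proof -
    have "monomials k \<subseteq> monomials n" using assms by (force simp: monomials_def)
    then show ?thesis unfolding homogeneous_def by (intro supported_mono) blast
  qed
  have "(\<lambda>p. p) \<in> graded_algebra_hom field_ring (poly_ring k) (poly_ring n :: ('a, 'a mpoly) graded)"
    using polys_mono[OF assms] hom_mono by (auto simp: graded_algebra_hom_def intro!: ring_hom_memI)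
  moreover have "?g \<in> graded_algebra_hom field_ring (poly_ring n) (poly_ring k)"
  proof -
    have "?g p \<in> polys k" if "p \<in> polys n" for p
      using that by (rule subst_polys) (simp add: polys_closed)
    moreover have "?g p \<in> homogeneous k j" if "p \<in> homogeneous n j" for p j
      using that by (rule subst_homogeneous) (simp add: homogeneous_closed)
    ultimately show ?thesis
      by (auto simp: graded_algebra_hom_def subst_mult subst_add intro!: ring_hom_memI)
  qed
  moreover have "?g p = p" if "p \<in> polys k" for p
    using subst_cong[OF that, of "\<lambda>i. if i < k then var i else 0" var] by simp
  ultimately have "\<exists>f\<in>graded_algebra_hom field_ring (poly_ring k) (poly_ring n).
      \<exists>g\<in>graded_algebra_hom field_ring (poly_ring n) (poly_ring k). \<forall>p\<in>carrier (poly_ring k). g (f p) = (p :: 'a mpoly)"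
    by (rule_tac bexI[of _ "\<lambda>p. p"], rule_tac bexI[of _ ?g]) simp_all
  then show ?thesis
    unfolding graded_retract_def using graded_algebra_poly_ring by blast
qed

lemma graded_coordinates_poly_ring_iso:
  assumes "\<theta> \<in> graded_algebra_hom field_ring (poly_ring k) S"
    "bij_betw \<theta> (polys k) (carrier S)" "\<And>j. \<theta> ` homogeneous k j = component S j"
  shows "graded_coordinates \<theta> (monomials k) mdeg S"
  unfolding graded_coordinates_def
proof (intro conjI ballI allI)
  have hom: "\<theta> \<in> ring_hom (poly_ring k) S"
    and smult: "\<And>a p. p \<in> polys k \<Longrightarrow> \<theta> (Poly_Mapping.single 0 a * p) = a \<odot>\<^bsub>S\<^esub> \<theta> p"
    using assms(1) by (auto simp: graded_algebra_hom_def)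
  show "bij_betw \<theta> (supported (monomials k)) (carrier S)"
    using assms(2) by (simp add: polys_eq_supported)
  show "\<theta> (p + q) = \<theta> p \<oplus>\<^bsub>S\<^esub> \<theta> q"
    if "p \<in> supported (monomials k)" "q \<in> supported (monomials k)" for p q
    using ring_hom_add[OF hom, of p q] that by (simp add: polys_eq_supported)
  show "\<theta> (scale a p) = a \<odot>\<^bsub>S\<^esub> \<theta> p" if "p \<in> supported (monomials k)" for a p
    using smult[of p a] that by (simp add: polys_eq_supported const_mult_eq_scale)
  show "\<theta> ` supported {x \<in> monomials k. mdeg x = j} = component S j" for j
    using assms(3)[of j] by (simp add: homogeneous_def)
qed

lemma graded_coordinates_poly_ring: "graded_coordinates (\<lambda>p. p) (monomials k) mdeg (poly_ring k)"
  by (rule graded_coordinates_poly_ring_iso)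
    (auto simp: graded_algebra_hom_def bij_betw_def intro!: ring_hom_memI)

lemma graded_coordinates_monomial_ideal:
  assumes "X \<subseteq> monomials n"
  shows "graded_coordinates (\<lambda>p. p) X mdeg
    (ideal_module (poly_ring n) (supported X :: 'a::field mpoly set))"
proof -
  have "supported X \<inter> homogeneous n j = (supported {x \<in> X. mdeg x = j} :: 'a mpoly set)" for j
    using assms by (auto simp: homogeneous_def supported_def)
  then show ?thesis
    by (simp add: graded_coordinates_def ideal_module_def bij_betw_def const_mult_eq_scale)
qed

lemma hilbert_fun_shift: "hilbert_fun (\<lambda>x. dg x + s) X j = hilbert_fun dg X (j - s)"
proof -
  have "(dg x + s = j) = (dg x = j - s)" for x by auto
  then show ?thesis by (simp add: hilbert_fun_def)
qed

lemma finite_shifted_monomials: "finite {m \<in> monomials k. mdeg m + s = j}"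
proof -
  have "(mdeg m + s = j) = (mdeg m = j - s)" for m by auto
  then show ?thesis by (simp add: finite_monomials_degree)
qed

text \<open>
  A Hilbert decomposition yields a numerical one, because its retracts are polynomial rings, of
  depth at most the number of their variables. Conversely, a numerical decomposition is realised by the
  polynomial rings \<open>poly_ring k\<close> themselves, whose depth is at least \<open>k\<close>.
\<close>

theorem Hdepth_monomial_ideal:
  assumes X: "X \<subseteq> monomials n"
  shows "Hdepth_ideal n (supported X :: 'a::field mpoly set)
    = (SUP L \<in> {L. numerical_decomposition n (hilbert_fun mdeg X) L}. numerical_depth L)"
proof -
  let ?R = "poly_ring n :: ('a, 'a mpoly) graded"
  let ?M = "ideal_module ?R (supported X)"
  note M = graded_coordinates_monomial_ideal[OF X]
  have finX: "finite {x \<in> X. mdeg x = j}" for j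
    by (rule finite_subset[OF _ finite_monomials_degree[of n j]]) (use X in auto)
  let ?sum = "\<lambda>H :: (('a, 'a mpoly) graded \<times> int) list.
    direct_sum {..<length H} (\<lambda>i. shift (fst (H ! i)) (- snd (H ! i)))"
  have sum_coord: "graded_coordinates (\<lambda>p. \<lambda>i\<in>{..<length H}. h i (reindex UNIV (Pair i) p))
      (Sigma {..<length H} (\<lambda>i. monomials (k i))) (\<lambda>(i, m). mdeg m + snd (H ! i)) (?sum H)"
    if "\<And>i. i < length H \<Longrightarrow> graded_coordinates (h i) (monomials (k i)) mdeg (fst (H ! i))" for H k h
    by (rule graded_coordinates_direct_sum) (rule graded_coordinates_shift[OF that])
  have sum_fin: "finite {z \<in> Sigma {..<l} (\<lambda>i. monomials (k i)). (case z of (i, m) \<Rightarrow> mdeg m + s i) = j}"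
    for k :: "nat \<Rightarrow> nat" and s l j
    by (rule hilbert_fun_Sigma(1)) (rule finite_shifted_monomials)
  have sum_hilb: "hilbert_fun (\<lambda>(i, m). mdeg m + s i) (Sigma {..<l} (\<lambda>i. monomials (k i))) j
      = (\<Sum>i<l. count_monomials (k i) (j - s i))" for k :: "nat \<Rightarrow> nat" and s l j
    by (subst hilbert_fun_Sigma(2)) (simp_all add: finite_shifted_monomials hilbert_fun_shift)
  show ?thesis
    unfolding Hdepth_ideal_def Hdepth_def
  proof (rule antisym; rule SUP_least)
    fix H assume "H \<in> {H. hilbert_decomposition field_ring ?R ?M H}"
    then have ret: "\<And>S s. (S, s) \<in> set H \<Longrightarrow> graded_retract field_ring ?R S"
      and iso: "graded_isomorphic field_ring ?M (?sum H)"
      by (auto simp: hilbert_decomposition_def)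
    have reti: "graded_retract field_ring ?R (fst (H ! i))" if "i < length H" for i
      using ret[of "fst (H ! i)" "snd (H ! i)"] that by simp
    have "\<exists>k \<theta>. k \<le> n \<and> \<theta> \<in> graded_algebra_hom field_ring (poly_ring k) (fst (H ! i)) \<and>
        bij_betw \<theta> (polys k) (carrier (fst (H ! i))) \<and>
        (\<forall>j. \<theta> ` homogeneous k j = component (fst (H ! i)) j)" if "i < length H" for i
      by (rule graded_retract_poly_ring[OF reti[OF that]]) blast
    then obtain k \<theta> where k: "\<And>i. i < length H \<Longrightarrow> k i \<le> n"
      and \<theta>: "\<And>i. i < length H \<Longrightarrow> \<theta> i \<in> graded_algebra_hom field_ring (poly_ring (k i)) (fst (H ! i))"
        "\<And>i. i < length H \<Longrightarrow> bij_betw (\<theta> i) (polys (k i)) (carrier (fst (H ! i)))"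
        "\<And>i j. i < length H \<Longrightarrow> \<theta> i ` homogeneous (k i) j = component (fst (H ! i)) j"
      by metis
    define L where "L = map (\<lambda>i. (k i, snd (H ! i))) [0..<length H]"
    have "hilbert_fun mdeg X j = (\<Sum>i<length H. count_monomials (k i) (j - snd (H ! i)))" for j
      unfolding sum_hilb[symmetric]
      by (rule graded_isomorphic_imp_hilbert_fun_eq[OF iso M sum_coord finX sum_fin])
        (rule graded_coordinates_poly_ring_iso[OF \<theta>])
    then have "numerical_decomposition n (hilbert_fun mdeg X) L"
      using k by (auto simp: numerical_decomposition_def L_def sum_list_nth)
    moreover have "Hdepth_of H \<le> numerical_depth L"
      unfolding numerical_depth_def
    proof (rule INF_greatest, clarify)
      fix k' s assume "(k', s) \<in> set L"
      then obtain i where i: "i < length H" "k' = k i" by (auto simp: L_def)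
      let ?S = "fst (H ! i)"
      have alg: "graded_algebra field_ring ?S" using reti[OF i(1)] by (simp add: graded_retract_def)
      have "Hdepth_of H \<le> depth ?S (shift (self_module ?S) (- snd (H ! i)))"
        unfolding Hdepth_of_def using i(1)
        by (intro INF_lower2[of "H ! i"]) (auto simp: case_prod_unfold)
      also have "\<dots> \<le> enat (k i)"
      proof (rule depth_le_of_iso)
        show "cring ?S" using alg by (simp add: graded_algebra_def algebra_def)
        show "component ?S j \<subseteq> carrier ?S" for j
        proof -
          have "submodule (component ?S j) field_ring ?S"
            using alg by (simp add: graded_algebra_def graded_module_def)
          then show ?thesis using submodule.axioms(1) subgroup.subset by fastforce
        qed
        show "\<theta> i \<in> ring_hom (poly_ring (k i)) ?S" using \<theta>(1)[OF i(1)] by (simp add: graded_algebra_hom_def)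
      qed (rule \<theta>(2)[OF i(1)])
      finally show "Hdepth_of H \<le> enat k'" by (simp add: i(2))
    qed
    ultimately show "Hdepth_of H \<le> (SUP L \<in> {L. numerical_decomposition n (hilbert_fun mdeg X) L}. numerical_depth L)"
      by (intro SUP_upper2[of L]) simp_all
  next
    fix L assume "L \<in> {L. numerical_decomposition n (hilbert_fun mdeg X) L}"
    then have k: "\<And>k s. (k, s) \<in> set L \<Longrightarrow> k \<le> n"
      and hilb: "\<And>j. hilbert_fun mdeg X j = (\<Sum>i<length L. count_monomials (fst (L ! i)) (j - snd (L ! i)))"
      by (auto simp: numerical_decomposition_def sum_list_nth case_prod_unfold)
    define H where "H = map (\<lambda>(k, s). (poly_ring k :: ('a, 'a mpoly) graded, s)) L"
    have Hi: "fst (H ! i) = poly_ring (fst (L ! i))" "snd (H ! i) = snd (L ! i)" if "i < length L" for i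
      using that by (simp_all add: H_def case_prod_unfold)
    have lenH: "length H = length L" by (simp add: H_def)
    have "graded_isomorphic field_ring ?M (?sum H)"
    proof (rule hilbert_fun_eq_imp_graded_isomorphic[OF M sum_coord finX sum_fin])
      show "graded_coordinates (\<lambda>p. p) (monomials (fst (L ! i))) mdeg (fst (H ! i))" if "i < length H" for i
        using that by (simp add: lenH Hi graded_coordinates_poly_ring)
      show "hilbert_fun mdeg X j
          = hilbert_fun (\<lambda>(i, m). mdeg m + snd (H ! i)) (Sigma {..<length H} (\<lambda>i. monomials (fst (L ! i)))) j" for j
        unfolding sum_hilb hilb lenH by (rule sum.cong) (simp_all add: Hi)
    qed
    then have "hilbert_decomposition field_ring ?R ?M H"
      using graded_retract_smaller_poly_ring k by (auto simp: hilbert_decomposition_def H_def)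
    moreover have "numerical_depth L \<le> Hdepth_of H"
      unfolding Hdepth_of_def
    proof (rule INF_greatest, clarify)
      fix S :: "('a, 'a mpoly) graded" and s assume "(S, s) \<in> set H"
      then obtain k where k: "(k, s) \<in> set L" "S = poly_ring k" by (auto simp: H_def)
      have "numerical_depth L \<le> enat k"
        unfolding numerical_depth_def using k(1) by (intro INF_lower2[of "(k, s)"]) auto
      also have "\<dots> \<le> depth S (shift (self_module S) (- s))"
        unfolding k(2) by (rule depth_poly_ring_ge)
      finally show "numerical_depth L \<le> depth S (shift (self_module S) (- s))" .
    qed
    ultimately show "numerical_depth L \<le> (SUP H \<in> {H. hilbert_decomposition field_ring ?R ?M H}. Hdepth_of H)"
      by (intro SUP_upper2[of H]) simp_all
  qed
qed

section \<open>Powers of the maximal ideal and squarefree Veronese ideals\<close>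

lemma ideal_supported:
  assumes X: "X \<subseteq> monomials n" and up: "\<And>m x. m \<in> monomials n \<Longrightarrow> x \<in> X \<Longrightarrow> m + x \<in> X"
  shows "ideal (supported X) (poly_ring n :: ('a::field, 'a mpoly) graded)"
proof -
  let ?R = "poly_ring n :: ('a, 'a mpoly) graded"
  interpret cring ?R by (rule cring_poly_ring)
  have sub: "supported X \<subseteq> polys n" unfolding polys_eq_supported using X by (rule supported_mono)
  have mul: "p * q \<in> supported X" if "p \<in> polys n" "q \<in> supported X" for p q :: "'a mpoly"
    using that unfolding polys_eq_supported by (rule supported_mult) (rule up)
  have inv: "inv\<^bsub>add_monoid ?R\<^esub> p \<in> supported X" if "p \<in> supported X" for p :: "'a mpoly"
    using a_inv_poly_ring[of p n] subsetD[OF sub that] supported_uminus[OF that] by (simp add: a_inv_def)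
  show ?thesis
  proof (rule idealI[OF ring_axioms])
    show "subgroup (supported X) (add_monoid ?R)"
      by (rule subgroup.intro) (use sub inv supported_add in simp_all)
    show "x \<otimes>\<^bsub>?R\<^esub> a \<in> supported X" if "a \<in> supported X" "x \<in> carrier ?R" for a x
      using mul[of x a] that by simp
    show "a \<otimes>\<^bsub>?R\<^esub> x \<in> supported X" if "a \<in> supported X" "x \<in> carrier ?R" for a x
      using mul[of x a] that by (simp add: mult.commute)
  qed
qed

text \<open>
  A monomial ideal is the span of its monomials. The hypothesis on \<open>G\<close> says that every monomial in \<open>X\<close>
  is a multiple of a generator.
\<close>

lemma genideal_eq_supported:
  fixes G :: "'a::field mpoly set"
  assumes X: "X \<subseteq> monomials n" and up: "\<And>m x. m \<in> monomials n \<Longrightarrow> x \<in> X \<Longrightarrow> m + x \<in> X"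
    and G: "G \<subseteq> supported X"
    and gen: "\<And>x. x \<in> X \<Longrightarrow> \<exists>m g. m \<in> monomials n \<and> Poly_Mapping.single g 1 \<in> G \<and> x = m + g"
  shows "Idl\<^bsub>poly_ring n\<^esub> G = supported X"
proof -
  let ?R = "poly_ring n :: ('a, 'a mpoly) graded"
  have sub: "supported X \<subseteq> (polys n :: 'a mpoly set)"
    unfolding polys_eq_supported using X by (rule supported_mono)
  have ring: "ring ?R" using cring_poly_ring by (rule cring.axioms)
  have Gsub: "G \<subseteq> carrier ?R" using G sub by simp
  show ?thesis
  proof
    show "Idl\<^bsub>?R\<^esub> G \<subseteq> supported X"
      using ring.genideal_minimal[OF ring ideal_supported[OF X up] G] by simp
    have I: "ideal (Idl\<^bsub>?R\<^esub> G) ?R" using ring Gsub by (rule ring.genideal_ideal)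
    have add: "p + q \<in> Idl\<^bsub>?R\<^esub> G" if "p \<in> Idl\<^bsub>?R\<^esub> G" "q \<in> Idl\<^bsub>?R\<^esub> G" for p q
      using additive_subgroup.a_closed[OF ideal.axioms(1)[OF I] that] by simp
    have zero: "0 \<in> Idl\<^bsub>?R\<^esub> G"
      using additive_subgroup.zero_closed[OF ideal.axioms(1)[OF I]] by simp
    show "supported X \<subseteq> Idl\<^bsub>?R\<^esub> G"
    proof
      fix p :: "'a mpoly" assume p: "p \<in> supported X"
      have mon: "Poly_Mapping.single x c \<in> Idl\<^bsub>?R\<^esub> G" if x: "x \<in> X" for x c
      proof -
        obtain m g where mg: "m \<in> monomials n" "Poly_Mapping.single g 1 \<in> G" "x = m + g"
          using gen[OF x] by blast
        have "Poly_Mapping.single g 1 \<in> Idl\<^bsub>?R\<^esub> G"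
          using ring.genideal_self[OF ring Gsub] mg(2) by (rule subsetD)
        then have "Poly_Mapping.single m c \<otimes>\<^bsub>?R\<^esub> Poly_Mapping.single g 1 \<in> Idl\<^bsub>?R\<^esub> G"
          by (rule ideal.I_l_closed[OF I]) (simp add: polys_eq_supported mg(1))
        then show ?thesis by (simp add: mult_single mg(3))
      qed
      have "(\<Sum>x\<in>A. Poly_Mapping.single x (Poly_Mapping.lookup p x)) \<in> Idl\<^bsub>?R\<^esub> G"
        if "finite A" "A \<subseteq> X" for A
        using that by (induction A rule: finite_induct) (simp_all add: zero add mon)
      from this[of "Poly_Mapping.keys p"] p show "p \<in> Idl\<^bsub>?R\<^esub> G"
        by (simp add: sum_singles supported_def)
    qed
  qed
qed

lemma maximal_ideal_eq: "maximal_ideal n = (supported (high_monomials n 1) :: 'a::field mpoly set)"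
  unfolding maximal_ideal_def
proof (rule genideal_eq_supported)
  show "high_monomials n 1 \<subseteq> monomials n" by (auto simp: high_monomials_def)
  show "m + x \<in> high_monomials n 1" if "m \<in> monomials n" "x \<in> high_monomials n 1" for m x
    using that by (simp add: high_monomials_def monomial_degree_add)
  show "var ` {..<n} \<subseteq> supported (high_monomials n 1)"
    by (auto simp: var_def high_monomials_def)
  show "\<exists>m g. m \<in> monomials n \<and> Poly_Mapping.single g (1::'a) \<in> var ` {..<n} \<and> x = m + g"
    if x: "x \<in> high_monomials n 1" for x
  proof -
    have "x \<noteq> 0" using x by (auto simp: high_monomials_def)
    then obtain i where i: "Poly_Mapping.lookup x i \<noteq> 0" by (auto simp: poly_mapping_eq_iff fun_eq_iff)
    then obtain m where m: "x = m + Poly_Mapping.single i 1" by (rule monomial_times_var)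
    then have "m \<in> monomials n" "i < n" using x by (simp_all add: high_monomials_def)
    then show ?thesis using m by (auto simp: var_def)
  qed
qed

text \<open>
  A monomial of degree at least \<open>s + 1\<close> is a variable times a monomial of degree at least \<open>s\<close>. The case
  \<open>s = 0\<close> is the unit ideal, the unit of the monoid of ideals.
\<close>

lemma maximal_ideal_power_eq:
  "(maximal_ideal n :: 'a::field mpoly set) [^]\<^bsub>ideals_set (poly_ring n :: ('a, 'a mpoly) graded)\<^esub> s
    = supported (high_monomials n s)"
proof (induction s)
  case 0
  show ?case by (simp add: nat_pow_def ideals_set_def polys_eq_supported high_monomials_def)
next
  case (Suc s)
  let ?R = "poly_ring n :: ('a, 'a mpoly) graded"
  let ?P = "\<lambda>s. supported (high_monomials n s) :: 'a mpoly set"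
  have "ideal_prod ?R (?P s) (?P 1) = ?P (Suc s)"
  proof (intro equalityI subsetI)
    fix p assume "p \<in> ideal_prod ?R (?P s) (?P 1)"
    then show "p \<in> ?P (Suc s)"
    proof (induction p rule: ideal_prod.induct)
      case (prod p q)
      show ?case
        unfolding poly_ring_simps using prod
        by (rule supported_mult) (simp add: high_monomials_def monomial_degree_add)
    next
      case (sum p q)
      then show ?case by (simp add: supported_add)
    qed
  next
    fix p assume p: "p \<in> ?P (Suc s)"
    have add: "p + q \<in> ideal_prod ?R (?P s) (?P 1)"
      if "p \<in> ideal_prod ?R (?P s) (?P 1)" "q \<in> ideal_prod ?R (?P s) (?P 1)" for p q
      using ideal_prod.sum[OF that] by simp
    have mult: "p * q \<in> ideal_prod ?R (?P s) (?P 1)" if "p \<in> ?P s" "q \<in> ?P 1" for p q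
      using ideal_prod.prod[OF that, of ?R] by simp
    have zero: "0 \<in> ideal_prod ?R (?P s) (?P 1)" using mult[of 0 0] by simp
    have mon: "Poly_Mapping.single x c \<in> ideal_prod ?R (?P s) (?P 1)" if x: "x \<in> high_monomials n (Suc s)" for x c
    proof -
      have "x \<noteq> 0" using x by (auto simp: high_monomials_def)
      then obtain i where i: "Poly_Mapping.lookup x i \<noteq> 0" by (auto simp: poly_mapping_eq_iff fun_eq_iff)
      then obtain m where m: "x = m + Poly_Mapping.single i 1" by (rule monomial_times_var)
      then have "m \<in> high_monomials n s" "i < n"
        using x by (simp_all add: high_monomials_def monomial_degree_add)
      then have "Poly_Mapping.single m c * var i \<in> ideal_prod ?R (?P s) (?P 1)"
        by (intro mult) (simp_all add: var_def high_monomials_def)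
      then show ?thesis by (simp add: var_def mult_single m)
    qed
    have "(\<Sum>x\<in>A. Poly_Mapping.single x (Poly_Mapping.lookup p x)) \<in> ideal_prod ?R (?P s) (?P 1)"
      if "finite A" "A \<subseteq> high_monomials n (Suc s)" for A
      using that by (induction A rule: finite_induct) (simp_all del: One_nat_def add: zero add mon)
    from this[of "Poly_Mapping.keys p"] p show "p \<in> ideal_prod ?R (?P s) (?P 1)"
      by (simp add: sum_singles supported_def)
  qed
  then show ?case using Suc.IH by (simp add: nat_pow_def ideals_set_def maximal_ideal_eq)
qed

lemma squarefree_veronese_eq: "squarefree_veronese n d = (supported (wide_monomials n d) :: 'a::field mpoly set)"
  unfolding squarefree_veronese_def
proof (rule genideal_eq_supported)
  let ?e = "\<lambda>A. \<Sum>i\<in>A. Poly_Mapping.single i (1::nat)"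
  have prod: "(\<Prod>i\<in>A. var i :: 'a mpoly) = Poly_Mapping.single (?e A) 1" if "finite A" for A
    unfolding var_def using that by (rule single_prod)
  have le: "Poly_Mapping.lookup (?e A) i = (if i \<in> A then 1 else 0)" if "finite A" for A i
    using that by (simp add: lookup_sum lookup_single when_def)
  have keys: "Poly_Mapping.keys (?e A) = A" if "finite A" for A
    using le[OF that] by (auto simp: in_keys_iff split: if_splits)
  show "wide_monomials n d \<subseteq> monomials n" by (auto simp: wide_monomials_def)
  show "m + x \<in> wide_monomials n d" if "m \<in> monomials n" "x \<in> wide_monomials n d" for m x
  proof -
    have "card (Poly_Mapping.keys x) \<le> card (Poly_Mapping.keys (m + x))"
      by (rule card_mono) (auto simp: keys_add_nat)
    then show ?thesis using that by (simp add: wide_monomials_def)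
  qed
  show "{\<Prod>i\<in>A. var i | A. A \<subseteq> {..<n} \<and> card A = d} \<subseteq> (supported (wide_monomials n d) :: 'a mpoly set)"
  proof clarify
    fix A assume A: "A \<subseteq> {..<n}" "d = card A"
    then have "finite A" using finite_subset by blast
    then show "(\<Prod>i\<in>A. var i) \<in> (supported (wide_monomials n (card A)) :: 'a mpoly set)"
      using A by (simp del: One_nat_def add: prod wide_monomials_def monomials_def keys)
  qed
  show "\<exists>m g. m \<in> monomials n \<and> Poly_Mapping.single g (1::'a) \<in> {\<Prod>i\<in>A. var i | A. A \<subseteq> {..<n} \<and> card A = d}
      \<and> x = m + g" if x: "x \<in> wide_monomials n d" for x
  proof -
    obtain A where A: "A \<subseteq> Poly_Mapping.keys x" "card A = d" "finite A"
      using obtain_subset_with_card_n[of d "Poly_Mapping.keys x"] x by (auto simp: wide_monomials_def)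
    have xn: "Poly_Mapping.keys x \<subseteq> {..<n}" using x by (simp add: wide_monomials_def monomials_def)
    have eq: "x = (x - ?e A) + ?e A"
    proof (rule poly_mapping_eqI)
      fix i
      have "Poly_Mapping.lookup x i \<noteq> 0" if "i \<in> A" using A(1) that by (auto simp: in_keys_iff)
      then show "Poly_Mapping.lookup x i = Poly_Mapping.lookup ((x - ?e A) + ?e A) i"
        by (simp add: lookup_add lookup_minus le[OF A(3), simplified])
    qed
    have "x \<in> monomials n" using x by (simp add: wide_monomials_def)
    then have "x - ?e A \<in> monomials n" using monomials_add[of "x - ?e A" "?e A" n] eq by metis
    moreover have "Poly_Mapping.single (?e A) (1::'a) \<in> {\<Prod>i\<in>A. var i | A. A \<subseteq> {..<n} \<and> card A = d}"
      using A xn prod[OF A(3)] by (intro CollectI exI[of _ A]) auto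
    ultimately show ?thesis using eq by blast
  qed
qed

section \<open>Comparison of the two Hilbert depths\<close>

text \<open>
  Division of every term \<open>t\<^sup>s (1 - t)\<^bsup>-k\<^esup>\<close> by \<open>(1 - t)\<^bsup>e\<^esup>\<close>.
\<close>

definition raise_by :: "nat \<Rightarrow> (nat \<times> int) list \<Rightarrow> (nat \<times> int) list" where
  "raise_by e L = map (\<lambda>(k, s). (k + e, s)) L"

abbreviation total :: "(nat \<times> int) list \<Rightarrow> int \<Rightarrow> nat" where
  "total L j \<equiv> \<Sum>(k, s)\<leftarrow>L. count_monomials k (j - s)"

lemma total_raise_Suc:
  "total (raise_by (Suc e) L) j = total (raise_by e L) j + total (raise_by (Suc e) L) (j - 1)"
proof (induction L)
  case (Cons a L)
  obtain k s where "a = (k, s)" by (cases a)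
  then show ?case
    using Cons.IH count_monomials_Suc[of "k + e" "j - s"] by (simp add: raise_by_def algebra_simps)
qed (simp add: raise_by_def)

lemma total_raise_eventually_0: "\<exists>b. \<forall>j<b. total (raise_by e L) j = 0"
proof (induction L)
  case (Cons a L)
  obtain k s where a: "a = (k, s)" by (cases a)
  obtain b where b: "\<forall>j<b. total (raise_by e L) j = 0" using Cons.IH by blast
  have "total (raise_by e (a # L)) j = 0" if "j < min b s" for j
    using b that by (simp add: a raise_by_def hilbert_fun_neg)
  then show ?case by blast
qed (simp add: raise_by_def)

text \<open>
  Division of both sides of an identity of Laurent series by \<open>(1 - t)\<^bsup>e\<^esup>\<close> is reversible. One step is a
  first difference in one direction; the other direction is an induction on the degree that
  starts where both sides vanish.
\<close>

lemma total_raise_eq_stanley_sum_iff: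
  "(\<forall>j. stanley_sum m d e j = total (raise_by e L) j) \<longleftrightarrow> (\<forall>j. stanley_sum m d 0 j = total L j)"
proof (induction e)
  case 0
  show ?case by (simp add: raise_by_def)
next
  case (Suc e)
  have "(\<forall>j. stanley_sum m d (Suc e) j = total (raise_by (Suc e) L) j) \<longleftrightarrow>
      (\<forall>j. stanley_sum m d e j = total (raise_by e L) j)"
  proof
    assume eq: "\<forall>j. stanley_sum m d (Suc e) j = total (raise_by (Suc e) L) j"
    show "\<forall>j. stanley_sum m d e j = total (raise_by e L) j"
    proof
      fix j
      show "stanley_sum m d e j = total (raise_by e L) j"
        using stanley_sum_integrate[of m d e j] total_raise_Suc[where e = e and L = L and j = j] eq by simp
    qed
  next
    assume eq: "\<forall>j. stanley_sum m d e j = total (raise_by e L) j"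
    obtain b where b: "\<forall>j<b. total (raise_by (Suc e) L) j = 0"
      using total_raise_eventually_0 by blast
    show "\<forall>j. stanley_sum m d (Suc e) j = total (raise_by (Suc e) L) j"
    proof
      fix j
      show "stanley_sum m d (Suc e) j = total (raise_by (Suc e) L) j"
      proof (induction j rule: int_induct_from[where b = "min b 0"])
        case (1 j)
        then show ?case using b by (simp add: stanley_sum_neg)
      next
        case (2 j)
        then show ?case
          using stanley_sum_integrate[of m d e j] total_raise_Suc[where e = e and L = L and j = j] eq by simp
      qed
    qed
  qed
  then show ?case using Suc.IH by simp
qed

text \<open>
  The defining sum of \<open>stanley_sum\<close> is itself a decomposition. The existence of at least one
  decomposition matters, because the supremum over an empty set would be zero and would not be raised
  together with the exponents.
\<close>

lemma stanley_sum_decomposition: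
  "\<exists>L. numerical_decomposition m (stanley_sum m d 0) L"
proof -
  let ?L = "concat (map (\<lambda>i. replicate ((d + i - 1) choose i) (m - i, int d)) [0..<m])"
  have "total ?L j = stanley_sum m d 0 j" for j
  proof -
    have "total (concat (map (\<lambda>i. replicate (c i) (m - i, int d)) [0..<l])) j
        = (\<Sum>i<l. c i * count_monomials (m - i) (j - int d))" for c :: "nat \<Rightarrow> nat" and l
      by (induction l) (simp_all add: sum_list_replicate)
    then show ?thesis by (simp add: stanley_sum_def)
  qed
  then show ?thesis unfolding numerical_decomposition_def by (intro exI[of _ ?L]) auto
qed

lemma numerical_depth_raise: "numerical_depth (raise_by e L) = enat e + numerical_depth L"
proof (rule antisym)
  show "enat e + numerical_depth L \<le> numerical_depth (raise_by e L)"
    unfolding numerical_depth_def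
  proof (rule INF_greatest, clarify)
    fix k s assume "(k, s) \<in> set (raise_by e L)"
    then obtain k' where k: "k = k' + e" "(k', s) \<in> set L" by (auto simp: raise_by_def)
    have "(INF (k, s) \<in> set L. enat k) \<le> enat k'"
      using k(2) by (intro INF_lower2[of "(k', s)"]) auto
    then have "enat e + (INF (k, s) \<in> set L. enat k) \<le> enat e + enat k'" by (rule add_left_mono)
    then show "enat e + (INF (k, s) \<in> set L. enat k) \<le> enat k" by (simp add: k(1) add.commute)
  qed
  show "numerical_depth (raise_by e L) \<le> enat e + numerical_depth L"
  proof -
    have le: "numerical_depth (raise_by e L) \<le> enat (k + e)" if "(k, s) \<in> set L" for k s
      unfolding numerical_depth_def using that
      by (intro INF_lower2[of "(k + e, s)"]) (auto simp: raise_by_def)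
    show ?thesis
    proof (cases "numerical_depth (raise_by e L)")
      case infinity
      have "set L = {}"
      proof (rule equals0I)
        fix a assume "a \<in> set L"
        then have "(fst a, snd a) \<in> set L" by simp
        from le[OF this] infinity show False by simp
      qed
      then show ?thesis by (simp add: numerical_depth_def top_enat_def)
    next
      case (enat b)
      have "enat (b - e) \<le> numerical_depth L"
        unfolding numerical_depth_def
      proof (rule INF_greatest, clarify)
        fix k s assume "(k, s) \<in> set L"
        from le[OF this] show "enat (b - e) \<le> enat k" by (simp add: enat)
      qed
      then have "enat e + enat (b - e) \<le> enat e + numerical_depth L" by (rule add_left_mono)
      moreover have "enat b \<le> enat e + enat (b - e)" by simp
      ultimately show ?thesis unfolding enat by (rule order_trans[rotated])
    qed
  qed
qed

text \<open>
  Elements of \<open>B\<close> that do not come from \<open>A\<close> are harmless as long as they do not exceed \<open>e\<close>, since \<open>A\<close> is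
  nonempty.
\<close>

lemma Sup_enat_shift:
  fixes A B :: "enat set"
  assumes "A \<noteq> {}" and AB: "\<And>a. a \<in> A \<Longrightarrow> enat e + a \<in> B"
    and BA: "\<And>b. b \<in> B \<Longrightarrow> b \<le> enat e \<or> (\<exists>a \<in> A. b = enat e + a)"
  shows "Sup B = enat e + Sup A"
proof (rule antisym)
  show "Sup B \<le> enat e + Sup A"
  proof (rule Sup_least)
    fix b assume "b \<in> B"
    then consider "b \<le> enat e" | a where "a \<in> A" "b = enat e + a" using BA by blast
    then show "b \<le> enat e + Sup A"
    proof cases
      case 1
      then show ?thesis by (rule order_trans) simp
    next
      case 2
      then show ?thesis by (simp add: Sup_upper add_left_mono)
    qed
  qed
  show "enat e + Sup A \<le> Sup B"
  proof (cases "Sup B")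
    case (enat b)
    have le: "enat e + a \<le> enat b" if "a \<in> A" for a
      using Sup_upper[OF AB[OF that]] by (simp add: enat)
    obtain a0 where "a0 \<in> A" using \<open>A \<noteq> {}\<close> by blast
    have "enat e \<le> enat e + a0" by simp
    also have "\<dots> \<le> enat b" using \<open>a0 \<in> A\<close> by (rule le)
    finally have "e \<le> b" by simp
    have "Sup A \<le> enat (b - e)"
    proof (rule Sup_least)
      fix a assume "a \<in> A"
      from le[OF this] show "a \<le> enat (b - e)" by (cases a) auto
    qed
    then have "enat e + Sup A \<le> enat e + enat (b - e)" by (rule add_left_mono)
    then show ?thesis using \<open>e \<le> b\<close> by (simp add: enat)
  qed simp
qed

text \<open>
  Raising all exponents by \<open>e\<close> maps the decompositions of the power of the maximal ideal onto those
  decompositions of the squarefree Veronese ideal whose exponents are all at least \<open>e\<close>. The remaining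
  ones have numerical depth less than \<open>e\<close> and cannot exceed the raised ones.
\<close>

theorem Hdepth_squarefree_veronese_eq:
  assumes "m \<ge> 1"
  shows "Hdepth_ideal (m + e) (squarefree_veronese (m + e) (Suc e) :: 'a::field mpoly set)
    = enat e + Hdepth_ideal m
        ((maximal_ideal m :: 'a mpoly set) [^]\<^bsub>ideals_set (poly_ring m :: ('a, 'a mpoly) graded)\<^esub> (Suc e))"
proof -
  let ?d = "Suc e"
  let ?A = "{L. numerical_decomposition m (stanley_sum m ?d 0) L}"
  let ?B = "{L. numerical_decomposition (m + e) (stanley_sum m ?d e) L}"
  have high: "hilbert_fun mdeg (high_monomials m ?d) = stanley_sum m ?d 0"
    by (rule ext) (simp add: hilbert_high)
  have wide: "hilbert_fun mdeg (wide_monomials (m + e) ?d) = stanley_sum m ?d e"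
    by (rule ext) (rule hilbert_wide)
  have A: "Hdepth_ideal m (supported (high_monomials m ?d) :: 'a mpoly set) = (SUP L\<in>?A. numerical_depth L)"
    by (subst Hdepth_monomial_ideal) (auto simp: high_monomials_def high[unfolded high_monomials_def])
  have B: "Hdepth_ideal (m + e) (supported (wide_monomials (m + e) ?d) :: 'a mpoly set)
      = (SUP L\<in>?B. numerical_depth L)"
    by (subst Hdepth_monomial_ideal) (auto simp: wide_monomials_def wide[unfolded wide_monomials_def])
  have raise: "numerical_decomposition (m + e) (stanley_sum m ?d e) (raise_by e L)
      \<longleftrightarrow> numerical_decomposition m (stanley_sum m ?d 0) L" for L
    using total_raise_eq_stanley_sum_iff[where m = m and d = ?d and e = e and L = L]
    by (fastforce simp: numerical_decomposition_def raise_by_def)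
  have "(SUP L\<in>?B. numerical_depth L) = enat e + (SUP L\<in>?A. numerical_depth L)"
  proof (rule Sup_enat_shift)
    show "numerical_depth ` ?A \<noteq> {}" using stanley_sum_decomposition[of m ?d] by blast
    show "enat e + a \<in> numerical_depth ` ?B" if a: "a \<in> numerical_depth ` ?A" for a
    proof -
      obtain L where "L \<in> ?A" "a = numerical_depth L" using a by blast
      then show ?thesis
        using raise[of L] by (intro image_eqI[of _ _ "raise_by e L"]) (simp_all add: numerical_depth_raise)
    qed
    show "b \<le> enat e \<or> (\<exists>a\<in>numerical_depth ` ?A. b = enat e + a)" if b: "b \<in> numerical_depth ` ?B" for b
    proof -
      obtain L where L: "L \<in> ?B" "b = numerical_depth L" using b by blast
      show ?thesis
      proof (cases "\<forall>(k, s) \<in> set L. e \<le> k")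
        case True
        define L' where "L' = map (\<lambda>(k, s). (k - e, s)) L"
        have "raise_by e L' = L"
          unfolding raise_by_def L'_def map_map by (rule map_idI) (use True in auto)
        then show ?thesis
          using L raise[of L'] numerical_depth_raise[of e L'] by auto
      next
        case False
        then obtain k s where k: "(k, s) \<in> set L" "k < e" by auto
        have "b \<le> enat k"
          unfolding L(2) numerical_depth_def using k(1) by (intro INF_lower2[of "(k, s)"]) auto
        also have "\<dots> \<le> enat e" using k(2) by simp
        finally show ?thesis by blast
      qed
    qed
  qed
  then show ?thesis
    unfolding squarefree_veronese_eq maximal_ideal_power_eq A B .
qed

theorem theorem1p3:
  fixes K :: "'a::field itself"
  shows
    "(\<forall>n s :: nat. n \<ge> 1 \<longrightarrow> s \<ge> 1 \<longrightarrow>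
        Hdepth_ideal n
          ((maximal_ideal n :: 'a mpoly set) [^]\<^bsub>ideals_set (poly_ring n :: ('a, 'a mpoly) graded)\<^esub> s)
        = enat (nat \<lceil>real n / (real s + 1)\<rceil>))
     \<longleftrightarrow>
     (\<forall>n d :: nat. n \<ge> d \<longrightarrow> d \<ge> 1 \<longrightarrow>
        Hdepth_ideal n (squarefree_veronese n d :: 'a mpoly set)
        = enat (d - 1 + nat \<lceil>(real n - (real d - 1)) / (real d + 1)\<rceil>))"
    (is "?A \<longleftrightarrow> ?B")
proof
  assume A: ?A
  show ?B
  proof (intro allI impI)
    fix n d :: nat assume "n \<ge> d" "d \<ge> 1"
    \<comment> \<open>With these parameters \<open>real n - (real d - 1)\<close> is \<open>real m\<close>.\<close>
    define e m where "e = d - 1" and "m = n - e"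
    have d: "d = Suc e" and n: "n = m + e" and m: "m \<ge> 1"
      using \<open>n \<ge> d\<close> \<open>d \<ge> 1\<close> by (simp_all add: e_def m_def)
    show "Hdepth_ideal n (squarefree_veronese n d :: 'a mpoly set)
        = enat (d - 1 + nat \<lceil>(real n - (real d - 1)) / (real d + 1)\<rceil>)"
    proof -
      have "Suc e \<ge> 1" by simp
      with A m have "Hdepth_ideal m
          ((maximal_ideal m :: 'a mpoly set) [^]\<^bsub>ideals_set (poly_ring m :: ('a, 'a mpoly) graded)\<^esub> Suc e)
          = enat (nat \<lceil>real m / (real (Suc e) + 1)\<rceil>)"
        by blast
      then show ?thesis unfolding d n Hdepth_squarefree_veronese_eq[OF m] by simp
    qed
  qed
next
  assume B: ?B
  show ?A
  proof (intro allI impI)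
    fix n s :: nat assume n: "n \<ge> 1" and "s \<ge> 1"
    define e where "e = s - 1"
    have s: "s = Suc e" using \<open>s \<ge> 1\<close> by (simp add: e_def)
    have "Hdepth_ideal (n + e) (squarefree_veronese (n + e) s :: 'a mpoly set)
        = enat (s - 1 + nat \<lceil>(real (n + e) - (real s - 1)) / (real s + 1)\<rceil>)"
      using B n by (simp add: s)
    then have "enat e + Hdepth_ideal n
          ((maximal_ideal n :: 'a mpoly set) [^]\<^bsub>ideals_set (poly_ring n :: ('a, 'a mpoly) graded)\<^esub> s)
        = enat e + enat (nat \<lceil>real n / (real s + 1)\<rceil>)"
      unfolding s Hdepth_squarefree_veronese_eq[OF n] by simp
    then show "Hdepth_ideal n
          ((maximal_ideal n :: 'a mpoly set) [^]\<^bsub>ideals_set (poly_ring n :: ('a, 'a mpoly) graded)\<^esub> s)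
        = enat (nat \<lceil>real n / (real s + 1)\<rceil>)"
      by (simp only: enat_add_left_cancel) simp
  qed
qed

end
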